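(* For any fixed value $T$, the WCM configuration LP with bound $T$ can be solved (it can be decided whether it is feasible and, if so, a feasible solution computed) in time polynomial in $m$, $k$ and $W=\sum_{\ell=1}^kw_\ell$.
   Context: Setting: scores $\alpha_0\le\cdots\le\alpha_{m-1}$, nonnegative integers bounded by a polynomial in $m$; candidates $c_1,\ldots,c_m$ with integer initial scores $\sigma_1,\ldots,\sigma_m$; $k$ manipulators with positive integer weights $w_1,\ldots,w_k$; $[m]=\{1,\ldots,m\}$, $[m]_0=\{0,\ldots,m-1\}$, $[k]=\{1,\ldots,k\}$. A configuration is a sequence $C=(C_1,\ldots,C_k)$ with $C_\ell\in[m]_0$. $\mathcal{C}_i(T)$ is the set of configurations with $\sum_{\ell}w_\ell\alpha_{C_\ell}\le T-\sigma_i$. The WCM configuration LP has variables $x_{i,C}\ge0$ for $i\in[m]$, $C\in\mathcal{C}_i(T)$ (exponentially many), and constraints $\sum_{C\in\mathcal{C}_i(T)}x_{i,C}\le1$ for all $i\in[m]$ and $\sum_i\sum_{C\in\mathcal{C}_i(T),\,C_\ell=j}x_{i,C}\ge1$ for all $j\in[m]_0,\ell\in[k]$. *)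

theory Defs
  imports Complex_Main "HOL-Library.FuncSet" "HOL-Computational_Algebra.Polynomial"
begin

section \<open>Weighted coalitional manipulation and its configuration LP\<close>

text \<open>Candidates are indexed by \<open>{1..m}\<close>, scores by \<open>{0..<m}\<close> and manipulators by \<open>{1..k}\<close>.
  Values of the function fields outside these ranges play no role.\<close>

record wcm =
  cands :: nat                  \<comment> \<open>\<open>m\<close>\<close>
  manips :: nat                 \<comment> \<open>\<open>k\<close>\<close>
  score :: "nat \<Rightarrow> nat"         \<comment> \<open>\<open>\<alpha>\<^sub>0, \<dots>, \<alpha>\<^sub>m\<^sub>-\<^sub>1\<close>\<close>
  init_score :: "nat \<Rightarrow> int"    \<comment> \<open>\<open>\<sigma>\<^sub>1, \<dots>, \<sigma>\<^sub>m\<close>\<close>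
  weight :: "nat \<Rightarrow> nat"        \<comment> \<open>\<open>w\<^sub>1, \<dots>, w\<^sub>k\<close>\<close>

definition wcm_instance :: "wcm \<Rightarrow> bool" where
  "wcm_instance I \<longleftrightarrow>
     mono_on {..<cands I} (score I) \<and> (\<forall>l\<in>{1..manips I}. 0 < weight I l)"

definition scores_bounded :: "nat poly \<Rightarrow> wcm \<Rightarrow> bool" where
  "scores_bounded q I \<longleftrightarrow> (\<forall>j<cands I. score I j \<le> poly q (cands I))"

definition total_weight :: "wcm \<Rightarrow> nat" where
  "total_weight I = (\<Sum>l=1..manips I. weight I l)"

definition configs :: "wcm \<Rightarrow> int \<Rightarrow> nat \<Rightarrow> (nat \<Rightarrow> nat) set" where
  "configs I T i =
     {C \<in> {1..manips I} \<rightarrow>\<^sub>E {..<cands I}.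
        int (\<Sum>l=1..manips I. weight I l * score I (C l)) \<le> T - init_score I i}"

definition lp_vars :: "wcm \<Rightarrow> int \<Rightarrow> (nat \<times> (nat \<Rightarrow> nat)) set" where
  "lp_vars I T = (SIGMA i:{1..cands I}. configs I T i)"

definition lp_feasible :: "wcm \<Rightarrow> int \<Rightarrow> (nat \<Rightarrow> (nat \<Rightarrow> nat) \<Rightarrow> real) \<Rightarrow> bool" where
  "lp_feasible I T x \<longleftrightarrow>
     (\<forall>(i, C)\<in>lp_vars I T. 0 \<le> x i C) \<and>
     (\<forall>i\<in>{1..cands I}. (\<Sum>C\<in>configs I T i. x i C) \<le> 1) \<and>
     (\<forall>j<cands I. \<forall>l\<in>{1..manips I}.
        1 \<le> (\<Sum>i=1..cands I. \<Sum>C\<in>{C \<in> configs I T i. C l = j}. x i C))"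


section \<open>Machine model\<close>

text \<open>
  A random access machine over the integers in structured form: programs work on integer variables
  and integer arrays with computed indices. Every elementary operation costs one unit. The only
  arithmetic operations are addition and subtraction, so the bit length of the numbers grows by at
  most a constant (depending on the program) per unit of time; hence unit cost is polynomially
  equivalent to Turing machine time. Adding unit-cost multiplication would destroy this.
\<close>

datatype aexp =
    N int
  | V string
  | Arr string aexp
  | Add aexp aexp
  | Sub aexp aexp

datatype bexp =
    Less aexp aexp
  | Neg bexp
  | Conj bexp bexp

datatype com =
    Skip
  | Assign string aexp
  | Store string aexp aexp      \<comment> \<open>array, index, value\<close>
  | Seq com com
  | If bexp com com
  | While bexp com

record state =
  var :: "string \<Rightarrow> int"
  arr :: "string \<Rightarrow> int \<Rightarrow> int"

primrec aval :: "aexp \<Rightarrow> state \<Rightarrow> int" where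
  "aval (N n) s = n"
| "aval (V x) s = var s x"
| "aval (Arr a e) s = arr s a (aval e s)"
| "aval (Add d e) s = aval d s + aval e s"
| "aval (Sub d e) s = aval d s - aval e s"

primrec bval :: "bexp \<Rightarrow> state \<Rightarrow> bool" where
  "bval (Less d e) s \<longleftrightarrow> aval d s < aval e s"
| "bval (Neg b) s \<longleftrightarrow> \<not> bval b s"
| "bval (Conj b c) s \<longleftrightarrow> bval b s \<and> bval c s"

primrec acost :: "aexp \<Rightarrow> nat" where
  "acost (N n) = 1"
| "acost (V x) = 1"
| "acost (Arr a e) = acost e + 1"
| "acost (Add d e) = acost d + acost e + 1"
| "acost (Sub d e) = acost d + acost e + 1"

primrec bcost :: "bexp \<Rightarrow> nat" where
  "bcost (Less d e) = acost d + acost e + 1"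
| "bcost (Neg b) = bcost b + 1"
| "bcost (Conj b c) = bcost b + bcost c + 1"

text \<open>\<open>exec c s t s'\<close>: started in \<open>s\<close>, the program \<open>c\<close> halts after \<open>t\<close> time units in \<open>s'\<close>.\<close>

inductive exec :: "com \<Rightarrow> state \<Rightarrow> nat \<Rightarrow> state \<Rightarrow> bool" where
  Skip: "exec Skip s 1 s"
| Assign: "exec (Assign x e) s (acost e + 1) (s\<lparr>var := (var s)(x := aval e s)\<rparr>)"
| Store: "exec (Store a d e) s (acost d + acost e + 1)
            (s\<lparr>arr := (arr s)(a := (arr s a)(aval d s := aval e s))\<rparr>)"
| Seq: "exec c s t s' \<Longrightarrow> exec d s' u s'' \<Longrightarrow> exec (Seq c d) s (t + u) s''"
| IfTrue: "bval b s \<Longrightarrow> exec c s t s' \<Longrightarrow> exec (If b c d) s (bcost b + t + 1) s'"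
| IfFalse: "\<not> bval b s \<Longrightarrow> exec d s t s' \<Longrightarrow> exec (If b c d) s (bcost b + t + 1) s'"
| WhileFalse: "\<not> bval b s \<Longrightarrow> exec (While b c) s (bcost b + 1) s"
| WhileTrue: "bval b s \<Longrightarrow> exec c s t s' \<Longrightarrow> exec (While b c) s' u s'' \<Longrightarrow>
     exec (While b c) s (bcost b + t + u + 1) s''"

inductive_cases SkipE: "exec Skip s t s'"
inductive_cases AssignE: "exec (Assign x e) s t s'"
inductive_cases StoreE: "exec (Store a d e) s t s'"
inductive_cases SeqE: "exec (Seq c d) s t s'"
inductive_cases IfE: "exec (If b c d) s t s'"
inductive_cases WhileE: "exec (While b c) s t s'"

lemma exec_deterministic:
  "exec c s t s' \<Longrightarrow> exec c s u s'' \<Longrightarrow> u = t \<and> s'' = s'"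
proof (induction arbitrary: u s'' rule: exec.induct)
  case (Skip s)
  then show ?case by (elim SkipE) simp
next
  case (Assign x e s)
  then show ?case by (elim AssignE) simp
next
  case (Store a d e s)
  then show ?case by (elim StoreE) simp
next
  case (Seq c s t s' d v r)
  from Seq.prems obtain t2 s2 v2
    where "exec c s t2 s2" "exec d s2 v2 s''" "u = t2 + v2"
    by (elim SeqE)
  with Seq.IH(1)[of t2 s2] Seq.IH(2)[of v2 s''] show ?case by simp
next
  case (IfTrue b s c t s' d)
  from IfTrue.prems IfTrue.hyps(1) obtain t2 where "exec c s t2 s''" "u = bcost b + t2 + 1"
    by (elim IfE) simp_all
  with IfTrue.IH[of t2 s''] show ?case by simp
next
  case (IfFalse b s d t s' c)
  from IfFalse.prems IfFalse.hyps(1) obtain t2 where "exec d s t2 s''" "u = bcost b + t2 + 1"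
    by (elim IfE) simp_all
  with IfFalse.IH[of t2 s''] show ?case by simp
next
  case (WhileFalse b s c)
  from WhileFalse.prems show ?case by (rule WhileE) (use WhileFalse.hyps(1) in simp_all)
next
  case (WhileTrue b s c t s' v r)
  from WhileTrue.prems obtain t2 s2 v2
    where "exec c s t2 s2" "exec (While b c) s2 v2 s''" "u = bcost b + t2 + v2 + 1"
    by (rule WhileE) (use WhileTrue.hyps(1) in simp_all)
  with WhileTrue.IH(1)[of t2 s2] WhileTrue.IH(2)[of v2 s''] show ?case by simp
qed

text \<open>Evaluation of a polynomial in three indeterminates; the innermost one is the last argument.\<close>

definition poly3 :: "nat poly poly poly \<Rightarrow> nat \<Rightarrow> nat \<Rightarrow> nat \<Rightarrow> nat" where
  "poly3 P a b c = poly (poly (poly P [:[:a:]:]) [:b:]) c"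


section \<open>Input and output\<close>

text \<open>All memory not holding the input is zero.\<close>

definition input :: "wcm \<Rightarrow> int \<Rightarrow> state" where
  "input I T =
     \<lparr>var = (\<lambda>_. 0)(''m'' := int (cands I), ''k'' := int (manips I), ''T'' := T),
      arr = (\<lambda>_ _. 0)
        (''alpha'' := (\<lambda>z. if z \<in> {0..<int (cands I)} then int (score I (nat z)) else 0),
         ''sigma'' := (\<lambda>z. if z \<in> {1..int (cands I)} then init_score I (nat z) else 0),
         ''w'' := (\<lambda>z. if z \<in> {1..int (manips I)} then int (weight I (nat z)) else 0))\<rparr>"

text \<open>A solution has exponentially many coordinates, so it is output as the list of its nonzero
  ones (zero coordinates may be listed as well). The list has length \<open>''count''\<close>; its entry number
  \<open>e\<close> consists of the candidate \<open>''cand''[e]\<close>, the configuration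
  \<open>''conf''[e * k + 1], \<dots>, ''conf''[e * k + k]\<close>, and the value \<open>''num''[e] / ''den''[e]\<close>.\<close>

definition entry_at :: "nat \<Rightarrow> state \<Rightarrow> nat \<Rightarrow> nat \<Rightarrow> (nat \<Rightarrow> nat) \<Rightarrow> bool" where
  "entry_at k s e i C \<longleftrightarrow>
     arr s ''cand'' (int e) = int i \<and>
     (\<forall>l\<in>{1..k}. arr s ''conf'' (int (e * k + l)) = int (C l))"

definition lists_solution ::
  "wcm \<Rightarrow> int \<Rightarrow> state \<Rightarrow> (nat \<Rightarrow> (nat \<Rightarrow> nat) \<Rightarrow> real) \<Rightarrow> bool" where
  "lists_solution I T s x \<longleftrightarrow>
     (let n = nat (var s ''count'') in
       (\<forall>e<n. \<exists>(i, C)\<in>lp_vars I T.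
          entry_at (manips I) s e i C \<and>
          0 < arr s ''den'' (int e) \<and>
          x i C = of_int (arr s ''num'' (int e)) / of_int (arr s ''den'' (int e))) \<and>
       (\<forall>(i, C)\<in>lp_vars I T.
          (\<nexists>e. e < n \<and> entry_at (manips I) s e i C) \<longrightarrow> x i C = 0))"

definition solves_config_lp :: "wcm \<Rightarrow> int \<Rightarrow> state \<Rightarrow> bool" where
  "solves_config_lp I T s \<longleftrightarrow>
     (if \<exists>x. lp_feasible I T x
      then var s ''feasible'' = 1 \<and> (\<exists>x. lp_feasible I T x \<and> lists_solution I T s x)
      else var s ''feasible'' = 0)"

end

theory Submission
  imports Defs "Jordan_Normal_Form.Determinant"
begin

text \<open>
  A configuration of a candidate is a path in a layered graph whose node after \<open>l\<close> manipulators is the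
  weighted score collected so far; these scores are polynomially bounded. A solution of the
  configuration LP therefore is a unit flow for every candidate, coupled by the covering constraints,
  which by counting hold with equality. This gives a homogeneous system \<open>A x = 0\<close>, \<open>x \<ge> 0\<close>, \<open>x\<^sub>0 > 0\<close>
  of polynomial size with entries in \<open>{-1, 0, 1}\<close>, and path decomposition turns a flow back into
  a solution with few nonzero coordinates.

  The system is solved exactly by Chubanov's rescaling algorithm. Let \<open>P\<close> be the orthogonal
  projection onto the kernel of \<open>A diag(s)\<close> and \<open>u\<close> a vector of counters. As long as some entry
  \<open>(P u)\<^sub>i\<close> is not positive, \<open>u\<^sub>i\<close> is incremented; this increases \<open>|P u|\<^sup>2\<close> by at most 1. Either \<open>P u\<close>
  becomes positive and yields a solution, or after \<open>4 n\<^sup>3\<close> steps the Cauchy-Schwarz inequality shows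
  that all solutions \<open>x \<le> s\<close> satisfy \<open>x\<^sub>j \<le> s\<^sub>j / 2\<close> where \<open>u\<^sub>j\<close> is largest, and \<open>s\<^sub>j\<close> is halved. A coordinate
  that is positive in some solution is at least \<open>1\<close> in a solution bounded by \<open>n\<^sup>R\<close>, so that \<open>s\<^sub>j\<close> can
  be set to \<open>0\<close> when it falls below \<open>1\<close>. A Gram determinant is a common denominator of the entries of
  \<open>P\<close>; hence all numbers have polynomially many bits and can be multiplied and divided bit by bit.
\<close>

section \<open>Projections and Gram determinants\<close>

text \<open>Feasibility is decided, so the arithmetic has to be exact, and since the machine only
  adds and subtracts, the length of every number has to be controlled. A projection meets both
  demands: its entries are at most 1 in absolute value, and their denominator is a product of pivots
  that obeys Hadamard's bound. Homogeneity turns the equations into a subspace, onto which one can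
  project, and allows every solution to be scaled into a fixed box. Deletion is forced by degenerate
  systems: a positive \<open>P u\<close> yields a solution without zero coordinates, so coordinates
  that vanish in all solutions have to go first. With \<open>s_j = 0\<close> the unit vector
  \<open>j\<close> lies in the kernel and the demand on that coordinate becomes trivial. The
  algorithm therefore always ends with a positive \<open>P u\<close>; infeasibility shows in the
  deletion of the homogenizing coordinate. There are at most \<open>n * (K + 1)\<close> decrements
  in all, and \<open>T\<close> and the initial scores enter only through comparisons, so their size
  does not affect the running time.\<close>

definition schur :: "('a \<Rightarrow> 'a \<Rightarrow> real) \<Rightarrow> 'a \<Rightarrow> 'a \<Rightarrow> 'a \<Rightarrow> real" where
  "schur B a x y = B x y - B x a * B a y / B a a"

definition gram :: "('a \<Rightarrow> 'a \<Rightarrow> real) \<Rightarrow> 'a list \<Rightarrow> 'a list \<Rightarrow> real mat" where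
  "gram B xs ys = mat (length xs) (length xs) (\<lambda>(i, j). B (xs ! i) (ys ! j))"

text \<open>Left multiplication by the unit lower triangular \<open>E\<close> clears the first
  column below the pivot and leaves the Schur complement in the lower right block. Two lists are
  allowed, so that minors whose last row and last column belong to different vectors are covered as
  well.\<close>

lemma det_gram_Cons:
  assumes "length xs = length ys" "B a a \<noteq> 0"
  shows "det (gram B (a # xs) (a # ys)) = B a a * det (gram (schur B a) xs ys)"
proof -
  let ?n = "length xs"
  define G where "G = gram B (a # xs) (a # ys)"
  define E where "E = mat (Suc ?n) (Suc ?n) (\<lambda>(i, j). if i = j then 1 else if j = 0 then - B (xs ! (i - 1)) a / B a a else 0)"
  define A1 where "A1 = mat 1 1 (\<lambda>_. B a a)"
  define A2 where "A2 = mat 1 ?n (\<lambda>(i, j). B a (ys ! j))"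
  define A4 where "A4 = gram (schur B a) xs ys"
  have EG: "E * G = four_block_mat A1 A2 (0\<^sub>m ?n 1) A4" (is "?l = ?r")
  proof (rule eq_matI)
    fix i j assume "i < dim_row ?r" "j < dim_col ?r"
    then have ij: "i < Suc ?n" "j < Suc ?n" by (auto simp: A1_def A4_def gram_def)
    have "(E * G) $$ (i, j) = (\<Sum>k\<in>{0..<Suc ?n}. E $$ (i, k) * G $$ (k, j))"
      using ij by (simp add: E_def G_def gram_def scalar_prod_def)
    also have "\<dots> = E $$ (i, 0) * G $$ (0, j) + (\<Sum>k\<in>{0..<?n}. E $$ (i, Suc k) * G $$ (Suc k, j))"
      by (subst sum.atLeast0_lessThan_Suc_shift) simp
    also have "(\<Sum>k\<in>{0..<?n}. E $$ (i, Suc k) * G $$ (Suc k, j))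
        = (\<Sum>k\<in>{0..<?n}. if k = i - 1 \<and> 0 < i then G $$ (i, j) else 0)"
      using ij by (intro sum.cong) (auto simp: E_def)
    also have "\<dots> = (if 0 < i then G $$ (i, j) else 0)"
      using ij by (auto simp: sum.delta)
    finally show "?l $$ (i, j) = ?r $$ (i, j)"
      using ij assms
      by (cases i; cases j) (auto simp: E_def G_def A1_def A2_def A4_def gram_def schur_def field_simps)
  qed (auto simp: E_def G_def gram_def A1_def A4_def)
  have "det E = 1"
  proof (subst det_lower_triangular[of "Suc ?n"])
    have "diag_mat E = replicate (Suc ?n) 1"
      unfolding list_eq_iff_nth_eq by (simp add: E_def diag_mat_def nth_append less_Suc_eq del: upt_Suc replicate_Suc)
    then show "prod_list (diag_mat E) = 1" by (simp del: replicate_Suc)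
  qed (auto simp: E_def)
  moreover have "det (E * G) = det E * det G"
    by (rule det_mult[of _ "Suc ?n"]) (auto simp: E_def G_def gram_def)
  moreover have "det (four_block_mat A1 A2 (0\<^sub>m ?n 1) A4) = det A1 * det A4"
    by (rule det_four_block_mat_lower_left_zero_col) (auto simp: A1_def A2_def A4_def gram_def)
  moreover have "det A1 = B a a"
    by (subst det_single) (auto simp: A1_def)
  ultimately show ?thesis using EG unfolding G_def A4_def by simp
qed

fun pivots :: "('a \<Rightarrow> 'a \<Rightarrow> real) \<Rightarrow> 'a list \<Rightarrow> bool" where
  "pivots B [] = True"
| "pivots B (a # l) = (B a a \<noteq> 0 \<and> pivots (schur B a) l)"

fun pivprod :: "('a \<Rightarrow> 'a \<Rightarrow> real) \<Rightarrow> 'a list \<Rightarrow> real" where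
  "pivprod B [] = 1"
| "pivprod B (a # l) = B a a * pivprod (schur B a) l"

fun schurs :: "('a \<Rightarrow> 'a \<Rightarrow> real) \<Rightarrow> 'a list \<Rightarrow> 'a \<Rightarrow> 'a \<Rightarrow> real" where
  "schurs B [] = B"
| "schurs B (a # l) = schurs (schur B a) l"

lemma schurs_snoc: "schurs B (l @ [a]) = schur (schurs B l) a"
  by (induction l arbitrary: B) auto

lemma pivprod_snoc: "pivprod B (l @ [a]) = pivprod B l * schurs B l a a"
  by (induction l arbitrary: B) auto

lemma pivots_snoc: "pivots B (l @ [a]) \<longleftrightarrow> pivots B l \<and> schurs B l a a \<noteq> 0"
  by (induction l arbitrary: B) auto

text \<open>Eliminating the common vectors one by one leaves a single entry next to the pivots. This
  is how an entry of a projection becomes a quotient of determinants.\<close>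

lemma det_bordered:
  "pivots B l \<Longrightarrow> det (gram B (l @ [x]) (l @ [y])) = pivprod B l * schurs B l x y"
proof (induction l arbitrary: B)
  case Nil
  then show ?case by (subst det_single) (auto simp: gram_def)
next
  case (Cons a l)
  then show ?case using det_gram_Cons[of "l @ [x]" "l @ [y]" B a] by simp
qed

lemma det_Ints:
  assumes "A \<in> carrier_mat n n" "\<And>i j. i < n \<Longrightarrow> j < n \<Longrightarrow> A $$ (i, j) \<in> \<int>"
  shows "det A \<in> (\<int> :: real set)"
proof -
  have "signof p \<in> (\<int> :: real set)" for p :: "nat \<Rightarrow> nat" by (auto simp: sign_def)
  moreover have "A $$ (i, p i) \<in> \<int>" if "p permutes {0..<n}" "i \<in> {0..<n}" for p i
    using that permutes_in_image[OF that(1), of i] assms(2)[of i "p i"] by simp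
  ultimately show ?thesis unfolding det_def'[OF assms(1)]
    by (intro Ints_sum Ints_mult Ints_prod) simp_all
qed

text \<open>Elimination divides, so its entries need not be integers; multiplied by all pivots,
  however, such an entry is the determinant of a bordered integer matrix.\<close>

lemma schurs_Ints:
  assumes "pivots B l" "\<And>x y. x \<in> set l \<union> X \<Longrightarrow> y \<in> set l \<union> X \<Longrightarrow> B x y \<in> \<int>" "x \<in> X" "y \<in> X"
  shows "pivprod B l * schurs B l x y \<in> \<int>"
proof -
  have nth: "(l @ [z]) ! i \<in> set l \<union> X" if "i < Suc (length l)" "z \<in> X" for i z
    using that by (auto simp: nth_append less_Suc_eq)
  have "gram B (l @ [x]) (l @ [y]) $$ (i, j) \<in> \<int>" if "i < Suc (length l)" "j < Suc (length l)" for i j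
    using that assms(2)[OF nth nth] assms(3,4) by (simp add: gram_def)
  then show ?thesis unfolding det_bordered[OF assms(1), symmetric]
    by (intro det_Ints[of _ "Suc (length l)"]) (simp_all add: gram_def)
qed

section \<open>Inner products and orthogonal projections\<close>

definition ip :: "nat \<Rightarrow> (nat \<Rightarrow> real) \<Rightarrow> (nat \<Rightarrow> real) \<Rightarrow> real" where
  "ip n x y = (\<Sum>i<n. x i * y i)"

definition mv :: "nat \<Rightarrow> (nat \<Rightarrow> nat \<Rightarrow> real) \<Rightarrow> (nat \<Rightarrow> real) \<Rightarrow> nat \<Rightarrow> real" where
  "mv n P x i = (\<Sum>j<n. P i j * x j)"

definition unit_vec_at :: "nat \<Rightarrow> nat \<Rightarrow> real" where
  "unit_vec_at j i = (if i = j then 1 else 0)"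

lemma ip_commute: "ip n x y = ip n y x"
  by (simp add: ip_def mult.commute)

lemma ip_self_nonneg: "0 \<le> ip n x x"
  by (simp add: ip_def sum_nonneg)

lemma ip_self_eq_0: "ip n x x = 0 \<Longrightarrow> i < n \<Longrightarrow> x i = 0"
  by (simp add: ip_def sum_nonneg_eq_0_iff)

lemma ip_cong: "(\<And>i. i < n \<Longrightarrow> x i = x' i) \<Longrightarrow> (\<And>i. i < n \<Longrightarrow> y i = y' i) \<Longrightarrow> ip n x y = ip n x' y'"
  by (simp add: ip_def)

lemma ip_add_right: "ip n x (\<lambda>i. y i + z i) = ip n x y + ip n x z"
  by (simp add: ip_def algebra_simps sum.distrib)

lemma ip_diff_right: "ip n x (\<lambda>i. y i - z i) = ip n x y - ip n x z"
  by (simp add: ip_def algebra_simps sum_subtractf)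

lemma ip_scale_right: "ip n x (\<lambda>i. c * y i) = c * ip n x y"
  by (simp add: ip_def sum_distrib_left algebra_simps)

lemma ip_unit: "j < n \<Longrightarrow> ip n (unit_vec_at j) x = x j"
  by (simp add: ip_def unit_vec_at_def if_distrib[of "\<lambda>t. t * _"] sum.delta cong: if_cong)

lemma mv_unit: "j < n \<Longrightarrow> mv n P (unit_vec_at j) i = P i j"
  by (simp add: mv_def unit_vec_at_def if_distrib[of "\<lambda>t. _ * t"] sum.delta cong: if_cong)

lemma mv_add: "mv n P (\<lambda>j. x j + y j) i = mv n P x i + mv n P y i"
  by (simp add: mv_def algebra_simps sum.distrib)

lemma mv_adjoint:
  assumes "\<And>i j. P i j = P j i"
  shows "ip n (mv n P x) y = ip n x (mv n P y)"
proof -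
  have "ip n (mv n P x) y = (\<Sum>i<n. \<Sum>j<n. P i j * x j * y i)"
    by (simp add: ip_def mv_def sum_distrib_right)
  also have "\<dots> = (\<Sum>j<n. \<Sum>i<n. P i j * x j * y i)" by (rule sum.swap)
  also have "\<dots> = ip n x (mv n P y)"
    using assms by (simp add: ip_def mv_def sum_distrib_left algebra_simps)
  finally show ?thesis .
qed

lemma cauchy_schwarz: "(ip n x y)\<^sup>2 \<le> ip n x x * ip n y y"
proof (cases "ip n y y = 0")
  case True
  then have "ip n x y = 0" using ip_self_eq_0[of n y] by (simp add: ip_def)
  then show ?thesis using True by simp
next
  case False
  then have pos: "0 < ip n y y" using ip_self_nonneg[of n y] by simp
  define c where "c = ip n x y / ip n y y"
  have "0 \<le> ip n (\<lambda>i. x i - c * y i) (\<lambda>i. x i - c * y i)" by (rule ip_self_nonneg)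
  also have "\<dots> = ip n x x - 2 * c * ip n x y + c * c * ip n y y"
    by (simp add: ip_def algebra_simps sum.distrib sum_subtractf sum_distrib_left)
  also have "\<dots> = ip n x x - (ip n x y)\<^sup>2 / ip n y y"
    using pos by (simp add: c_def field_simps power2_eq_square)
  finally show ?thesis using pos by (simp add: field_simps)
qed

text \<open>The projection onto the orthogonal complement of the first \<open>r\<close> rows, and the Gram determinant of
  those rows that are independent of their predecessors.\<close>

primrec proj :: "nat \<Rightarrow> (nat \<Rightarrow> nat \<Rightarrow> real) \<Rightarrow> nat \<Rightarrow> nat \<Rightarrow> nat \<Rightarrow> real" where
  "proj n a 0 = (\<lambda>i j. if i = j then 1 else 0)"
| "proj n a (Suc r) = (let v = mv n (proj n a r) (a r); q = ip n v (a r) in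
     if q = 0 then proj n a r else (\<lambda>i j. proj n a r i j - v i * v j / q))"

primrec pden :: "nat \<Rightarrow> (nat \<Rightarrow> nat \<Rightarrow> real) \<Rightarrow> nat \<Rightarrow> real" where
  "pden n a 0 = 1"
| "pden n a (Suc r) = (let q = ip n (mv n (proj n a r) (a r)) (a r) in
     if q = 0 then pden n a r else pden n a r * q)"

lemma proj_sym: "proj n a r i j = proj n a r j i"
  by (induction r arbitrary: i j) (auto simp: Let_def)

lemma proj_adjoint: "ip n (mv n (proj n a r) x) y = ip n x (mv n (proj n a r) y)"
  by (rule mv_adjoint) (rule proj_sym)

lemma mv_rank1: "mv n (\<lambda>i j. P i j - v i * v j / q) x i = mv n P x i - v i * ip n v x / q"
  by (simp add: mv_def ip_def algebra_simps sum_subtractf sum_distrib_left sum_divide_distrib)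

lemma mv_proj_Suc:
  "mv n (proj n a (Suc r)) x i =
    (let v = mv n (proj n a r) (a r); q = ip n v (a r) in
     if q = 0 then mv n (proj n a r) x i else mv n (proj n a r) x i - v i * ip n v x / q)"
  by (simp add: Let_def mv_rank1)

text \<open>In the inductive step \<open>v\<close> lies in the range of the old projection and has
  squared length \<open>q\<close>. Subtracting the rank one matrix of \<open>v\<close>, divided by
  \<open>q\<close>, therefore removes one direction and leaves a projection.\<close>

lemma proj_idem: "i < n \<Longrightarrow> mv n (proj n a r) (mv n (proj n a r) x) i = mv n (proj n a r) x i"
proof (induction r arbitrary: x i)
  case 0
  have "mv n (proj n a 0) y i = y i" if "i < n" for y i
    using that by (simp add: mv_def if_distrib[of "\<lambda>t. t * _"] sum.delta cong: if_cong)
  then show ?case using 0 by simp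
next
  case (Suc r)
  define P where "P = proj n a r"
  define v where "v = mv n P (a r)"
  define q where "q = ip n v (a r)"
  have IH: "mv n P (mv n P y) i = mv n P y i" if "i < n" for i y
    unfolding P_def using Suc.IH that by blast
  show ?case
  proof (cases "q = 0")
    case True
    then show ?thesis using IH[OF Suc.prems] by (simp add: P_def v_def q_def Let_def)
  next
    case False
    have Pv: "mv n P v i = v i" if "i < n" for i unfolding v_def by (rule IH[OF that])
    have vPx: "ip n v (mv n P x) = ip n v x" for x
      unfolding P_def by (subst proj_adjoint[symmetric]) (intro ip_cong Pv[unfolded P_def] refl)
    have vv: "ip n v v = q" unfolding q_def by (subst (2) v_def) (rule vPx)
    define P' where "P' = proj n a (Suc r)"
    have P': "mv n P' x i = mv n P x i - v i * ip n v x / q" for x i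
      unfolding P'_def mv_proj_Suc using False by (simp add: P_def v_def q_def Let_def)
    have "ip n v (mv n P' x) = ip n v (\<lambda>i. mv n P x i - ip n v x / q * v i)"
      by (intro ip_cong) (simp_all add: P')
    also have "\<dots> = 0" unfolding ip_diff_right ip_scale_right vPx vv using False by simp
    finally have 1: "ip n v (mv n P' x) = 0" .
    have "mv n P (mv n P' x) i = (\<Sum>j<n. P i j * (mv n P x j - ip n v x / q * v j))"
      by (simp add: mv_def[of n P "mv n P' x"] P' mult.commute)
    also have "\<dots> = mv n P (mv n P x) i - ip n v x / q * mv n P v i"
      by (simp add: mv_def[of n P v] mv_def[of n P "mv n P x"] algebra_simps sum_subtractf sum_distrib_left sum_divide_distrib)
    finally have 2: "mv n P (mv n P' x) i = mv n P' x i"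
      using Suc.prems by (simp add: IH Pv P' algebra_simps)
    show ?thesis unfolding P'_def[symmetric] by (subst P') (simp add: 1 2)
  qed
qed

lemma proj_quad: "ip n x (mv n (proj n a r) x) = ip n (mv n (proj n a r) x) (mv n (proj n a r) x)"
  by (subst proj_adjoint) (intro ip_cong proj_idem[symmetric] refl)

lemma proj_ann: "t < r \<Longrightarrow> i < n \<Longrightarrow> mv n (proj n a r) (a t) i = 0"
proof (induction r arbitrary: i)
  case 0
  then show ?case by simp
next
  case (Suc r)
  define P where "P = proj n a r"
  define v where "v = mv n P (a r)"
  define q where "q = ip n v (a r)"
  have vv: "ip n v v = q"
    unfolding v_def q_def P_def by (metis proj_quad ip_commute)
  have P': "mv n (proj n a (Suc r)) x i = (if q = 0 then mv n P x i else mv n P x i - v i * ip n v x / q)" for x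
    unfolding mv_proj_Suc by (simp add: P_def v_def q_def Let_def)
  show ?case
  proof (cases "t = r")
    case True
    \<comment> \<open>As \<open>q\<close> is the squared length of \<open>v\<close>, a zero pivot
      means that the row depends on its predecessors and is already annihilated.\<close>
    have "v i = 0" if "q = 0" using ip_self_eq_0[of n v i] vv that Suc.prems by simp
    then show ?thesis unfolding P' True by (simp add: v_def[symmetric] q_def[symmetric])
  next
    case False
    then have "t < r" using Suc.prems by simp
    then have 0: "mv n P (a t) i = 0" if "i < n" for i unfolding P_def using Suc.IH that by blast
    have "ip n v (a t) = ip n (a r) (mv n P (a t))"
      unfolding v_def P_def by (rule proj_adjoint)
    also have "\<dots> = 0" by (simp add: ip_def 0)
    finally show ?thesis unfolding P' using 0 Suc.prems by simp
  qed
qed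

lemma proj_fix:
  assumes "\<And>t. t < r \<Longrightarrow> ip n (a t) x = 0" "i < n"
  shows "mv n (proj n a r) x i = x i"
  using assms
proof (induction r arbitrary: i)
  case 0
  then show ?case by (simp add: mv_def if_distrib[of "\<lambda>t. t * _"] sum.delta cong: if_cong)
next
  case (Suc r)
  have Px: "mv n (proj n a r) x i = x i" if "i < n" for i
    using Suc.IH Suc.prems(1) that by simp
  have "ip n (mv n (proj n a r) (a r)) x = ip n (a r) (mv n (proj n a r) x)"
    by (rule proj_adjoint)
  also have "\<dots> = ip n (a r) x" by (intro ip_cong Px refl)
  also have "\<dots> = 0" using Suc.prems(1) by simp
  finally show ?case unfolding mv_proj_Suc using Px Suc.prems(2) by (simp add: Let_def)
qed

lemma proj_mv_in_kernel: "t < r \<Longrightarrow> ip n (a t) (mv n (proj n a r) x) = 0"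
  by (subst proj_adjoint[symmetric]) (simp add: ip_def proj_ann)

lemma piv_nonneg: "0 \<le> ip n (mv n (proj n a r) x) x"
  by (subst ip_commute, subst proj_quad) (rule ip_self_nonneg)

lemma piv_le: "ip n (mv n (proj n a r) x) x \<le> ip n x x"
proof -
  let ?v = "mv n (proj n a r) x"
  have "0 \<le> ip n (\<lambda>i. x i - ?v i) (\<lambda>i. x i - ?v i)" by (rule ip_self_nonneg)
  also have "\<dots> = ip n x x - 2 * ip n ?v x + ip n ?v ?v"
    by (simp add: ip_def algebra_simps sum.distrib sum_subtractf sum_distrib_left)
  also have "ip n ?v ?v = ip n ?v x" by (metis proj_quad ip_commute)
  finally show ?thesis by simp
qed

text \<open>By symmetry and idempotence a diagonal entry is the squared length of its row. Together
  with the two lemmas below this bounds all entries by 1.\<close>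

lemma proj_diag: "i < n \<Longrightarrow> proj n a r i i = (\<Sum>k<n. (proj n a r i k)\<^sup>2)"
proof -
  assume i: "i < n"
  have "proj n a r i i = ip n (unit_vec_at i) (mv n (proj n a r) (unit_vec_at i))"
    using i by (simp add: ip_unit mv_unit)
  also have "\<dots> = ip n (mv n (proj n a r) (unit_vec_at i)) (mv n (proj n a r) (unit_vec_at i))"
    by (rule proj_quad)
  also have "\<dots> = (\<Sum>k<n. (proj n a r i k)\<^sup>2)"
    using i by (simp add: ip_def mv_unit power2_eq_square proj_sym[of n a r i])
  finally show ?thesis .
qed

lemma proj_sq_le: "i < n \<Longrightarrow> j < n \<Longrightarrow> (proj n a r i j)\<^sup>2 \<le> proj n a r i i"
  unfolding proj_diag[of i n] by (rule member_le_sum) auto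

lemma proj_diag_bounds:
  assumes "i < n" shows "0 \<le> proj n a r i i" "proj n a r i i \<le> 1"
proof -
  show "0 \<le> proj n a r i i" unfolding proj_diag[OF assms] by (rule sum_nonneg) simp
  have le: "proj n a r i i * proj n a r i i \<le> proj n a r i i"
    using proj_sq_le[OF assms assms, of a r] by (simp add: power2_eq_square)
  show "proj n a r i i \<le> 1"
  proof (rule ccontr)
    assume "\<not> proj n a r i i \<le> 1"
    then have "1 * proj n a r i i < proj n a r i i * proj n a r i i"
      by (intro mult_strict_right_mono) auto
    then show False using le by simp
  qed
qed

lemma proj_abs_le: "i < n \<Longrightarrow> j < n \<Longrightarrow> \<bar>proj n a r i j\<bar> \<le> 1"
  using proj_sq_le[of i n j a r] proj_diag_bounds(2)[of i n a r]
  by (metis abs_square_le_1 order.trans)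

lemma pden_pos: "0 < pden n a r"
proof (induction r)
  case (Suc r)
  then show ?case using piv_nonneg[of n a r "a r"] by (auto simp: Let_def less_le)
qed simp

text \<open>Hadamard's inequality: every pivot is the squared length of a projected row and thus at
  most that of the row itself.\<close>

lemma pden_le:
  assumes "\<And>t. t < r \<Longrightarrow> ip n (a t) (a t) \<le> b" "1 \<le> b"
  shows "pden n a r \<le> b ^ r"
  using assms(1)
proof (induction r)
  case (Suc r)
  let ?q = "ip n (mv n (proj n a r) (a r)) (a r)"
  have q: "?q \<le> b" using piv_le[of n a r "a r"] Suc.prems[of r] by simp
  have IH: "pden n a r \<le> b ^ r" using Suc by simp
  have "pden n a r * ?q \<le> b ^ r * b"
    using q IH pden_pos[of n a r] piv_nonneg[of n a r "a r"] assms(2) by (intro mult_mono) auto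
  moreover have "b ^ r \<le> b ^ r * b" using assms(2) by simp
  ultimately show ?case using IH by (auto simp: Let_def mult.commute)
qed simp

section \<open>Integrality of the projection after clearing denominators\<close>

primrec pivrows :: "nat \<Rightarrow> (nat \<Rightarrow> nat \<Rightarrow> real) \<Rightarrow> nat \<Rightarrow> (nat \<Rightarrow> real) list" where
  "pivrows n a 0 = []"
| "pivrows n a (Suc r) = (if ip n (mv n (proj n a r) (a r)) (a r) = 0 then pivrows n a r
     else pivrows n a r @ [a r])"

text \<open>A Schur step on the inner product subtracts the same rank one term as a step of
  \<open>proj\<close>. Dropping the dependent rows keeps all pivots nonzero, so the determinant
  identities apply to the projection.\<close>

lemma pivrows:
  "pivots (ip n) (pivrows n a r) \<and> pivprod (ip n) (pivrows n a r) = pden n a r \<and>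
   (\<forall>x y. schurs (ip n) (pivrows n a r) x y = ip n x (mv n (proj n a r) y))"
proof (induction r)
  case 0
  have "ip n x (mv n (proj n a 0) y) = ip n x y" for x y
    by (intro ip_cong refl proj_fix) simp_all
  then show ?case by simp
next
  case (Suc r)
  let ?v = "mv n (proj n a r) (a r)"
  have "ip n x (mv n (proj n a (Suc r)) y)
      = ip n x (mv n (proj n a r) y) - ip n x ?v * ip n (a r) (mv n (proj n a r) y) / ip n ?v (a r)"
    if "ip n ?v (a r) \<noteq> 0" for x y
  proof -
    have "ip n x (mv n (proj n a (Suc r)) y)
        = ip n x (\<lambda>i. mv n (proj n a r) y i - ip n ?v y / ip n ?v (a r) * ?v i)"
      using that by (intro ip_cong refl) (subst mv_proj_Suc, simp add: Let_def)
    then show ?thesis unfolding ip_diff_right ip_scale_right proj_adjoint[of n a r "a r" y] by simp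
  qed
  then show ?case
    using Suc by (auto simp: schurs_snoc pivprod_snoc pivots_snoc schur_def Let_def ip_commute[of n "a r" ?v])
qed

lemma set_pivrows: "set (pivrows n a r) \<subseteq> a ` {..<r}"
  by (induction r) auto

lemma ip_Ints: "(\<And>i. i < n \<Longrightarrow> x i \<in> \<int>) \<Longrightarrow> (\<And>i. i < n \<Longrightarrow> y i \<in> \<int>) \<Longrightarrow> ip n x y \<in> \<int>"
  unfolding ip_def by (intro Ints_sum Ints_mult) auto

text \<open>Bordering the Gram matrix by two unit vectors isolates a single entry of the projection.
  This lets the program store the projection as integers over one denominator and divide without
  remainder.\<close>

lemma pden_proj_Ints:
  assumes "\<And>t c. t < r \<Longrightarrow> c < n \<Longrightarrow> a t c \<in> \<int>" "i < n" "j < n"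
  shows "pden n a r * proj n a r i j \<in> \<int>"
proof -
  let ?X = "unit_vec_at ` {..<n}"
  have int: "x c \<in> \<int>" if "x \<in> set (pivrows n a r) \<union> ?X" "c < n" for x c
    using that set_pivrows[of n a r] assms(1) by (auto simp: unit_vec_at_def)
  have "pivprod (ip n) (pivrows n a r) * schurs (ip n) (pivrows n a r) (unit_vec_at i) (unit_vec_at j) \<in> \<int>"
    by (rule schurs_Ints[where X = ?X]) (use pivrows assms(2,3) int in \<open>auto intro!: ip_Ints\<close>)
  then show ?thesis using pivrows[of n a r] assms(2,3) by (simp add: ip_unit mv_unit)
qed

section \<open>Rescaling\<close>

definition kern :: "nat \<Rightarrow> nat \<Rightarrow> (nat \<Rightarrow> nat \<Rightarrow> int) \<Rightarrow> (nat \<Rightarrow> real) \<Rightarrow> bool" where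
  "kern n R A x \<longleftrightarrow> (\<forall>r<R. (\<Sum>c<n. of_int (A r c) * x c) = 0)"

definition srow :: "(nat \<Rightarrow> nat \<Rightarrow> int) \<Rightarrow> (nat \<Rightarrow> real) \<Rightarrow> nat \<Rightarrow> nat \<Rightarrow> real" where
  "srow A s r c = of_int (A r c) * s c"

lemma kern_ip: "kern n R A x \<longleftrightarrow> (\<forall>r<R. ip n (\<lambda>c. of_int (A r c)) x = 0)"
  by (simp add: kern_def ip_def)

lemma kern_scale: "kern n R A x \<Longrightarrow> kern n R A (\<lambda>i. c * x i)"
  by (simp add: kern_ip ip_scale_right)

lemma kern_diff: "kern n R A x \<Longrightarrow> kern n R A y \<Longrightarrow> kern n R A (\<lambda>i. x i - y i)"
  by (simp add: kern_ip ip_diff_right)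

lemma ip_srow: "ip n (srow A s r) x = (\<Sum>c<n. of_int (A r c) * (s c * x c))"
  by (simp add: ip_def srow_def mult.assoc)

text \<open>On a minimal support the kernel is spanned by a single vector \<open>x\<close>, so the projection onto it has the
  entries \<open>x\<^sub>i x\<^sub>j / |x|\<^sup>2\<close>. Its column \<open>j\<close>, multiplied by the common denominator, is the solution sought.\<close>

lemma kern_small_solution:
  assumes A: "\<And>r c. r < R \<Longrightarrow> c < n \<Longrightarrow> \<bar>A r c\<bar> \<le> 1"
    and ex: "kern n R A x0" "\<And>i. i < n \<Longrightarrow> 0 \<le> x0 i" "j < n" "0 < x0 j"
  shows "\<exists>y. kern n R A y \<and> (\<forall>i<n. 0 \<le> y i \<and> y i \<le> real n ^ R) \<and> 1 \<le> y j"
proof -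
  define good where "good x \<longleftrightarrow> kern n R A x \<and> (\<forall>i<n. 0 \<le> x i) \<and> 0 < x j" for x
  define supp where "supp x = {i\<in>{..<n}. x i \<noteq> (0::real)}" for x
  have "good x0" using ex by (simp add: good_def)
  then obtain x where x: "good x" and min: "\<And>y. good y \<Longrightarrow> card (supp x) \<le> card (supp y)"
    using ex_has_least_nat[of good x0 "\<lambda>x. card (supp x)"] by blast
  from x have kx: "kern n R A x" and x0: "\<And>i. i < n \<Longrightarrow> 0 \<le> x i" and xj: "0 < x j"
    by (auto simp: good_def)
  \<comment> \<open>This 0-1 scaling erases the columns outside the support of \<open>x\<close>, so
    that \<open>p\<close> cannot leave that support.\<close>
  define s where "s i = (if 0 < x i then 1 else (0::real))" for i
  have sx: "s i * x i = x i" if "i < n" for i using x0[OF that] by (auto simp: s_def)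
  define P where "P = proj n (srow A s) R"
  define p where "p i = s i * P i j" for i
  have kp: "kern n R A p"
    unfolding kern_def
  proof (intro allI impI)
    fix r assume "r < R"
    then have "ip n (srow A s r) (mv n P (unit_vec_at j)) = 0"
      unfolding P_def by (rule proj_mv_in_kernel)
    then show "(\<Sum>c<n. of_int (A r c) * p c) = 0"
      using ex(3) by (simp add: ip_srow mv_unit p_def)
  qed
  have parallel: "p i = p j / x j * x i" if "i < n" for i
  proof (rule ccontr)
    assume "p i \<noteq> p j / x j * x i"
    define w0 where "w0 i = p i - p j / x j * x i" for i
    have kw0: "kern n R A w0" unfolding w0_def by (intro kern_diff kern_scale kp kx)
    \<comment> \<open>The sign makes coordinate \<open>i\<close> positive, so that moving against
      \<open>w\<close> must hit the boundary. Coordinate \<open>j\<close> of \<open>w\<close> is 0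
      by the choice of the multiple of \<open>x\<close>, hence \<open>x j\<close> stays
      positive.\<close>
    define w where "w k = sgn (w0 i) * w0 k" for k
    have kw: "kern n R A w" unfolding w_def by (intro kern_scale kw0)
    have "w0 i \<noteq> 0" using \<open>p i \<noteq> _\<close> by (simp add: w0_def)
    then have wi: "0 < w i" by (auto simp: w_def sgn_if)
    have wj: "w j = 0" using xj by (simp add: w_def w0_def)
    have w0: "w k = 0" if "k < n" "x k = 0" for k
      using that by (simp add: w_def w0_def p_def s_def)
    define I where "I = {k\<in>{..<n}. 0 < w k}"
    have I: "finite I" "i \<in> I" using wi that by (auto simp: I_def)
    \<comment> \<open>The ratio test: the largest step that keeps \<open>x - t * w\<close>
      nonnegative. The coordinate attaining the minimum leaves the support, against
      minimality.\<close>
    define t where "t = Min ((\<lambda>k. x k / w k) ` I)"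
    have "t \<in> (\<lambda>k. x k / w k) ` I" unfolding t_def using I by (intro Min_in) auto
    then obtain k1 where k1: "k1 \<in> I" "t = x k1 / w k1" by blast
    have tle: "t \<le> x k / w k" if "k \<in> I" for k
      unfolding t_def using I that by (intro Min_le) auto
    have t0: "0 \<le> t" using k1 x0[of k1] by (auto simp: I_def)
    define y where "y k = x k - t * w k" for k
    have ky: "kern n R A y" unfolding y_def by (intro kern_diff kern_scale kx kw)
    have y0: "0 \<le> y k" if "k < n" for k
    proof (cases "0 < w k")
      case True
      then show ?thesis using tle[of k] that by (simp add: I_def y_def field_simps)
    next
      case False
      then have "t * w k \<le> 0" using t0 by (simp add: mult_nonneg_nonpos)
      then show ?thesis using x0[OF that] by (simp add: y_def)
    qed
    have "good y" using ky y0 xj wj by (simp add: good_def y_def)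
    moreover have "supp y \<subset> supp x"
    proof
      show "supp y \<subseteq> supp x" using w0 by (auto simp: supp_def y_def)
      have "k1 \<in> supp x" "k1 \<notin> supp y" using k1 w0[of k1] by (auto simp: supp_def y_def I_def)
      then show "supp y \<noteq> supp x" by blast
    qed
    then have "card (supp y) < card (supp x)"
      by (intro psubset_card_mono) (auto simp: supp_def)
    ultimately show False using min[of y] by simp
  qed
  have "ip n (srow A s t) x = 0" if "t < R" for t
  proof -
    have "ip n (srow A s t) x = (\<Sum>c<n. of_int (A t c) * x c)"
      unfolding ip_srow by (intro sum.cong refl) (simp add: sx)
    then show ?thesis using kx that by (simp add: kern_def)
  qed
  then have Px: "mv n P x j = x j"
    unfolding P_def using ex(3) by (intro proj_fix)
  have "P j j \<noteq> 0"
  proof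
    assume "P j j = 0"
    then have "P j k = 0" if "k < n" for k
      using proj_sq_le[of j n k "srow A s" R] ex(3) that by (simp add: P_def)
    then show False using Px xj by (simp add: mv_def)
  qed
  then have Pjj: "0 < P j j" using proj_diag_bounds(1)[of j n "srow A s" R] ex(3) by (simp add: P_def)
  then have pj: "p j = P j j" using xj by (simp add: p_def s_def)
  define D where "D = pden n (srow A s) R"
  have D: "0 < D" unfolding D_def by (rule pden_pos)
  have int: "srow A s t c \<in> \<int>" for t c by (simp add: srow_def s_def)
  have "D * P j j \<in> \<int>" unfolding D_def P_def by (intro pden_proj_Ints int ex(3))
  moreover have "0 < D * P j j" using D Pjj by simp
  ultimately have Dj: "1 \<le> D * P j j" by (auto elim!: Ints_cases)
  have row: "ip n (srow A s t) (srow A s t) \<le> real n" if "t < R" for t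
  proof -
    have "srow A s t c * srow A s t c \<le> 1" if "c < n" for c
    proof -
      have "\<bar>of_int (A t c)\<bar> \<le> (1::real)" using A[OF \<open>t < R\<close> that] by linarith
      then have "\<bar>srow A s t c\<bar> \<le> 1" by (simp add: srow_def s_def)
      then show ?thesis by (metis abs_square_le_1 power2_eq_square)
    qed
    then have "ip n (srow A s t) (srow A s t) \<le> (\<Sum>c<n. 1)" unfolding ip_def by (intro sum_mono) auto
    then show ?thesis by simp
  qed
  have Dn: "D \<le> real n ^ R" unfolding D_def using ex(3) row by (intro pden_le) auto
  have "kern n R A (\<lambda>i. D * p i)" by (rule kern_scale) (rule kp)
  moreover have "0 \<le> D * p i \<and> D * p i \<le> real n ^ R" if "i < n" for i
  proof -
    have "0 \<le> p i" unfolding parallel[OF that] pj using Pjj xj x0[OF that] by simp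
    moreover have "p i \<le> 1"
      using proj_abs_le[OF that ex(3), of "srow A s" R] by (auto simp: p_def s_def P_def)
    then have "D * p i \<le> D * 1" using D by (intro mult_left_mono) auto
    then have "D * p i \<le> real n ^ R" using Dn by linarith
    ultimately show ?thesis using D by simp
  qed
  ultimately show ?thesis using Dj pj by (intro exI[of _ "\<lambda>i. D * p i"]) simp
qed

text \<open>In the expansion of the quadratic form the cross term is twice the coordinate
  \<open>i\<close> of \<open>P u\<close>, which is not positive, and the new square is a diagonal
  entry of \<open>P\<close>, which is at most 1.\<close>

lemma quad_step:
  assumes "i < n" "mv n (proj n a r) u i \<le> 0"
  shows "ip n (u(i := u i + 1)) (mv n (proj n a r) (u(i := u i + 1))) \<le> ip n u (mv n (proj n a r) u) + 1"
proof -
  let ?P = "proj n a r" and ?e = "unit_vec_at i"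
  have u': "u(i := u i + 1) = (\<lambda>k. u k + ?e k)" by (auto simp: unit_vec_at_def)
  have m: "mv n ?P (u(i := u i + 1)) = (\<lambda>k. mv n ?P u k + mv n ?P ?e k)"
    unfolding u' by (rule ext) (rule mv_add)
  have "ip n (u(i := u i + 1)) (mv n ?P (u(i := u i + 1)))
     = ip n u (mv n ?P u) + ip n u (mv n ?P ?e) + ip n ?e (mv n ?P u) + ip n ?e (mv n ?P ?e)"
    unfolding m by (subst ip_commute, simp only: u' ip_add_right) (simp add: ip_commute ip_add_right)
  also have "ip n u (mv n ?P ?e) = ip n ?e (mv n ?P u)"
    by (metis proj_adjoint ip_commute)
  also have "ip n ?e (mv n ?P u) = mv n ?P u i" using assms by (simp add: ip_unit)
  also have "ip n ?e (mv n ?P ?e) = ?P i i" using assms by (simp add: ip_unit mv_unit)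
  finally show ?thesis using assms(2) proj_diag_bounds(2)[OF assms(1), of a r]
    by (simp add: fun_upd_def)
qed

text \<open>The projection fixes \<open>x\<close>, so \<open>u j * x j\<close> is at most the inner
  product of \<open>P u\<close> and \<open>x\<close>, and hence at most the square root of
  \<open>t * n\<close>. With \<open>u j\<close> at least \<open>t / n\<close> this gives that
  \<open>x j\<close> squared is at most \<open>n ^ 3 / t\<close>; the threshold
  \<open>4 * n ^ 3\<close> is chosen to make this 1/4.\<close>

lemma perceptron_coordinate_bound:
  fixes u x :: "nat \<Rightarrow> real"
  assumes ker: "\<And>k. k < r \<Longrightarrow> ip n (a k) x = 0"
    and x: "\<And>i. i < n \<Longrightarrow> 0 \<le> x i \<and> x i \<le> 1"
    and u: "\<And>i. i < n \<Longrightarrow> 0 \<le> u i"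
    and quad: "ip n u (mv n (proj n a r) u) \<le> t"
    and t: "4 * real n ^ 3 \<le> t" and j: "j < n" "t \<le> real n * u j"
  shows "x j \<le> 1 / 2"
proof -
  let ?P = "proj n a r"
  have n: "0 < real n" using j by simp
  have tpos: "0 < t" using t n by (smt (verit) zero_less_power)
  have "u j * x j \<le> ip n u x"
    unfolding ip_def by (rule member_le_sum) (use j x u in auto)
  also have "ip n u x = ip n u (mv n ?P x)"
    by (intro ip_cong refl proj_fix[symmetric] ker)
  also have "\<dots> = ip n (mv n ?P u) x" by (rule proj_adjoint[symmetric])
  finally have "u j * x j \<le> ip n (mv n ?P u) x" .
  then have "(u j * x j)\<^sup>2 \<le> (ip n (mv n ?P u) x)\<^sup>2"
    using u[OF j(1)] x[OF j(1)] by (intro power_mono) auto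
  also have "\<dots> \<le> ip n (mv n ?P u) (mv n ?P u) * ip n x x" by (rule cauchy_schwarz)
  also have "\<dots> \<le> t * real n"
  proof (rule mult_mono)
    show "ip n (mv n ?P u) (mv n ?P u) \<le> t" using quad unfolding proj_quad .
    have "ip n x x \<le> (\<Sum>i<n. 1)" unfolding ip_def using x by (intro sum_mono) (simp add: mult_le_one)
    then show "ip n x x \<le> real n" by simp
  qed (use tpos in \<open>auto simp: ip_self_nonneg\<close>)
  finally have 1: "(u j * x j)\<^sup>2 \<le> t * real n" .
  have "(t * x j)\<^sup>2 \<le> (real n * (u j * x j))\<^sup>2"
    using j(2) x[OF j(1)] tpos by (intro power_mono) (auto simp: mult.assoc[symmetric] intro: mult_right_mono)
  also have "\<dots> \<le> real n ^ 2 * (t * real n)" using 1 by (simp add: power_mult_distrib mult_left_mono)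
  finally have "t * (t * (x j)\<^sup>2) \<le> t * real n ^ 3"
    by (simp add: power2_eq_square power3_eq_cube algebra_simps)
  then have "t * (x j)\<^sup>2 \<le> real n ^ 3" using tpos by simp
  moreover have "4 * real n ^ 3 * (x j)\<^sup>2 \<le> t * (x j)\<^sup>2" using t by (intro mult_right_mono) auto
  ultimately have "real n ^ 3 * (4 * (x j)\<^sup>2) \<le> real n ^ 3 * 1" by simp
  then have "(x j)\<^sup>2 \<le> (1 / 2)\<^sup>2" using n by (simp add: power2_eq_square)
  then show ?thesis by (rule power2_le_imp_le) simp
qed

text \<open>The exponent \<open>-1\<close> marks a deleted coordinate. The program looks powers of two up in the array
  \<open>''pw''\<close>, whose entry \<open>-1\<close> is never written and thus \<open>0\<close>.\<close>

definition scale :: "(nat \<Rightarrow> int) \<Rightarrow> nat \<Rightarrow> int" where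
  "scale e i = (if e i < 0 then 0 else 2 ^ nat (e i))"

text \<open>Only solutions in a cube are tracked. That is enough, because any solution can be scaled
  into it, and because a coordinate that can be positive at all is at least 1 in some solution of
  this cube once \<open>2 ^ K\<close> exceeds the bound on small solutions.\<close>

definition box_inv :: "nat \<Rightarrow> nat \<Rightarrow> (nat \<Rightarrow> nat \<Rightarrow> int) \<Rightarrow> nat \<Rightarrow> (nat \<Rightarrow> int) \<Rightarrow> bool" where
  "box_inv n R A K e \<longleftrightarrow> (\<forall>x. kern n R A x \<longrightarrow> (\<forall>i<n. 0 \<le> x i \<and> x i \<le> 2 ^ K) \<longrightarrow>
     (\<forall>i<n. x i \<le> of_int (scale e i)))"

lemma box_inv_start: "(\<And>i. i < n \<Longrightarrow> e i = int K) \<Longrightarrow> box_inv n R A K e"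
  by (simp add: box_inv_def scale_def)

lemma box_inv_halve:
  assumes A: "\<And>r c. r < R \<Longrightarrow> c < n \<Longrightarrow> \<bar>A r c\<bar> \<le> 1"
    and K: "real n ^ R \<le> 2 ^ K"
    and box: "box_inv n R A K e"
    and u: "\<And>i. i < n \<Longrightarrow> 0 \<le> u i"
    and quad: "ip n u (mv n (proj n (srow A (\<lambda>c. of_int (scale e c))) R) u) \<le> t"
    and t: "4 * real n ^ 3 \<le> t" and j: "j < n" "t \<le> real n * u j" "0 \<le> e j"
  shows "box_inv n R A K (e(j := e j - 1))"
proof -
  let ?s = "\<lambda>c. real_of_int (scale e c)"
  have s0: "0 \<le> ?s i" for i by (simp add: scale_def)
  have half: "x j \<le> ?s j / 2"
    if x: "kern n R A x" "\<forall>i<n. 0 \<le> x i \<and> x i \<le> 2 ^ K" for x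
  proof -
    have xs: "x i \<le> ?s i" if "i < n" for i using box x that by (auto simp: box_inv_def)
    \<comment> \<open>Dividing by the scales maps the box to the unit cube. For a deleted coordinate
      the quotient is 0 by the convention on division, in accordance with \<open>x i\<close> being 0
      there.\<close>
    define y where "y i = x i / ?s i" for i
    have sy: "?s i * y i = x i" if "i < n" for i
      using xs[OF that] x(2) that by (auto simp: y_def)
    have "y j \<le> 1 / 2"
    proof (rule perceptron_coordinate_bound[OF _ _ u quad t j(1,2)])
      fix k assume "k < R"
      then show "ip n (srow A ?s k) y = 0"
        using x(1) sy by (simp add: ip_srow kern_def)
    next
      fix i assume i: "i < n"
      show "0 \<le> y i \<and> y i \<le> 1"
        using xs[OF i] x(2) i s0[of i] by (cases "?s i = 0") (auto simp: y_def divide_le_eq_1)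
    qed auto
    then have "?s j * y j \<le> ?s j * (1 / 2)" using s0 by (intro mult_left_mono) auto
    then show ?thesis using sy[OF j(1)] by simp
  qed
  have new: "x j \<le> of_int (scale (e(j := e j - 1)) j)"
    if x: "kern n R A x" "\<forall>i<n. 0 \<le> x i \<and> x i \<le> 2 ^ K" for x
  proof (cases "e j = 0")
    case False
    then have "nat (e j) = Suc (nat (e j - 1))" using j(3) by simp
    then have "?s j = 2 * of_int (scale (e(j := e j - 1)) j)" using j(3) False by (simp add: scale_def)
    then show ?thesis using half[OF x] by simp
  next
    \<comment> \<open>At scale 1 all tracked solutions have \<open>x j\<close> at most 1/2, but a
      positive \<open>x j\<close> would entail a tracked solution in which this coordinate is at
      least 1. So the coordinate is always 0, and its exponent may drop to the deletion
      mark.\<close>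
    case True
    have "\<not> 0 < x j"
    proof
      assume "0 < x j"
      then obtain y where y: "kern n R A y" "\<forall>i<n. 0 \<le> y i \<and> y i \<le> real n ^ R" "1 \<le> y j"
        using kern_small_solution[OF A x(1) _ j(1)] x(2) by blast
      have "\<forall>i<n. 0 \<le> y i \<and> y i \<le> 2 ^ K" using y(2) K by force
      from half[OF y(1) this] have "y j \<le> 1 / 2" using True by (simp add: scale_def)
      then show False using y(3) by simp
    qed
    then show ?thesis using True by (simp add: scale_def)
  qed
  show ?thesis unfolding box_inv_def
  proof (intro allI impI)
    fix x i assume x: "kern n R A x" "\<forall>i<n. 0 \<le> x i \<and> x i \<le> 2 ^ K" and i: "i < n"
    show "x i \<le> of_int (scale (e(j := e j - 1)) i)"
    proof (cases "i = j")
      case True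
      then show ?thesis using new[OF x] by simp
    next
      case False
      then have "scale (e(j := e j - 1)) i = scale e i" by (simp add: scale_def)
      then show ?thesis using box x i unfolding box_inv_def by metis
    qed
  qed
qed

text \<open>Dividing a solution by its coordinate sum moves it into the unit cube, hence into the
  tracked box, where a deleted coordinate is 0.\<close>

lemma box_inv_infeasible:
  assumes "box_inv n R A K e" "e 0 < 0" "0 < n"
  shows "\<not> (\<exists>x. kern n R A x \<and> (\<forall>i<n. 0 \<le> x i) \<and> 0 < x 0)"
proof
  assume "\<exists>x. kern n R A x \<and> (\<forall>i<n. 0 \<le> x i) \<and> 0 < x 0"
  then obtain x where x: "kern n R A x" "\<forall>i<n. 0 \<le> x i" "0 < x 0" by blast
  define b where "b = (\<Sum>i<n. x i)"
  have xb: "x i \<le> b" if "i < n" for i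
    unfolding b_def by (rule member_le_sum) (use that x in auto)
  have b: "0 < b" using xb[OF assms(3)] x(3) by simp
  define y where "y i = 1 / b * x i" for i
  have "kern n R A y" unfolding y_def by (rule kern_scale) (rule x(1))
  moreover have "0 \<le> y i \<and> y i \<le> 2 ^ K" if "i < n" for i
  proof -
    have "y i \<le> 1" "0 \<le> y i" using xb[OF that] b x(2) that by (auto simp: y_def)
    moreover have "(1::real) \<le> 2 ^ K" by simp
    ultimately show ?thesis by linarith
  qed
  ultimately have "y 0 \<le> of_int (scale e 0)" using assms by (auto simp: box_inv_def)
  then show False using assms(2) x(3) b by (simp add: scale_def y_def divide_le_0_iff)
qed

section \<open>A program logic\<close>

notation Seq (infixr ";;" 60)

text \<open>Both branches of a conditional are charged, instead of the dearer one, which keeps the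
  bound a polynomial in \<open>b\<close>.\<close>

primrec cost :: "com \<Rightarrow> nat \<Rightarrow> nat" where
  "cost Skip b = 1"
| "cost (Assign x e) b = acost e + 1"
| "cost (Store a d e) b = acost d + acost e + 1"
| "cost (Seq c d) b = cost c b + cost d b"
| "cost (If e c d) b = bcost e + cost c b + cost d b + 1"
| "cost (While e c) b = b * (bcost e + cost c b + 1) + bcost e + 1"

primrec wvars :: "com \<Rightarrow> string set" where
  "wvars Skip = {}"
| "wvars (Assign x e) = {x}"
| "wvars (Store a d e) = {}"
| "wvars (Seq c d) = wvars c \<union> wvars d"
| "wvars (If e c d) = wvars c \<union> wvars d"
| "wvars (While e c) = wvars c"

primrec warrs :: "com \<Rightarrow> string set" where
  "warrs Skip = {}"
| "warrs (Assign x e) = {}"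
| "warrs (Store a d e) = {a}"
| "warrs (Seq c d) = warrs c \<union> warrs d"
| "warrs (If e c d) = warrs c \<union> warrs d"
| "warrs (While e c) = warrs c"

definition setv :: "string \<Rightarrow> int \<Rightarrow> state \<Rightarrow> state" where
  "setv x v s = s\<lparr>var := (var s)(x := v)\<rparr>"

definition seta :: "string \<Rightarrow> int \<Rightarrow> int \<Rightarrow> state \<Rightarrow> state" where
  "seta a i v s = s\<lparr>arr := (arr s)(a := (arr s a)(i := v))\<rparr>"

lemma setv_simps [simp]:
  "var (setv x v s) = (var s)(x := v)" "arr (setv x v s) = arr s"
  by (simp_all add: setv_def)

lemma seta_simps [simp]:
  "var (seta a i v s) = var s" "arr (seta a i v s) = (arr s)(a := (arr s a)(i := v))"
  by (simp_all add: seta_def)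

text \<open>What a program leaves alone is read off its syntax, so that invariants need to mention
  only what changes.\<close>

definition frame :: "com \<Rightarrow> state \<Rightarrow> state \<Rightarrow> bool" where
  "frame c s s' \<longleftrightarrow> (\<forall>x. x \<notin> wvars c \<longrightarrow> var s' x = var s x) \<and>
     (\<forall>a. a \<notin> warrs c \<longrightarrow> arr s' a = arr s a)"

lemma frame_var: "frame c s s' \<Longrightarrow> x \<notin> wvars c \<Longrightarrow> var s' x = var s x"
  and frame_arr: "frame c s s' \<Longrightarrow> a \<notin> warrs c \<Longrightarrow> arr s' a = arr s a"
  by (simp_all add: frame_def)

lemmas frameD = frame_var frame_arr

lemma frame_refl: "frame c s s"
  by (simp add: frame_def)

lemma frame_trans: "frame c s s' \<Longrightarrow> frame c s' s'' \<Longrightarrow> frame c s s''"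
  by (simp add: frame_def)

lemma frame_mono: "frame c s s' \<Longrightarrow> wvars c \<subseteq> wvars d \<Longrightarrow> warrs c \<subseteq> warrs d \<Longrightarrow> frame d s s'"
  by (auto simp: frame_def)

lemma exec_frame: "exec c s t s' \<Longrightarrow> frame c s s'"
  by (induction rule: exec.induct) (auto simp: frame_def)

text \<open>\<open>cost c b\<close> bounds the running time of \<open>c\<close> if no loop in \<open>c\<close> makes more than \<open>b\<close> iterations at a time.
  Proofs of \<open>wp b c Q s\<close> thus only have to bound the number of iterations.\<close>

definition wp :: "nat \<Rightarrow> com \<Rightarrow> (state \<Rightarrow> bool) \<Rightarrow> state \<Rightarrow> bool" where
  "wp b c Q s \<longleftrightarrow> (\<exists>t s'. exec c s t s' \<and> t \<le> cost c b \<and> Q s')"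

lemma wp_Skip: "Q s \<Longrightarrow> wp b Skip Q s"
  by (auto simp: wp_def simp del: One_nat_def intro!: exI[of _ 1] exI[of _ s] exec.Skip)

lemma wp_Assign: "Q (setv x (aval e s) s) \<Longrightarrow> wp b (Assign x e) Q s"
  unfolding wp_def setv_def
  by (intro exI[of _ "acost e + 1"]) (auto intro: exec.Assign[unfolded Suc_eq_plus1[symmetric]])

lemma wp_Store: "Q (seta a (aval d s) (aval e s) s) \<Longrightarrow> wp b (Store a d e) Q s"
  unfolding wp_def seta_def
  by (intro exI[of _ "acost d + acost e + 1"]) (auto intro: exec.Store[unfolded Suc_eq_plus1[symmetric]])

lemma wp_Seq: "wp b c (wp b d Q) s \<Longrightarrow> wp b (Seq c d) Q s"
  unfolding wp_def by (fastforce intro: exec.Seq)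

lemma wp_If:
  assumes "bval e s \<Longrightarrow> wp b c Q s" "\<not> bval e s \<Longrightarrow> wp b d Q s"
  shows "wp b (If e c d) Q s"
proof (cases "bval e s")
  case True
  then obtain t s' where "exec c s t s'" "t \<le> cost c b" "Q s'" using assms(1) by (auto simp: wp_def)
  then show ?thesis unfolding wp_def using exec.IfTrue[OF True]
    by (intro exI[of _ "bcost e + t + 1"] exI[of _ s']) auto
next
  case False
  then obtain t s' where "exec d s t s'" "t \<le> cost d b" "Q s'" using assms(2) by (auto simp: wp_def)
  then show ?thesis unfolding wp_def using exec.IfFalse[OF False]
    by (intro exI[of _ "bcost e + t + 1"] exI[of _ s']) auto
qed

lemmas wp_intros = wp_Skip wp_Assign wp_Store wp_Seq wp_If

lemma wp_conseq:
  assumes "wp b c R s" "\<And>s'. frame c s s' \<Longrightarrow> R s' \<Longrightarrow> Q s'"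
  shows "wp b c Q s"
  using assms unfolding wp_def by (meson exec_frame)

text \<open>The measure serves termination and time at once: its initial value bounds the number of
  iterations. Each iteration also knows its frame relation to the state before the loop.\<close>

lemma wp_While:
  fixes \<mu> :: "state \<Rightarrow> nat"
  assumes init: "I s" and le: "\<mu> s \<le> b"
    and step: "\<And>s'. frame (While e c) s s' \<Longrightarrow> I s' \<Longrightarrow> bval e s' \<Longrightarrow>
      wp b c (\<lambda>s''. I s'' \<and> \<mu> s'' < \<mu> s') s'"
    and fin: "\<And>s'. frame (While e c) s s' \<Longrightarrow> I s' \<Longrightarrow> \<not> bval e s' \<Longrightarrow> Q s'"
  shows "wp b (While e c) Q s"
proof -
  \<comment> \<open>For the induction the time bound has to use the measure of the current state;
    \<open>b\<close> enters only at the end.\<close>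
  have "\<exists>t s''. exec (While e c) s' t s'' \<and> t \<le> \<mu> s' * (bcost e + cost c b + 1) + bcost e + 1 \<and> Q s''"
    if "frame (While e c) s s'" "I s'" for s'
    using that
  proof (induction "\<mu> s'" arbitrary: s' rule: less_induct)
    case less
    show ?case
    proof (cases "bval e s'")
      case True
      from step[OF less.prems True] obtain t1 s1
        where 1: "exec c s' t1 s1" "t1 \<le> cost c b" "I s1" "\<mu> s1 < \<mu> s'" by (auto simp: wp_def)
      have "frame (While e c) s s1"
        using frame_trans[OF less.prems(1) frame_mono[OF exec_frame[OF 1(1)]]] by simp
      from less.hyps[OF 1(4) this 1(3)] obtain t2 s2 where
        2: "exec (While e c) s1 t2 s2" "t2 \<le> \<mu> s1 * (bcost e + cost c b + 1) + bcost e + 1" "Q s2" by blast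
      have "Suc (\<mu> s1) * (bcost e + cost c b + 1) \<le> \<mu> s' * (bcost e + cost c b + 1)"
        using 1(4) by (intro mult_le_mono1) simp
      then show ?thesis using exec.WhileTrue[OF True 1(1) 2(1)] 1(2) 2(2,3)
        by (intro exI conjI) auto
    next
      case False
      then show ?thesis using exec.WhileFalse[OF False, of c] fin[OF less.prems False]
        by (intro exI conjI) auto
    qed
  qed
  from this[OF frame_refl init] obtain t s'' where
    "exec (While e c) s t s''" "t \<le> \<mu> s * (bcost e + cost c b + 1) + bcost e + 1" "Q s''" by blast
  moreover have "\<mu> s * (bcost e + cost c b + 1) \<le> b * (bcost e + cost c b + 1)" by (rule mult_le_mono1[OF le])
  ultimately show ?thesis unfolding wp_def by (intro exI[of _ t] exI[of _ s'']) simp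
qed

definition FOR :: "string \<Rightarrow> aexp \<Rightarrow> aexp \<Rightarrow> com \<Rightarrow> com" where
  "FOR x a e c = Seq (Assign x a) (While (Less (V x) e) (Seq c (Assign x (Add (V x) (N 1)))))"

lemma wvars_FOR [simp]: "wvars (FOR x a e c) = insert x (wvars c)"
  and warrs_FOR [simp]: "warrs (FOR x a e c) = warrs c"
  by (auto simp: FOR_def)

text \<open>The limit is evaluated anew in every iteration, so its value must be stable under the
  frame of the loop. The step condition refers to the state after the increment, because an
  invariant may depend on the counter.\<close>

lemma wp_FOR:
  fixes lo hi :: nat
  assumes bounds: "aval a s = int lo" "lo \<le> hi" "hi - lo \<le> b"
    and x: "x \<notin> wvars c"
    and hi: "\<And>s'. frame (FOR x a e c) s s' \<Longrightarrow> aval e s' = int hi"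
    and init: "I lo (setv x (int lo) s)"
    and step: "\<And>i s'. frame (FOR x a e c) s s' \<Longrightarrow> lo \<le> i \<Longrightarrow> i < hi \<Longrightarrow> var s' x = int i \<Longrightarrow> I i s' \<Longrightarrow>
      wp b c (\<lambda>s''. I (Suc i) (setv x (1 + int i) s'')) s'"
    and fin: "\<And>s'. frame (FOR x a e c) s s' \<Longrightarrow> var s' x = int hi \<Longrightarrow> I hi s' \<Longrightarrow> Q s'"
  shows "wp b (FOR x a e c) Q s"
proof -
  let ?w = "While (Less (V x) e) (Seq c (Assign x (Add (V x) (N 1))))"
  have fr: "frame (FOR x a e c) s s'" if "frame ?w (setv x (int lo) s) s'" for s'
    using that by (auto simp: frame_def)
  have "wp b ?w Q (setv x (int lo) s)"
  proof (rule wp_While[where I = "\<lambda>s'. \<exists>i. lo \<le> i \<and> i \<le> hi \<and> var s' x = int i \<and> I i s'"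
        and \<mu> = "\<lambda>s'. hi - nat (var s' x)"])
    show "\<exists>i. lo \<le> i \<and> i \<le> hi \<and> var (setv x (int lo) s) x = int i \<and> I i (setv x (int lo) s)"
      using init bounds by auto
    show "hi - nat (var (setv x (int lo) s) x) \<le> b" using bounds by simp
  next
    fix s' assume f: "frame ?w (setv x (int lo) s) s'"
      and "\<exists>i. lo \<le> i \<and> i \<le> hi \<and> var s' x = int i \<and> I i s'" and b: "bval (Less (V x) e) s'"
    then obtain i where i: "lo \<le> i" "i \<le> hi" "var s' x = int i" "I i s'" by blast
    have "i < hi" using b hi[OF fr[OF f]] i by simp
    from step[OF fr[OF f] i(1) this i(3,4)]
    have "wp b c (\<lambda>s''. I (Suc i) (setv x (1 + int i) s'')) s'" .
    then have "wp b c (\<lambda>s''. I (Suc i) (setv x (1 + int i) s'') \<and> var s'' x = int i) s'"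
      by (rule wp_conseq) (use x i(3) in \<open>auto simp: frame_def\<close>)
    then have "wp b c (\<lambda>s''. let s3 = setv x (aval (Add (V x) (N 1)) s'') s'' in
        (\<exists>i. lo \<le> i \<and> i \<le> hi \<and> var s3 x = int i \<and> I i s3) \<and> hi - nat (var s3 x) < hi - nat (var s' x)) s'"
    proof (rule wp_conseq)
      fix s'' assume *: "I (Suc i) (setv x (1 + int i) s'') \<and> var s'' x = int i"
      show "let s3 = setv x (aval (Add (V x) (N 1)) s'') s'' in
        (\<exists>i. lo \<le> i \<and> i \<le> hi \<and> var s3 x = int i \<and> I i s3) \<and> hi - nat (var s3 x) < hi - nat (var s' x)"
        using * i \<open>i < hi\<close> by (auto simp: Let_def add.commute intro!: exI[of _ "Suc i"])
    qed
    then show "wp b (Seq c (Assign x (Add (V x) (N 1))))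
        (\<lambda>s''. (\<exists>i. lo \<le> i \<and> i \<le> hi \<and> var s'' x = int i \<and> I i s'') \<and>
          hi - nat (var s'' x) < hi - nat (var s' x)) s'"
      by (intro wp_Seq) (erule wp_conseq, intro wp_Assign, simp only: Let_def)
  next
    fix s' assume f: "frame ?w (setv x (int lo) s) s'"
      and "\<exists>i. lo \<le> i \<and> i \<le> hi \<and> var s' x = int i \<and> I i s'" and b: "\<not> bval (Less (V x) e) s'"
    then obtain i where i: "lo \<le> i" "i \<le> hi" "var s' x = int i" "I i s'" by blast
    then have "i = hi" using b hi[OF fr[OF f]] by simp
    then show "Q s'" using fin[OF fr[OF f]] i by simp
  qed
  then show ?thesis unfolding FOR_def using bounds(1) by (intro wp_Seq wp_Assign) simp
qed

section \<open>Multiplication and exact division\<close>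

definition pow_table :: "state \<Rightarrow> nat \<Rightarrow> bool" where
  "pow_table s l \<longleftrightarrow> var s ''L'' = int l \<and> (\<forall>i<l. arr s ''pw'' (int i) = 2 ^ i) \<and> arr s ''pw'' (- 1) = 0"

text \<open>Horner's scheme on the binary digits of the second factor. The digits are found from the
  top by comparison with powers of two, since halving is not an operation of the machine.\<close>

definition MULLOOP :: com where
  "MULLOOP =
     While (Less (N 0) (V ''mi''))
       (Assign ''mi'' (Sub (V ''mi'') (N 1));;
        Assign ''mr'' (Add (V ''mr'') (V ''mr''));;
        If (Less (V ''mb'') (Arr ''pw'' (V ''mi'')))
          Skip
          (Assign ''mb'' (Sub (V ''mb'') (Arr ''pw'' (V ''mi'')));;
           Assign ''mr'' (Add (V ''mr'') (V ''ma''))))"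

definition MULB :: com where
  "MULB =
     If (Less (V ''mb'') (N 0))
       (Assign ''ma'' (Sub (N 0) (V ''ma''));;
        Assign ''mb'' (Sub (N 0) (V ''mb'')))
       Skip;;
     Assign ''mr'' (N 0);;
     Assign ''mi'' (V ''L'');;
     MULLOOP"

lemma wvars_MULB [simp]: "wvars MULB = {''ma'', ''mb'', ''mr'', ''mi''}"
  and warrs_MULB [simp]: "warrs MULB = {}"
  by (auto simp: MULB_def MULLOOP_def)

text \<open>The loop invariant splits the product into the part already accumulated, still to be
  shifted by \<open>i\<close> bits, and the part of the remaining digits. Only the factor that is
  read bit by bit has to be below \<open>2 ^ l\<close>; the other one may have any size.\<close>

lemma wp_MULB:
  assumes pw: "pow_table s l" and l: "l \<le> b" and small: "\<bar>var s ''mb''\<bar> < 2 ^ l"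
  shows "wp b MULB (\<lambda>s'. var s' ''mr'' = var s ''ma'' * var s ''mb'') s"
proof -
  define X where "X = var s ''ma'' * var s ''mb''"
  define I where "I s' \<longleftrightarrow> pow_table s' l \<and> (\<exists>i\<le>l. var s' ''mi'' = int i \<and> 0 \<le> var s' ''mb'' \<and> var s' ''mb'' < 2 ^ i \<and>
      var s' ''mr'' * 2 ^ i + var s' ''ma'' * var s' ''mb'' = X)" for s'
  have loop: "wp b MULLOOP (\<lambda>s'. var s' ''mr'' = X) s1" if "I s1" for s1
    unfolding MULLOOP_def
  proof (rule wp_While[where I = I and \<mu> = "\<lambda>s. nat (var s ''mi'')"], goal_cases)
    case 1
    show ?case by (rule that)
  next
    case 2
    show ?case using that l by (auto simp: I_def)
  next
    case (3 s')
    then obtain i where i: "Suc i \<le> l" "var s' ''mi'' = 1 + int i" "0 \<le> var s' ''mb''" "var s' ''mb'' < 2 * 2 ^ i"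
      "var s' ''mr'' * (2 * 2 ^ i) + var s' ''ma'' * var s' ''mb'' = X"
      and p: "var s' ''L'' = int l" "\<forall>i<l. arr s' ''pw'' (int i) = 2 ^ i" "arr s' ''pw'' (- 1) = 0"
      unfolding I_def pow_table_def by (auto simp: gr0_conv_Suc)
    show ?case
      using i p by (intro wp_intros)
        (auto simp: I_def pow_table_def algebra_simps intro!: exI[of _ i])
  next
    case (4 s')
    then show ?case by (auto simp: I_def)
  qed
  show ?thesis unfolding MULB_def X_def[symmetric]
    using pw small by (intro wp_intros loop) (auto simp: I_def X_def pow_table_def)
qed

definition MUL :: "string \<Rightarrow> aexp \<Rightarrow> aexp \<Rightarrow> com" where
  "MUL r d e =
     Assign ''ma'' d;;
     Assign ''mb'' e;;
     MULB;;
     Assign r (V ''mr'')"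

lemma wvars_MUL [simp]: "wvars (MUL r d e) = {''ma'', ''mb'', ''mr'', ''mi'', r}"
  and warrs_MUL [simp]: "warrs (MUL r d e) = {}"
  by (auto simp: MUL_def)

lemma wp_MUL:
  assumes pw: "pow_table s l" and l: "l \<le> b"
    and vals: "aval d s = x" "aval e (setv ''ma'' x s) = y" and small: "\<bar>y\<bar> < 2 ^ l"
    and Q: "\<And>s'. frame (MUL r d e) s s' \<Longrightarrow> var s' r = x * y \<Longrightarrow> Q s'"
  shows "wp b (MUL r d e) Q s"
proof (rule wp_conseq)
  show "wp b (MUL r d e) (\<lambda>s'. var s' r = x * y) s"
    unfolding MUL_def
    apply (intro wp_Seq wp_Assign)
    apply (rule wp_conseq[OF wp_MULB[where l = l]])
    using pw l vals small by (auto simp: pow_table_def intro!: wp_Assign)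
qed (rule Q)

definition DIVLOOP :: com where
  "DIVLOOP =
     While (Less (N 0) (V ''di''))
       (Assign ''di'' (Sub (V ''di'') (N 1));;
        Assign ''dq'' (Add (V ''dq'') (V ''dq''));;
        If (Less (V ''da'') (Arr ''dt'' (V ''di'')))
          Skip
          (Assign ''da'' (Sub (V ''da'') (Arr ''dt'' (V ''di'')));;
           Assign ''dq'' (Add (V ''dq'') (N 1))))"

definition DIVB :: com where
  "DIVB =
     Assign ''dg'' (N 0);;
     If (Less (V ''da'') (N 0))
       (Assign ''da'' (Sub (N 0) (V ''da''));;
        Assign ''dg'' (N 1))
       Skip;;
     Store ''dt'' (N 0) (V ''dd'');;
     FOR ''di'' (N 0) (V ''L'')
       (Store ''dt'' (Add (V ''di'') (N 1)) (Add (Arr ''dt'' (V ''di'')) (Arr ''dt'' (V ''di''))));;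
     Assign ''dq'' (N 0);;
     Assign ''di'' (V ''L'');;
     DIVLOOP;;
     If (Less (N 0) (V ''dg'')) (Assign ''dq'' (Sub (N 0) (V ''dq''))) Skip"

lemma wvars_DIVB [simp]: "wvars DIVB = {''da'', ''dg'', ''di'', ''dq''}"
  and warrs_DIVB [simp]: "warrs DIVB = {''dt''}"
  by (auto simp: DIVB_def DIVLOOP_def)

text \<open>Long division by the multiples \<open>d * 2 ^ i\<close>, which are obtained by doubling.
  Exactness is assumed: what the loop leaves is below \<open>d\<close> and a multiple of
  \<open>d\<close>, hence 0. The sign is put aside in \<open>dg\<close>.\<close>

lemma wp_DIVB:
  assumes L: "var s ''L'' = int l" "l \<le> b" and d: "var s ''dd'' = d" "0 < d"
    and a: "var s ''da'' = d * q" and q: "\<bar>q\<bar> < 2 ^ l"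
  shows "wp b DIVB (\<lambda>s'. var s' ''dq'' = q) s"
proof -
  define g where "g = (if q < 0 then 1 else 0 :: int)"
  define base where "base s' m \<longleftrightarrow> var s' ''L'' = int l \<and> var s' ''dd'' = d \<and> var s' ''dg'' = g \<and>
    (\<forall>i\<le>m. arr s' ''dt'' (int i) = d * 2 ^ i)" for s' :: state and m :: nat
  define J where "J m s' \<longleftrightarrow> base s' m \<and> var s' ''da'' = d * \<bar>q\<bar>" for s' m
  define I where "I s' \<longleftrightarrow> base s' l \<and> (\<exists>i\<le>l. var s' ''di'' = int i \<and> 0 \<le> var s' ''da'' \<and>
      var s' ''da'' < d * 2 ^ i \<and> var s' ''dq'' * (d * 2 ^ i) + var s' ''da'' = d * \<bar>q\<bar>)" for s'
  have loop: "wp b DIVLOOP (\<lambda>s'. base s' l \<and> var s' ''dq'' = \<bar>q\<bar>) s1" if "I s1" for s1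
    unfolding DIVLOOP_def
  proof (rule wp_While[where I = I and \<mu> = "\<lambda>s. nat (var s ''di'')"], goal_cases)
    case 1
    show ?case by (rule that)
  next
    case 2
    show ?case using that L by (auto simp: I_def)
  next
    case (3 s')
    then obtain i where i: "Suc i \<le> l" "var s' ''di'' = 1 + int i" "0 \<le> var s' ''da''"
      "var s' ''da'' < 2 * (d * 2 ^ i)" "var s' ''dq'' * (2 * (d * 2 ^ i)) + var s' ''da'' = d * \<bar>q\<bar>"
      and t: "base s' l"
      unfolding I_def by (auto simp: gr0_conv_Suc algebra_simps)
    have dt: "arr s' ''dt'' (int i) = d * 2 ^ i" using t i(1) by (auto simp: base_def)
    show ?case
      using i t dt by (intro wp_intros)
        (auto simp: I_def base_def algebra_simps intro!: exI[of _ i])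
  next
    case (4 s')
    then have 1: "base s' l" "0 \<le> var s' ''da''" "var s' ''da'' < d"
      and 2: "d * (\<bar>q\<bar> - var s' ''dq'') = var s' ''da''" by (auto simp: I_def algebra_simps)
    have "\<bar>q\<bar> - var s' ''dq'' < 1" using 1(3) d(2) unfolding 2[symmetric]
      by (metis mult_less_cancel_left_pos mult.right_neutral)
    moreover have "0 \<le> \<bar>q\<bar> - var s' ''dq''" using 1(2) d(2) unfolding 2[symmetric]
      by (simp add: zero_le_mult_iff)
    ultimately show ?case using 1 by simp
  qed
  have init: "wp b (FOR ''di'' (N 0) (V ''L'') (Store ''dt'' (Add (V ''di'') (N 1)) (Add (Arr ''dt'' (V ''di'')) (Arr ''dt'' (V ''di'')))))
      (J l) s1" if "J 0 s1" for s1
    by (rule wp_FOR[where I = J and lo = 0 and hi = l])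
      (use that L(2) in \<open>auto simp: J_def base_def le_Suc_eq frame_def add.commute intro!: wp_intros\<close>)
  have neg: "d * q < 0 \<longleftrightarrow> q < 0" "d * q \<le> 0 \<longleftrightarrow> q \<le> 0" using d by (auto simp: mult_less_0_iff mult_le_0_iff)
  have "d * \<bar>q\<bar> < d * 2 ^ l" using q d by simp
  then have "\<bar>d * q\<bar> < d * 2 ^ l" using d by (simp add: abs_mult)
  then have lt: "- (d * q) < d * 2 ^ l" "d * q < d * 2 ^ l" by linarith+
  show ?thesis unfolding DIVB_def
    apply (intro wp_intros)
    apply (auto intro!: wp_conseq[OF init] wp_intros wp_conseq[OF loop])
    using L(1) d a q lt by (auto simp: I_def J_def base_def g_def neg abs_if split: if_splits)
qed

section \<open>Computing the projection\<close>

text \<open>The array \<open>rb\<close> holds the offsets \<open>i * n\<close> of matrix rows,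
  because computing an address would need a multiplication.\<close>

definition ROWLOAD :: com where
  "ROWLOAD =
     FOR ''c'' (N 0) (V ''n'')
       (MUL ''t'' (Arr ''pw'' (Arr ''e'' (V ''c''))) (Arr ''A'' (Add (Arr ''rb'' (V ''r'')) (V ''c'')));;
        Store ''a'' (V ''c'') (V ''t''))"

definition PIVOT :: com where
  "PIVOT =
     Assign ''q'' (N 0);;
     FOR ''i'' (N 0) (V ''n'')
       (Assign ''y'' (N 0);;
        FOR ''c'' (N 0) (V ''n'')
          (MUL ''t'' (Arr ''nn'' (Add (Arr ''rb'' (V ''i'')) (V ''c''))) (Arr ''a'' (V ''c''));;
           Assign ''y'' (Add (V ''y'') (V ''t'')));;
        Store ''v'' (V ''i'') (V ''y'');;
        MUL ''t'' (V ''y'') (Arr ''a'' (V ''i''));;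
        Assign ''q'' (Add (V ''q'') (V ''t'')))"

text \<open>Fraction-free elimination in the manner of Bareiss. For a projection \<open>P\<close>
  with denominator \<open>D\<close>, the array \<open>nn\<close> holds \<open>D * P\<close>,
  \<open>v\<close> holds \<open>D\<close> times the projected row, and \<open>q\<close> is the next
  denominator; the new numerator is \<open>q\<close> times the old one minus a product of two
  entries of \<open>v\<close>, divided exactly by \<open>D\<close>.\<close>

definition UPDATE :: com where
  "UPDATE =
     FOR ''i'' (N 0) (V ''n'')
       (FOR ''j'' (N 0) (V ''n'')
          (MUL ''y'' (V ''q'') (Arr ''nn'' (Add (Arr ''rb'' (V ''i'')) (V ''j'')));;
           MUL ''t'' (Arr ''v'' (V ''i'')) (Arr ''v'' (V ''j''));;
           Assign ''da'' (Sub (V ''y'') (V ''t''));;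
           Assign ''dd'' (V ''d'');;
           DIVB;;
           Store ''nn'' (Add (Arr ''rb'' (V ''i'')) (V ''j'')) (V ''dq'')))"

definition INITN :: com where
  "INITN =
     Assign ''d'' (N 1);;
     FOR ''i'' (N 0) (V ''n'')
       (FOR ''j'' (N 0) (V ''n'') (Store ''nn'' (Add (Arr ''rb'' (V ''i'')) (V ''j'')) (N 0));;
        Store ''nn'' (Add (Arr ''rb'' (V ''i'')) (V ''i'')) (N 1))"

definition PROJECT :: com where
  "PROJECT =
     INITN;;
     FOR ''r'' (N 0) (V ''R'')
       (ROWLOAD;;
        PIVOT;;
        If (Less (N 0) (V ''q''))
          (UPDATE;;
           Assign ''d'' (V ''q''))
          Skip)"

lemma wvars_ROWLOAD [simp]: "wvars ROWLOAD = {''c'', ''t'', ''ma'', ''mb'', ''mr'', ''mi''}"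
  and warrs_ROWLOAD [simp]: "warrs ROWLOAD = {''a''}"
  by (auto simp: ROWLOAD_def)

lemma wvars_PIVOT [simp]: "wvars PIVOT = {''q'', ''i'', ''y'', ''c'', ''t'', ''ma'', ''mb'', ''mr'', ''mi''}"
  and warrs_PIVOT [simp]: "warrs PIVOT = {''v''}"
  by (auto simp: PIVOT_def)

lemma wvars_UPDATE [simp]: "wvars UPDATE = {''i'', ''j'', ''y'', ''t'', ''da'', ''dd'', ''dg'', ''di'', ''dq'', ''ma'', ''mb'', ''mr'', ''mi''}"
  and warrs_UPDATE [simp]: "warrs UPDATE = {''nn'', ''dt''}"
  by (auto simp: UPDATE_def)

lemma wvars_INITN [simp]: "wvars INITN = {''d'', ''i'', ''j''}"
  and warrs_INITN [simp]: "warrs INITN = {''nn''}"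
  by (auto simp: INITN_def)

lemma wvars_PROJECT [simp]: "wvars PROJECT = {''q'', ''c'', ''d'', ''r'', ''i'', ''j'', ''y'', ''t'', ''da'', ''dd'', ''dg'', ''di'', ''dq'', ''ma'', ''mb'', ''mr'', ''mi''}"
  and warrs_PROJECT [simp]: "warrs PROJECT = {''nn'', ''dt'', ''a'', ''v''}"
  by (auto simp: PROJECT_def)

lemma matrix_index_eq:
  fixes n i j i' j' :: nat
  assumes "j < n" "j' < n"
  shows "i * n + j = i' * n + j' \<longleftrightarrow> i = i' \<and> j = j'"
proof
  assume eq: "i * n + j = i' * n + j'"
  have "(i * n + j) div n = i" "(i' * n + j') div n = i'" using assms by auto
  then have "i = i'" using eq by simp
  then show "i = i' \<and> j = j'" using eq by simp
qed simp

lemma matrix_index_eq_int: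
  fixes n i j i' j' :: nat
  assumes "j < n" "j' < n"
  shows "int i * int n + int j = int i' * int n + int j' \<longleftrightarrow> i = i' \<and> j = j'"
  using matrix_index_eq[OF assms, of i i'] by (metis of_nat_add of_nat_eq_iff of_nat_mult)

text \<open>The exponent \<open>K\<close> makes \<open>2 ^ K\<close> at least \<open>n ^ R\<close>,
  the bound for small solutions. A scaled row has squared length at most
  \<open>2 ^ (n + K + K)\<close>, so the denominator is at most the \<open>R\<close>-th power of
  this; the additional factor in \<open>l\<close> pays for the projected row, and the final 1 makes
  the bounds strict. In the bounds on \<open>b\<close>, the two last summands 1 pay for an iteration
  that ends a loop by setting \<open>done\<close>.\<close>

locale lp_data =
  fixes n R b K l :: nat and A :: "nat \<Rightarrow> nat \<Rightarrow> int"
  assumes n_pos: "0 < n"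
    and A_le: "\<And>r c. r < R \<Longrightarrow> c < n \<Longrightarrow> \<bar>A r c\<bar> \<le> 1"
    and K_def: "K = n * R"
    and l_def: "l = (n + K + K) * (R + 1) + 1"
    and b_ge: "n + R \<le> b" "l \<le> b" "4 * n ^ 3 + 1 \<le> b" "n * (K + 1) + 1 \<le> b"
begin

section \<open>Bounds on the size of all numbers in the projection\<close>

definition ctx :: "state \<Rightarrow> bool" where
  "ctx s \<longleftrightarrow> var s ''n'' = int n \<and> var s ''R'' = int R \<and> pow_table s l \<and>
     (\<forall>i<n + R. arr s ''rb'' (int i) = int i * int n) \<and>
     (\<forall>r<R. \<forall>c<n. arr s ''A'' (int r * int n + int c) = A r c)"

lemma ctx_frame:
  assumes "frame c s s'" "ctx s" "wvars c \<inter> {''n'', ''R'', ''L''} = {}" "warrs c \<inter> {''A'', ''rb'', ''pw''} = {}"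
  shows "ctx s'"
  using assms by (auto simp: ctx_def frame_def pow_table_def disjoint_iff)

lemma ctx_setv [simp]: "x \<notin> {''n'', ''R'', ''L''} \<Longrightarrow> ctx (setv x k s) \<longleftrightarrow> ctx s"
  by (auto simp: ctx_def pow_table_def)

lemma ctx_seta [simp]: "x \<notin> {''A'', ''rb'', ''pw''} \<Longrightarrow> ctx (seta x k w s) \<longleftrightarrow> ctx s"
  by (auto simp: ctx_def pow_table_def)

lemma ctxD:
  assumes "ctx s"
  shows "var s ''n'' = int n" "var s ''R'' = int R" "pow_table s l"
    "\<And>i. i < n + R \<Longrightarrow> arr s ''rb'' (int i) = int i * int n"
    "\<And>i. i < n \<Longrightarrow> arr s ''rb'' (int i) = int i * int n"
    "\<And>i. i < R \<Longrightarrow> arr s ''rb'' (int i) = int i * int n"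
    "\<And>r c. r < R \<Longrightarrow> c < n \<Longrightarrow> arr s ''A'' (int r * int n + int c) = A r c"
  using assms by (auto simp: ctx_def)

lemma l_pos: "0 < l" and K_less_l: "K < l" and b_le: "n \<le> b" "R \<le> b" "l \<le> b"
  using b_ge by (auto simp: l_def)

definition eok :: "(nat \<Rightarrow> int) \<Rightarrow> bool" where
  "eok e \<longleftrightarrow> (\<forall>c<n. - 1 \<le> e c \<and> e c \<le> int K)"

lemma pw_scale: "pow_table s l \<Longrightarrow> eok e \<Longrightarrow> c < n \<Longrightarrow> arr s ''pw'' (e c) = scale e c"
proof -
  assume pt: "pow_table s l" and e: "eok e" and c: "c < n"
  show ?thesis
  proof (cases "e c < 0")
    case True
    then have "e c = - 1" using e c by (force simp: eok_def)
    then show ?thesis using pt by (simp add: scale_def pow_table_def)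
  next
    case False
    have "e c = int (nat (e c))" "nat (e c) < l" using False e c K_less_l by (force simp: eok_def)+
    then show ?thesis using pt False unfolding pow_table_def by (metis scale_def)
  qed
qed

lemma scale_bounds: "eok e \<Longrightarrow> c < n \<Longrightarrow> 0 \<le> scale e c \<and> scale e c \<le> 2 ^ K"
  by (auto simp: scale_def eok_def intro!: power_increasing)

definition srows :: "(nat \<Rightarrow> int) \<Rightarrow> nat \<Rightarrow> nat \<Rightarrow> real" where
  "srows e = srow A (\<lambda>c. of_int (scale e c))"

lemma srows_int: "srows e r c = of_int (A r c * scale e c)"
  by (simp add: srows_def srow_def)

lemma srows_Ints: "srows e r c \<in> \<int>"
  by (simp add: srows_int)

lemma srows_abs: 
  assumes "eok e" "r < R" "c < n" shows "\<bar>A r c * scale e c\<bar> \<le> 2 ^ K"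
proof -
  have "\<bar>A r c * scale e c\<bar> \<le> 1 * 2 ^ K" unfolding abs_mult
    using scale_bounds[OF assms(1,3)] A_le[OF assms(2,3)] by (intro mult_mono) auto
  then show ?thesis by simp
qed

lemma srows_abs_real: 
  assumes "eok e" "r < R" "c < n" shows "\<bar>srows e r c\<bar> \<le> 2 ^ K"
proof -
  have "real_of_int \<bar>A r c * scale e c\<bar> \<le> real_of_int (2 ^ K)"
    using srows_abs[OF assms] by (simp only: of_int_le_iff)
  then show ?thesis by (simp add: srows_int)
qed

lemma srows_sq:
  assumes "eok e" "r < R" shows "ip n (srows e r) (srows e r) \<le> 2 ^ (n + K + K)"
proof -
  have "srows e r c * srows e r c \<le> 2 ^ (K + K)" if "c < n" for c
  proof -
    have "\<bar>srows e r c\<bar> * \<bar>srows e r c\<bar> \<le> 2 ^ K * 2 ^ K"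
      using srows_abs_real[OF assms that] by (intro mult_mono) auto
    then show ?thesis by (simp add: power_add)
  qed
  then have "ip n (srows e r) (srows e r) \<le> (\<Sum>c<n. 2 ^ (K + K))"
    unfolding ip_def by (intro sum_mono) auto
  also have "\<dots> = real n * 2 ^ (K + K)" by simp
  also have "\<dots> \<le> 2 ^ n * 2 ^ (K + K)"
    using less_exp[of n] by (intro mult_right_mono) (auto simp: of_nat_less_numeral_power_cancel_iff less_imp_le)
  finally show ?thesis by (simp add: power_add algebra_simps)
qed

lemma pden_bound:
  assumes "eok e" "r \<le> R" shows "pden n (srows e) r \<le> 2 ^ ((n + K + K) * R)"
proof -
  have "pden n (srows e) r \<le> (2 ^ (n + K + K)) ^ r"
    using assms srows_sq by (intro pden_le) (auto simp: one_le_power)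
  also have "\<dots> \<le> 2 ^ ((n + K + K) * R)"
    unfolding power_mult[symmetric] using assms by (intro power_increasing) auto
  finally show ?thesis .
qed

lemma pden_bound_strict:
  assumes "eok e" "r \<le> R" shows "pden n (srows e) r < 2 ^ l"
proof -
  have "(2::real) ^ ((n + K + K) * R) < 2 ^ l" by (rule power_strict_increasing) (simp_all add: l_def)
  then show ?thesis using pden_bound[OF assms] by linarith
qed

lemma proj_entry_bound:
  assumes "eok e" "r \<le> R" "i < n" "j < n"
  shows "\<bar>pden n (srows e) r * proj n (srows e) r i j\<bar> < 2 ^ l"
proof -
  have "\<bar>pden n (srows e) r * proj n (srows e) r i j\<bar> \<le> pden n (srows e) r * 1"
    unfolding abs_mult using pden_pos[of n "srows e" r] proj_abs_le[OF assms(3,4), of "srows e" r]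
    by (intro mult_mono) auto
  then show ?thesis using pden_bound_strict[OF assms(1,2)] by linarith
qed

lemma proj_row_bound:
  assumes "eok e" "r < R" "i < n"
  shows "\<bar>pden n (srows e) r * mv n (proj n (srows e) r) (srows e r) i\<bar> < 2 ^ l"
proof -
  have "\<bar>mv n (proj n (srows e) r) (srows e r) i\<bar> \<le> (\<Sum>j<n. \<bar>proj n (srows e) r i j * srows e r j\<bar>)"
    unfolding mv_def by (rule sum_abs)
  also have "\<dots> \<le> (\<Sum>j<n. 1 * 2 ^ K)"
    unfolding abs_mult using proj_abs_le[OF assms(3)] srows_abs_real[OF assms(1,2)]
    by (intro sum_mono mult_mono) auto
  also have "\<dots> = real n * 2 ^ K" by simp
  also have "\<dots> \<le> 2 ^ n * 2 ^ (K + K)"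
    using less_exp[of n] by (intro mult_mono) (auto simp: of_nat_less_numeral_power_cancel_iff less_imp_le intro!: power_increasing)
  finally have 1: "\<bar>mv n (proj n (srows e) r) (srows e r) i\<bar> \<le> 2 ^ (n + K + K)" by (simp add: power_add algebra_simps)
  have "\<bar>pden n (srows e) r * mv n (proj n (srows e) r) (srows e r) i\<bar> \<le> 2 ^ ((n + K + K) * R) * 2 ^ (n + K + K)"
    unfolding abs_mult using 1 pden_pos[of n "srows e" r] pden_bound[OF assms(1), of r] assms(2)
    by (intro mult_mono) auto
  also have "\<dots> = 2 ^ ((n + K + K) * (R + 1))" by (simp add: power_add algebra_simps)
  also have "\<dots> < (2::real) ^ l" by (rule power_strict_increasing) (simp_all add: l_def)
  finally show ?thesis .
qed

lemma of_int_abs_less: "\<bar>real_of_int x\<bar> < 2 ^ k \<Longrightarrow> \<bar>x\<bar> < 2 ^ k"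
  by (metis of_int_abs of_int_less_iff of_int_numeral of_int_power)

lemma A_small: "r < R \<Longrightarrow> c < n \<Longrightarrow> \<bar>A r c\<bar> < 2 ^ l"
proof -
  assume "r < R" "c < n"
  then have "\<bar>A r c\<bar> \<le> 1" by (rule A_le)
  moreover have "(1::int) < 2 ^ l" using l_pos by simp
  ultimately show ?thesis by linarith
qed

abbreviation es :: "state \<Rightarrow> nat \<Rightarrow> int" where
  "es s c \<equiv> arr s ''e'' (int c)"

section \<open>Verification of the projection program\<close>

lemma wp_ROWLOAD:
  assumes "ctx s" "eok (es s)" "var s ''r'' = int r" "r < R"
  shows "wp b ROWLOAD (\<lambda>s'. \<forall>c<n. arr s' ''a'' (int c) = A r c * scale (es s) c) s"
  unfolding ROWLOAD_def
proof (rule wp_FOR[where lo = 0 and hi = n and I = "\<lambda>i s'. \<forall>c<i. arr s' ''a'' (int c) = A r c * scale (es s) c"], goal_cases)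
  case (7 i s')
  note i = 7(3,4) and I = 7(5)
  note fr = frameD[OF 7(1), simplified]
  have c: "ctx s'" by (rule ctx_frame[OF 7(1) assms(1)]) auto
  have e: "es s' = es s" by (simp add: fr)
  show ?case
    apply (intro wp_Seq)
    apply (rule wp_MUL[where l = l and x = "scale (es s) i" and y = "A r i"])
    using c b_le i assms e pw_scale[OF ctxD(3)[OF c], of "es s" i] A_le[of r i] l_pos
         apply (simp_all add: ctxD fr A_small)[5]
    apply (intro wp_intros)
    using I i by (auto simp: frame_def less_Suc_eq)
qed (use assms b_le in \<open>auto simp: ctxD frame_def\<close>)

definition holdsN :: "(nat \<Rightarrow> int) \<Rightarrow> nat \<Rightarrow> state \<Rightarrow> bool" where
  "holdsN e r s \<longleftrightarrow> real_of_int (var s ''d'') = pden n (srows e) r \<and>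
     (\<forall>i<n. \<forall>j<n. real_of_int (arr s ''nn'' (int i * int n + int j)) = pden n (srows e) r * proj n (srows e) r i j)"

lemma wp_PIVOT:
  assumes s: "ctx s" "holdsN e r s" and e: "eok e" and r: "r < R"
    and a: "\<And>c. c < n \<Longrightarrow> arr s ''a'' (int c) = A r c * scale e c"
  shows "wp b PIVOT (\<lambda>s'. (\<forall>i<n. real_of_int (arr s' ''v'' (int i)) = pden n (srows e) r * mv n (proj n (srows e) r) (srows e r) i) \<and>
      real_of_int (var s' ''q'') = pden n (srows e) r * ip n (mv n (proj n (srows e) r) (srows e r)) (srows e r)) s"
proof -
  define D where "D = pden n (srows e) r"
  define P where "P = proj n (srows e) r"
  define I where "I m s' \<longleftrightarrow> (\<forall>i<m. real_of_int (arr s' ''v'' (int i)) = D * mv n P (srows e r) i) \<and>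
      real_of_int (var s' ''q'') = D * (\<Sum>i<m. mv n P (srows e r) i * srows e r i)" for m and s' :: state
  have small: "\<bar>A r c * scale e c\<bar> < 2 ^ l" if "c < n" for c
    using srows_abs[OF e r that] K_less_l power_strict_increasing[of K l "2::int"] by linarith
  show ?thesis unfolding PIVOT_def
  proof (intro wp_Seq wp_Assign, rule wp_FOR[where lo = 0 and hi = n and I = I], goal_cases)
    case (7 i s')
    note fr = frameD[OF 7(1), simplified]
    have c: "ctx s'" by (rule ctx_frame[OF 7(1)]) (use s in auto)
    have nn: "real_of_int (arr s' ''nn'' (int i * int n + int j)) = D * P i j" if "j < n" for j
      using s(2) 7(3) that by (simp add: fr holdsN_def D_def P_def)
    have i: "i < n" "var s' ''i'' = int i" "I i s'" using 7 by auto
    have rb: "arr s' ''rb'' (int i) = int i * int n" using ctxD(5)[OF c i(1)] .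
    show ?case
    proof (intro wp_Seq wp_Assign, rule wp_FOR[where lo = 0 and hi = n and
          I = "\<lambda>m s'. real_of_int (var s' ''y'') = D * (\<Sum>j<m. P i j * srows e r j)"], goal_cases)
      case (7 j s2)
      note fr2 = frameD[OF 7(1), simplified]
      have c2: "ctx s2" by (rule ctx_frame[OF 7(1)]) (use c in auto)
      show ?case
        apply (intro wp_Seq)
        apply (rule wp_MUL[where l = l and x = "arr s' ''nn'' (int i * int n + int j)" and y = "A r j * scale e j"])
             apply (use c2 7 i b_le small fr2 fr a rb in \<open>simp_all add: ctxD\<close>)[5]
        apply (rule wp_Assign)
        apply (use 7 nn[of j] in \<open>simp add: frame_var algebra_simps srows_int\<close>)
        done
    next
      case (8 s2)
      note fr2 = frameD[OF 8(1), simplified]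
      have c2: "ctx s2" by (rule ctx_frame[OF 8(1)]) (use c in auto)
      have y: "real_of_int (var s2 ''y'') = D * mv n P (srows e r) i"
        using 8(3) by (simp add: mv_def)
      show ?case
        apply (intro wp_Seq wp_Store)
        apply (rule wp_MUL[where l = l and x = "var s2 ''y''" and y = "A r i * scale e i"])
             apply (use c2 i b_le small fr2 fr a in \<open>simp_all add: ctxD\<close>)[5]
        apply (rule wp_Assign)
        apply (use i y in \<open>auto simp add: I_def frameD fr2 algebra_simps srows_int less_Suc_eq\<close>)
        done
    qed (use c b_le in \<open>auto simp: ctxD frameD\<close>)
  qed (use s b_le in \<open>auto simp: ctxD frameD I_def ip_def D_def P_def\<close>)
qed

lemma wp_UPDATE:
  assumes s: "ctx s" "holdsN e r s" and e: "eok e" and r: "r < R"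
    and v: "\<And>i. i < n \<Longrightarrow> real_of_int (arr s ''v'' (int i)) = pden n (srows e) r * mv n (proj n (srows e) r) (srows e r) i"
    and q: "real_of_int (var s ''q'') = pden n (srows e) r * ip n (mv n (proj n (srows e) r) (srows e r)) (srows e r)"
    and qpos: "0 < var s ''q''"
  shows "wp b UPDATE (\<lambda>s'. \<forall>i<n. \<forall>j<n. real_of_int (arr s' ''nn'' (int i * int n + int j)) =
      pden n (srows e) (Suc r) * proj n (srows e) (Suc r) i j) s"
proof -
  define D where "D = pden n (srows e) r"
  define P where "P = proj n (srows e) r"
  define Q where "Q = ip n (mv n P (srows e r)) (srows e r)"
  define D' where "D' = pden n (srows e) (Suc r)"
  define P' where "P' = proj n (srows e) (Suc r)"
  have D: "0 < D" unfolding D_def by (rule pden_pos)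
  have "0 < real_of_int (var s ''q'')" using qpos by simp
  then have Q: "0 < Q" using D q unfolding D_def[symmetric] P_def[symmetric] Q_def[symmetric]
    by (simp add: zero_less_mult_iff)
  have D': "D' = D * Q" using Q by (simp add: D'_def D_def Q_def P_def Let_def)
  have P': "P' i j = P i j - mv n P (srows e r) i * mv n P (srows e r) j / Q" for i j
    using Q by (simp add: P'_def Q_def P_def Let_def)
  \<comment> \<open>Integrality and size of the new numerators follow from the determinants,
    independently of the program; both are needed for the division.\<close>
  have ex: "\<exists>k. real_of_int k = D' * P' i j \<and> \<bar>k\<bar> < 2 ^ l" if "i < n" "j < n" for i j
  proof -
    have "D' * P' i j \<in> \<int>" unfolding D'_def P'_def by (intro pden_proj_Ints srows_Ints that)
    then obtain k where k: "D' * P' i j = of_int k" by (rule Ints_cases)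
    moreover have "\<bar>D' * P' i j\<bar> < 2 ^ l"
      unfolding D'_def P'_def using r by (intro proj_entry_bound e that) auto
    ultimately show ?thesis by (intro exI[of _ k]) (simp add: of_int_abs_less)
  qed
  define I where "I m s' \<longleftrightarrow> (\<forall>i<n. \<forall>j<n. real_of_int (arr s' ''nn'' (int i * int n + int j)) =
      (if i < m then D' * P' i j else D * P i j))" for m and s' :: state
  \<comment> \<open>Updating in place is safe, since a new entry depends only on the old entry at
    the same position and on \<open>v\<close>, \<open>q\<close> and \<open>d\<close>.\<close>
  define J where "J m k s' \<longleftrightarrow> (\<forall>i<n. \<forall>j<n. real_of_int (arr s' ''nn'' (int i * int n + int j)) =
      (if i < m \<or> i = m \<and> j < k then D' * P' i j else D * P i j))" for m k and s' :: state
  have small: "\<bar>arr s ''v'' (int j)\<bar> < 2 ^ l" if "j < n" for j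
    by (rule of_int_abs_less) (use v[OF that] proj_row_bound[OF e r that] in simp)
  show ?thesis unfolding UPDATE_def
  proof (rule wp_FOR[where lo = 0 and hi = n and I = I], goal_cases)
    case (7 i s')
    note fr = frameD[OF 7(1), simplified]
    have c: "ctx s'" by (rule ctx_frame[OF 7(1)]) (use s in auto)
    have i: "i < n" "var s' ''i'' = int i" "I i s'" using 7 by auto
    show ?case
    proof (rule wp_FOR[where lo = 0 and hi = n and I = "J i"], goal_cases)
      case (7 j s2)
      note fr2 = frameD[OF 7(1), simplified]
      have c2: "ctx s2" by (rule ctx_frame[OF 7(1)]) (use c in auto)
      have j: "j < n" "var s2 ''j'' = int j" "J i j s2" using 7 by auto
      have nn: "real_of_int (arr s2 ''nn'' (int i * int n + int j)) = D * P i j"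
        using j i unfolding J_def by simp
      have "\<bar>real_of_int (arr s2 ''nn'' (int i * int n + int j))\<bar> < 2 ^ l"
        unfolding nn D_def P_def using r by (intro proj_entry_bound e i j) auto
      then have nsmall: "\<bar>arr s2 ''nn'' (int i * int n + int j)\<bar> < 2 ^ l" by (rule of_int_abs_less)
      have rb: "arr s2 ''rb'' (int i) = int i * int n" using ctxD(5)[OF c2 i(1)] .
      obtain k where k: "real_of_int k = D' * P' i j" "\<bar>k\<bar> < 2 ^ l" using ex[OF i(1) j(1)] by blast
      have dd: "real_of_int (var s ''d'') = D" using s(2) by (simp add: holdsN_def D_def)
      have "real_of_int (var s ''q'' * arr s2 ''nn'' (int i * int n + int j) - arr s ''v'' (int i) * arr s ''v'' (int j))
          = D * Q * (D * P i j) - D * mv n P (srows e r) i * (D * mv n P (srows e r) j)"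
        using q v i(1) j(1) by (simp add: nn D_def P_def Q_def)
      also have "\<dots> = D * (D' * P' i j)" using Q by (simp add: D' P' field_simps)
      also have "\<dots> = real_of_int (var s ''d'' * k)" by (simp add: k dd)
      finally have exact: "var s ''q'' * arr s2 ''nn'' (int i * int n + int j) - arr s ''v'' (int i) * arr s ''v'' (int j) = var s ''d'' * k"
        by (simp only: of_int_eq_iff)
      have dpos: "0 < var s ''d''" using D dd by simp
      show ?case
        apply (intro wp_Seq)
        apply (rule wp_MUL[where l = l and x = "var s ''q''" and y = "arr s2 ''nn'' (int i * int n + int j)"])
             apply (use c2 j i b_le nsmall fr2 fr rb in \<open>simp_all add: ctxD\<close>)[5]
        subgoal premises p for s3
          apply (rule wp_Seq)
          apply (rule wp_MUL[where l = l and x = "arr s ''v'' (int i)" and y = "arr s ''v'' (int j)"])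
               apply (use c2 ctx_frame[OF p(1) c2] j i b_le small fr2 fr frameD[OF p(1)] in \<open>simp_all add: ctxD\<close>)[5]
          subgoal premises p2 for s4
            apply (intro wp_Seq wp_Assign)
            apply (rule wp_conseq[OF wp_DIVB[where l = l and d = "var s ''d''" and q = k]])
                  apply (use c2 b_le p(2) p2(2) exact k(2) dpos in \<open>simp_all add: frameD[OF p(1)] frameD[OF p2(1)] fr2 fr ctxD pow_table_def[symmetric]\<close>)[6]
            subgoal using ctxD(3)[OF s(1)] by (simp add: pow_table_def)
            subgoal premises p3 for s5
              apply (rule wp_Store)
              using j i rb k(1) p3(2)
              apply (simp add: J_def frameD[OF p(1)] frameD[OF p2(1)] frameD[OF p3(1)] fr2 matrix_index_eq_int)
              done
            done
          done
        done
    next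
      case (8 s2)
      then show ?case by (auto simp: I_def J_def less_Suc_eq)
    qed (use c i b_le in \<open>auto simp: ctxD frameD I_def J_def\<close>)
  qed (use s b_le in \<open>auto simp: ctxD frameD I_def D_def P_def D'_def P'_def holdsN_def\<close>)
qed

lemma wp_INITN:
  assumes s: "ctx s"
  shows "wp b INITN (holdsN e 0) s"
proof -
  define f where "f i j = (if i = j then 1 else 0 :: int)" for i j :: nat
  define I where "I m s' \<longleftrightarrow> (\<forall>i<m. \<forall>j<n. arr s' ''nn'' (int i * int n + int j) = f i j)" for m and s' :: state
  define J where "J m k s' \<longleftrightarrow> I m s' \<and> (\<forall>j<k. arr s' ''nn'' (int m * int n + int j) = 0)" for m k and s' :: state
  show ?thesis unfolding INITN_def
  proof (intro wp_Seq wp_Assign, rule wp_FOR[where lo = 0 and hi = n and I = I], goal_cases)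
    case (7 i s')
    note fr = frameD[OF 7(1), simplified]
    have c: "ctx s'" by (rule ctx_frame[OF 7(1)]) (use s in auto)
    have i: "i < n" "var s' ''i'' = int i" "I i s'" using 7 by auto
    show ?case
    proof (rule wp_Seq, rule wp_FOR[where lo = 0 and hi = n and I = "J i"], goal_cases)
      case (7 j s2)
      note fr2 = frameD[OF 7(1), simplified]
      have c2: "ctx s2" by (rule ctx_frame[OF 7(1)]) (use c in auto)
      have rb: "arr s2 ''rb'' (int i) = int i * int n" using ctxD(5)[OF c2 i(1)] .
      show ?case
        apply (rule wp_Store)
        using 7 rb i by (auto simp: J_def I_def fr2 matrix_index_eq_int)
    next
      case (8 s2)
      note fr2 = frameD[OF 8(1), simplified]
      have c2: "ctx s2" by (rule ctx_frame[OF 8(1)]) (use c in auto)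
      have rb: "arr s2 ''rb'' (int i) = int i * int n" using ctxD(5)[OF c2 i(1)] .
      show ?case
        apply (rule wp_Store)
        using 8 rb i by (auto simp: J_def I_def fr2 matrix_index_eq_int less_Suc_eq f_def)
    qed (use c i b_le in \<open>auto simp: ctxD frameD I_def J_def\<close>)
  qed (use s b_le in \<open>auto simp: ctxD frameD I_def f_def holdsN_def\<close>)
qed

lemma holdsN_frame:
  "frame c s s' \<Longrightarrow> holdsN e r s \<Longrightarrow> ''d'' \<notin> wvars c \<Longrightarrow> ''nn'' \<notin> warrs c \<Longrightarrow> holdsN e r s'"
  by (simp add: holdsN_def frame_def)

lemma wp_PROJECT:
  assumes s: "ctx s" and e: "eok (es s)"
  shows "wp b PROJECT (holdsN (es s) R) s"
  unfolding PROJECT_def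
proof (rule wp_Seq, rule wp_conseq[OF wp_INITN[OF s, of "es s"]],
    rule wp_FOR[where lo = 0 and hi = R and I = "holdsN (es s)"], goal_cases)
  case (7 s1 r s')
  have c1: "ctx s1" by (rule ctx_frame[OF 7(1) s]) auto
  have c: "ctx s'" by (rule ctx_frame[OF 7(3) c1]) auto
  have es: "es s' = es s" using frame_arr[OF 7(3)] frame_arr[OF 7(1)] by simp
  have r: "r < R" "var s' ''r'' = int r" using 7 by auto
  have h: "holdsN (es s) r s'" using 7 by simp
  show ?case
  proof (rule wp_Seq, rule wp_conseq[OF wp_ROWLOAD[OF c _ r(2,1)]], goal_cases)
    case (2 s2)
    have c2: "ctx s2" by (rule ctx_frame[OF 2(1) c]) auto
    have h2: "holdsN (es s) r s2" by (rule holdsN_frame[OF 2(1) h]) auto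
    show ?case
    proof (rule wp_Seq, rule wp_conseq[OF wp_PIVOT[OF c2 h2 e r(1)]], goal_cases)
      case (2 s3)
      note p3 = this
      have c3: "ctx s3" by (rule ctx_frame[OF 2(1) c2]) auto
      have h3: "holdsN (es s) r s3" by (rule holdsN_frame[OF 2(1) h2]) auto
      define D where "D = pden n (srows (es s)) r"
      define Q where "Q = ip n (mv n (proj n (srows (es s)) r) (srows (es s) r)) (srows (es s) r)"
      have q: "real_of_int (var s3 ''q'') = D * Q" using 2 by (simp add: D_def Q_def)
      have D: "0 < D" unfolding D_def by (rule pden_pos)
      have Q: "0 \<le> Q" unfolding Q_def by (rule piv_nonneg)
      show ?case
      proof (rule wp_If)
        assume "bval (Less (N 0) (V ''q'')) s3"
        then have qpos: "0 < var s3 ''q''" by simp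
        then have "0 < real_of_int (var s3 ''q'')" by simp
        then have "Q \<noteq> 0" using q by auto
        then have D': "pden n (srows (es s)) (Suc r) = D * Q" by (simp add: D_def Q_def Let_def)
        show "wp b (Seq UPDATE (Assign ''d'' (V ''q''))) (\<lambda>s''. holdsN (es s) (Suc r) (setv ''r'' (1 + int r) s'')) s3"
          apply (rule wp_Seq, rule wp_conseq[OF wp_UPDATE[OF c3 h3 e r(1) _ _ qpos]])
          subgoal using p3(2) by blast
          subgoal using p3(2) by blast
          subgoal premises p for s4
            apply (rule wp_Assign)
            using p(2) frame_var[OF p(1)] q D' by (auto simp: holdsN_def simp del: pden.simps proj.simps)
          done
      next
        assume "\<not> bval (Less (N 0) (V ''q'')) s3"
        then have "\<not> 0 < real_of_int (var s3 ''q'')" by simp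
        then have "Q = 0" using q D Q by (metis less_eq_real_def mult_pos_pos)
        then have "pden n (srows (es s)) (Suc r) = D" "proj n (srows (es s)) (Suc r) = proj n (srows (es s)) r"
          by (simp_all add: D_def Q_def Let_def)
        then show "wp b Skip (\<lambda>s''. holdsN (es s) (Suc r) (setv ''r'' (1 + int r) s'')) s3"
          using h3 by (intro wp_Skip) (simp add: holdsN_def D_def del: pden.simps proj.simps)
      qed
    qed (use 2 es in auto)
  qed (use e es in auto)
qed (use s b_le ctx_frame[OF _ s] in \<open>auto simp: ctxD frameD holdsN_def\<close>)

end

section \<open>The rescaling algorithm\<close>

definition PINIT :: com where
  "PINIT =
     FOR ''i'' (N 0) (V ''n'')
       (Store ''u'' (V ''i'') (N 0);;
        Store ''z'' (V ''i'') (N 0))"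

text \<open>The array \<open>z\<close> holds \<open>P u\<close> multiplied by the positive
  denominator, so signs agree, and for integers being below 1 means not being positive. The index -1
  reports that none was found.\<close>

definition FINDNEG :: com where
  "FINDNEG =
     Assign ''ii'' (N (- 1));;
     FOR ''i'' (N 0) (V ''n'') (If (Less (Arr ''z'' (V ''i'')) (N 1)) (Assign ''ii'' (V ''i'')) Skip)"

definition BUMP :: com where
  "BUMP =
     Store ''u'' (V ''ii'') (Add (Arr ''u'' (V ''ii'')) (N 1));;
     FOR ''j'' (N 0) (V ''n'')
       (Store ''z'' (V ''j'') (Add (Arr ''z'' (V ''j'')) (Arr ''nn'' (Add (Arr ''rb'' (V ''ii'')) (V ''j'')))))"

definition PLOOP :: com where
  "PLOOP =
     While (Conj (Less (V ''tt'') (V ''t0'')) (Less (V ''done'') (N 1)))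
       (FINDNEG;;
        If (Less (V ''ii'') (N 0))
          (Assign ''done'' (N 1))
          (BUMP;;
           Assign ''tt'' (Add (V ''tt'') (N 1))))"

definition HALVE :: com where
  "HALVE =
     Assign ''jj'' (N 0);;
     FOR ''i'' (N 0) (V ''n'')
       (If (Less (Arr ''u'' (V ''jj'')) (Arr ''u'' (V ''i''))) (Assign ''jj'' (V ''i'')) Skip);;
     Store ''e'' (V ''jj'') (Sub (Arr ''e'' (V ''jj'')) (N 1))"

definition MAJOR :: com where
  "MAJOR =
     PROJECT;;
     PINIT;;
     Assign ''tt'' (N 0);;
     PLOOP;;
     If (Less (V ''done'') (N 1)) HALVE Skip"

text \<open>Repeated addition takes time proportional to the second factor. It is affordable for
  sizes and scores, and it is available before the table of powers exists.\<close>

definition SMUL :: "string \<Rightarrow> aexp \<Rightarrow> aexp \<Rightarrow> com" where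
  "SMUL r d e =
     Assign r (N 0);;
     FOR ''si'' (N 0) e (Assign r (Add (V r) d))"

definition SETUP :: com where
  "SETUP =
     SMUL ''K'' (V ''n'') (V ''R'');;
     SMUL ''L'' (Add (Add (V ''n'') (V ''K'')) (V ''K'')) (Add (V ''R'') (N 1));;
     Assign ''L'' (Add (V ''L'') (N 1));;
     Store ''pw'' (N 0) (N 1);;
     FOR ''i'' (N 0) (V ''L'')
       (Store ''pw'' (Add (V ''i'') (N 1)) (Add (Arr ''pw'' (V ''i'')) (Arr ''pw'' (V ''i''))));;
     Assign ''p'' (N 0);;
     FOR ''i'' (N 0) (Add (V ''n'') (V ''R''))
       (Store ''rb'' (V ''i'') (V ''p'');;
        Assign ''p'' (Add (V ''p'') (V ''n'')));;
     FOR ''i'' (N 0) (V ''n'') (Store ''e'' (V ''i'') (V ''K''));;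
     SMUL ''t1'' (V ''n'') (V ''n'');;
     SMUL ''t0'' (V ''t1'') (V ''n'');;
     Assign ''t0'' (Add (V ''t0'') (V ''t0''));;
     Assign ''t0'' (Add (V ''t0'') (V ''t0''));;
     Assign ''done'' (N 0)"

definition SOLVE :: com where
  "SOLVE =
     SETUP;;
     While (Less (V ''done'') (N 1)) MAJOR;;
     FOR ''c'' (N 0) (V ''n'')
       (MUL ''t'' (Arr ''z'' (V ''c'')) (Arr ''pw'' (Arr ''e'' (V ''c'')));;
        Store ''x'' (V ''c'') (V ''t''));;
     If (Less (Arr ''e'' (N 0)) (N 0)) (Assign ''feasible'' (N 0)) (Assign ''feasible'' (N 1))"

lemma wvars_PINIT [simp]: "wvars PINIT = {''i''}" and warrs_PINIT [simp]: "warrs PINIT = {''u'', ''z''}"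
  by (auto simp: PINIT_def)

lemma wvars_FINDNEG [simp]: "wvars FINDNEG = {''i'', ''ii''}" and warrs_FINDNEG [simp]: "warrs FINDNEG = {}"
  by (auto simp: FINDNEG_def)

lemma wvars_BUMP [simp]: "wvars BUMP = {''j''}" and warrs_BUMP [simp]: "warrs BUMP = {''u'', ''z''}"
  by (auto simp: BUMP_def)

lemma wvars_PLOOP [simp]: "wvars PLOOP = {''tt'', ''done'', ''i'', ''ii'', ''j''}"
  and warrs_PLOOP [simp]: "warrs PLOOP = {''u'', ''z''}"
  by (auto simp: PLOOP_def)

lemma wvars_HALVE [simp]: "wvars HALVE = {''jj'', ''i''}" and warrs_HALVE [simp]: "warrs HALVE = {''e''}"
  by (auto simp: HALVE_def)

lemma wvars_MAJOR [simp]: "wvars MAJOR = {''tt'', ''done'', ''ii'', ''jj'', ''q'', ''c'', ''d'', ''r'', ''i'', ''j'', ''y'', ''t'', ''da'', ''dd'', ''dg'', ''di'', ''dq'', ''ma'', ''mb'', ''mr'', ''mi''}"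
  and warrs_MAJOR [simp]: "warrs MAJOR = {''e'', ''u'', ''z'', ''nn'', ''dt'', ''a'', ''v''}"
  by (auto simp: MAJOR_def)

lemma wvars_SMUL [simp]: "wvars (SMUL r d e) = {r, ''si''}" and warrs_SMUL [simp]: "warrs (SMUL r d e) = {}"
  by (auto simp: SMUL_def)

lemma wvars_SETUP [simp]: "wvars SETUP = {''K'', ''L'', ''si'', ''i'', ''p'', ''t1'', ''t0'', ''done''}"
  and warrs_SETUP [simp]: "warrs SETUP = {''pw'', ''rb'', ''e''}"
  by (auto simp: SETUP_def)

lemma wvars_SOLVE [simp]: "wvars SOLVE = {''feasible'', ''K'', ''L'', ''si'', ''p'', ''t1'', ''t0'', ''tt'', ''done'', ''ii'', ''jj'', ''q'', ''c'', ''d'', ''r'', ''i'', ''j'', ''y'', ''t'', ''da'', ''dd'', ''dg'', ''di'', ''dq'', ''ma'', ''mb'', ''mr'', ''mi''}"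
  and warrs_SOLVE [simp]: "warrs SOLVE = {''pw'', ''rb'', ''x'', ''e'', ''u'', ''z'', ''nn'', ''dt'', ''a'', ''v''}"
  by (auto simp: SOLVE_def)

lemma wp_SMUL:
  assumes "r \<noteq> ''si''" "y \<le> b"
    and d: "\<And>s'. frame (SMUL r d e) s s' \<Longrightarrow> aval d s' = x"
    and e: "\<And>s'. frame (SMUL r d e) s s' \<Longrightarrow> aval e s' = int y"
    and Q: "\<And>s'. frame (SMUL r d e) s s' \<Longrightarrow> var s' r = x * int y \<Longrightarrow> Q s'"
  shows "wp b (SMUL r d e) Q s"
proof (rule wp_conseq)
  show "wp b (SMUL r d e) (\<lambda>s'. var s' r = x * int y) s"
    unfolding SMUL_def
  proof (intro wp_Seq wp_Assign, rule wp_FOR[where lo = 0 and hi = y and I = "\<lambda>i s'. var s' r = x * int i"], goal_cases)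
    case (5 s')
    then show ?case by (intro e) (auto simp: frame_def)
  next
    case (7 i s')
    have "aval d s' = x" using 7(1) by (intro d) (auto simp: frame_def)
    then show ?case using 7 assms(1) by (intro wp_Assign) (simp add: algebra_simps)
  qed (use assms in auto)
qed (rule Q)

section \<open>Correctness and iteration count of the rescaling loop\<close>

context lp_data
begin

abbreviation us :: "state \<Rightarrow> nat \<Rightarrow> real" where
  "us s i \<equiv> real_of_int (arr s ''u'' (int i))"

abbreviation PR :: "(nat \<Rightarrow> int) \<Rightarrow> nat \<Rightarrow> nat \<Rightarrow> real" where
  "PR e \<equiv> proj n (srows e) R"

text \<open>A deleted coordinate is incremented at most once, hence never has the largest counter at the end.\<close>

definition perc_inv :: "(nat \<Rightarrow> int) \<Rightarrow> state \<Rightarrow> bool" where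
  "perc_inv e s \<longleftrightarrow> (\<forall>i<n. 0 \<le> arr s ''u'' (int i)) \<and> (\<Sum>i<n. us s i) = of_int (var s ''tt'') \<and>
     (\<forall>i<n. real_of_int (arr s ''z'' (int i)) = pden n (srows e) R * mv n (PR e) (us s) i) \<and>
     ip n (us s) (mv n (PR e) (us s)) \<le> of_int (var s ''tt'') \<and>
     (\<forall>i<n. e i < 0 \<longrightarrow> arr s ''u'' (int i) \<le> 1) \<and>
     0 \<le> var s ''tt'' \<and> var s ''tt'' \<le> int (4 * n ^ 3) \<and> var s ''done'' \<in> {0, 1} \<and>
     (var s ''done'' = 1 \<longrightarrow> (\<forall>i<n. 0 < arr s ''z'' (int i)))"

text \<open>The scaled column of a deleted coordinate is 0, so its unit vector lies in the kernel
  and is fixed by the projection. The coordinate of \<open>P u\<close> then equals the counter and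
  is positive after one increment.\<close>

lemma inactive:
  assumes "e k < 0" "k < n"
  shows "mv n (PR e) u k = u k"
proof -
  have "mv n (PR e) (unit_vec_at k) i = unit_vec_at k i" if "i < n" for i
  proof (rule proj_fix[OF _ that])
    fix t assume "t < R"
    show "ip n (srows e t) (unit_vec_at k) = 0"
      using assms by (subst ip_commute) (simp add: ip_unit srows_int scale_def)
  qed
  then have P: "PR e i k = unit_vec_at k i" if "i < n" for i using that assms by (simp add: mv_unit)
  have "mv n (PR e) u k = ip n (unit_vec_at k) u"
    by (simp add: mv_def ip_def proj_sym[of n _ R k] P)
  then show ?thesis using assms by (simp add: ip_unit)
qed

lemma wp_PINIT:
  assumes "ctx s"
  shows "wp b PINIT (\<lambda>s'. \<forall>i<n. arr s' ''u'' (int i) = 0 \<and> arr s' ''z'' (int i) = 0) s"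
  unfolding PINIT_def
  by (rule wp_FOR[where lo = 0 and hi = n and I = "\<lambda>m s'. \<forall>i<m. arr s' ''u'' (int i) = 0 \<and> arr s' ''z'' (int i) = 0"])
    (use assms b_le in \<open>auto simp: ctxD frameD less_Suc_eq intro!: wp_intros\<close>)

lemma wp_FINDNEG:
  assumes "ctx s"
  shows "wp b FINDNEG (\<lambda>s'. (var s' ''ii'' = - 1 \<and> (\<forall>i<n. 0 < arr s ''z'' (int i))) \<or>
     (\<exists>k<n. var s' ''ii'' = int k \<and> arr s ''z'' (int k) \<le> 0)) s"
  unfolding FINDNEG_def
  by (intro wp_Seq wp_Assign, rule wp_FOR[where lo = 0 and hi = n and I = "\<lambda>m s'. (var s' ''ii'' = - 1 \<and> (\<forall>i<m. 0 < arr s ''z'' (int i))) \<or>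
     (\<exists>k<n. var s' ''ii'' = int k \<and> arr s ''z'' (int k) \<le> 0)"])
    (use assms b_le in \<open>auto simp: ctxD frameD less_Suc_eq intro!: wp_intros\<close>)

lemma wp_BUMP:
  assumes "ctx s" "var s ''ii'' = int k" "k < n"
  shows "wp b BUMP (\<lambda>s'. us s' = (us s)(k := us s k + 1) \<and> (\<forall>i. arr s' ''u'' (int i) = arr s ''u'' (int i) + (if i = k then 1 else 0)) \<and>
    (\<forall>j<n. arr s' ''z'' (int j) = arr s ''z'' (int j) + arr s ''nn'' (int k * int n + int j))) s"
proof -
  have rb: "arr s ''rb'' (int k) = int k * int n" using ctxD(5)[OF assms(1,3)] .
  show ?thesis unfolding BUMP_def
  proof (intro wp_Seq wp_Store, rule wp_FOR[where lo = 0 and hi = n and I = "\<lambda>m s'.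
     (\<forall>j<n. arr s' ''z'' (int j) = arr s ''z'' (int j) + (if j < m then arr s ''nn'' (int k * int n + int j) else 0))"], goal_cases)
    case (7 j s')
    note fr = frameD[OF 7(1), simplified]
    show ?case using 7 rb assms(2) by (intro wp_Store) (auto simp: fr less_Suc_eq)
  next
    case (8 s')
    then show ?case using assms(2) by (auto simp: frameD fun_eq_iff)
  qed (use assms b_le in \<open>auto simp: ctxD frameD\<close>)
qed

lemma wp_PLOOP:
  assumes s: "ctx s" "holdsN (es s) R s" "var s ''t0'' = int (4 * n ^ 3)" and inv: "perc_inv (es s) s"
  shows "wp b PLOOP (\<lambda>s'. perc_inv (es s) s' \<and> (var s' ''done'' = 1 \<or> var s' ''done'' = 0 \<and> var s' ''tt'' = int (4 * n ^ 3))) s"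
  unfolding PLOOP_def
\<comment> \<open>The additional unit of the measure pays for the last iteration, which only sets
  \<open>done\<close>.\<close>
proof (rule wp_While[where I = "perc_inv (es s)" and
     \<mu> = "\<lambda>s. nat (int (4 * n ^ 3) - var s ''tt'') + (if var s ''done'' < 1 then 1 else 0)"], goal_cases)
  case 1
  show ?case by (rule inv)
next
  case 2
  have "nat (int (4 * n ^ 3) - var s ''tt'') \<le> 4 * n ^ 3"
    using inv unfolding perc_inv_def by linarith
  then show ?case by (rule order_trans[OF add_mono b_ge(3)]) simp
next
  case (3 s')
  note fr = frameD[OF 3(1), simplified]
  define e where "e = es s"
  have c: "ctx s'" by (rule ctx_frame[OF 3(1) s(1)]) auto
  have h: "holdsN e R s'" unfolding e_def by (rule holdsN_frame[OF 3(1) s(2)]) auto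
  have inv': "perc_inv e s'" using 3 by (simp add: e_def)
  have less: "var s' ''tt'' < int (4 * n ^ 3)" "var s' ''done'' = 0"
    using 3 s(3) by (auto simp: fr perc_inv_def)
  show ?case unfolding e_def[symmetric]
  proof (rule wp_Seq, rule wp_conseq[OF wp_FINDNEG[OF c]], rule wp_If, goal_cases)
    case (1 s2)
    then have "\<forall>i<n. 0 < arr s' ''z'' (int i)" by auto
    then show ?case using inv' less 1(1) by (intro wp_Assign) (auto simp: perc_inv_def frameD)
  next
    case (2 s2)
    then obtain k where k: "k < n" "var s2 ''ii'' = int k" "arr s' ''z'' (int k) \<le> 0" by auto
    have c2: "ctx s2" by (rule ctx_frame[OF 2(1) c]) auto
    note fr2 = frameD[OF 2(1), simplified]
    show ?case
    proof (rule wp_Seq, rule wp_conseq[OF wp_BUMP[OF c2 k(2,1)]], rule wp_Assign, goal_cases)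
      case (1 s3)
      note fr3 = frameD[OF 1(1), simplified]
      define u where "u = us s'"
      define u' where "u' = u(k := u k + 1)"
      have u': "us s3 = u'" using conjunct1[OF 1(2)] by (simp only: u'_def u_def fr2)
      have u'_add: "u' = (\<lambda>j. u j + unit_vec_at k j)" by (auto simp: u'_def unit_vec_at_def)
      define D where "D = pden n (srows e) R"
      have D: "0 < D" unfolding D_def by (rule pden_pos)
      have z: "real_of_int (arr s' ''z'' (int i)) = D * mv n (PR e) u i" if "i < n" for i
        using inv' that by (simp add: perc_inv_def D_def u_def)
      have neg: "mv n (PR e) u k \<le> 0"
      proof -
        have "real_of_int (arr s' ''z'' (int k)) \<le> 0" using k by simp
        then show ?thesis using z[OF k(1)] D by (simp add: mult_le_0_iff)
      qed
      have z': "real_of_int (arr s3 ''z'' (int i)) = D * mv n (PR e) u' i" if "i < n" for i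
      proof -
        have "real_of_int (arr s3 ''z'' (int i)) = D * mv n (PR e) u i + D * PR e k i"
          using 1(2) that z[OF that] h k(1) by (simp add: fr2 holdsN_def D_def)
        then show ?thesis unfolding u'_add mv_add mv_unit[OF k(1)]
          by (simp add: algebra_simps proj_sym[of n _ R k])
      qed
      have quad: "ip n u' (mv n (PR e) u') \<le> of_int (var s' ''tt'') + 1"
        using quad_step[OF k(1) neg] inv' unfolding u'_def perc_inv_def u_def[symmetric] by simp
      have sum: "(\<Sum>i<n. u' i) = of_int (var s' ''tt'') + 1"
        using inv' k(1) unfolding u'_add perc_inv_def u_def[symmetric]
        by (simp add: sum.distrib unit_vec_at_def)
      have sum': "(\<Sum>i<n. us s3 i) = of_int (var s' ''tt'') + 1" using sum fun_cong[OF u'] by simp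
      have act: "arr s3 ''u'' (int i) \<le> 1" if "i < n" "e i < 0" for i
      proof (cases "i = k")
        case True
        have "u k \<le> 0" using inactive[of e k u] that True neg by simp
        then show ?thesis using 1(2) True by (simp add: u_def fr2)
      next
        case False
        then show ?thesis using 1(2) inv' that by (simp add: fr2 perc_inv_def)
      qed
      have ge: "0 \<le> arr s3 ''u'' (int i)" if "i < n" for i
        using 1(2) inv' that by (simp add: fr2 perc_inv_def)
      have "us (setv ''tt'' (aval (Add (V ''tt'') (N 1)) s3) s3) = u'" using u' by simp
      then show ?case using z' quad sum' act ge less inv' unfolding perc_inv_def D_def[symmetric]
        by (simp add: fr2 fr3)
    qed
  qed
next
  case (4 s')
  have "var s' ''t0'' = int (4 * n ^ 3)" using s(3) frame_var[OF 4(1), of "''t0''"] by simp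
  moreover have "var s' ''tt'' \<le> int (4 * n ^ 3)" "var s' ''done'' \<in> {0, 1}"
    using 4(2) unfolding perc_inv_def by blast+
  ultimately show ?case using 4(2,3) by auto
qed

lemma wp_HALVE:
  assumes "ctx s"
  shows "wp b HALVE (\<lambda>s'. \<exists>k<n. es s' = (es s)(k := es s k - 1) \<and> (\<forall>i<n. arr s ''u'' (int i) \<le> arr s ''u'' (int k))) s"
  unfolding HALVE_def
proof (intro wp_Seq wp_Assign, rule wp_FOR[where lo = 0 and hi = n and I = "\<lambda>m s'. \<exists>k<n. var s' ''jj'' = int k \<and>
     (\<forall>i<m. arr s ''u'' (int i) \<le> arr s ''u'' (int k))"], goal_cases)
  case (7 i s')
  note fr = frameD[OF 7(1), simplified]
  show ?case using 7(3-5) by (intro wp_intros) (fastforce simp: fr less_Suc_eq)+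
next
  case (8 s')
  note fr = frameD[OF 8(1), simplified]
  show ?case using 8(3) by (intro wp_Store) (auto simp: fr fun_eq_iff)
qed (use assms b_le n_pos in \<open>auto simp: ctxD frameD\<close>)

definition positive_kernel :: "state \<Rightarrow> bool" where
  "positive_kernel s \<longleftrightarrow> (\<forall>i<n. 0 < arr s ''z'' (int i)) \<and>
     (\<forall>r<R. (\<Sum>c<n. A r c * (scale (es s) c * arr s ''z'' (int c))) = 0)"

text \<open>Each summand is the number of decrements that the coordinate still admits; the last of
  them deletes it.\<close>

definition potential :: "state \<Rightarrow> nat" where
  "potential s = (\<Sum>c<n. nat (es s c + 1))"

lemma n_pow_R: "real n ^ R \<le> 2 ^ K"
proof -
  have "real n \<le> 2 ^ n" using less_exp[of n] by (simp add: of_nat_less_numeral_power_cancel_iff less_imp_le)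
  then have "real n ^ R \<le> (2 ^ n) ^ R" by (intro power_mono) auto
  then show ?thesis by (simp add: K_def power_mult)
qed

lemma wp_MAJOR:
  assumes s: "ctx s" "var s ''t0'' = int (4 * n ^ 3)" "var s ''done'' = 0"
    and e: "eok (es s)" "box_inv n R A K (es s)"
  shows "wp b MAJOR (\<lambda>s'. eok (es s') \<and> box_inv n R A K (es s') \<and>
    (var s' ''done'' = 1 \<and> potential s' \<le> potential s \<and> positive_kernel s' \<or> var s' ''done'' = 0 \<and> potential s' < potential s)) s"
  unfolding MAJOR_def
proof (rule wp_Seq, rule wp_conseq[OF wp_PROJECT[OF s(1) e(1)]], goal_cases)
  case (1 s1)
  note fr1 = frameD[OF 1(1), simplified]
  have c1: "ctx s1" by (rule ctx_frame[OF 1(1) s(1)]) auto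
  define e where "e = es s"
  have h1: "holdsN e R s1" using 1(2) by (simp add: e_def)
  show ?case
  proof (rule wp_Seq, rule wp_conseq[OF wp_PINIT[OF c1]], intro wp_Seq wp_Assign, goal_cases)
    case (1 s2)
    note fr2 = frameD[OF 1(1), simplified]
    define s3 where "s3 = setv ''tt'' (aval (N 0) s2) s2"
    have c2: "ctx s2" by (rule ctx_frame[OF 1(1) c1]) auto
    have c3: "ctx s3" using c2 by (simp add: s3_def)
    have h2: "holdsN e R s2" by (rule holdsN_frame[OF 1(1) h1]) auto
    have h3: "holdsN e R s3" using h2 by (simp add: s3_def holdsN_def)
    have e3: "es s3 = e" by (simp add: s3_def fr1 fr2 e_def)
    have "perc_inv e s3"
      using 1(2) s(3) by (simp add: perc_inv_def s3_def ip_def mv_def fr1 fr2)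
    then have inv3: "perc_inv (es s3) s3" by (simp add: e3)
    show ?case unfolding s3_def[symmetric]
    proof (rule wp_conseq[OF wp_PLOOP[OF c3 _ _ inv3]], unfold e3, rule h3, goal_cases)
      case 1
      then show ?case using s(2) by (simp add: s3_def fr1 fr2)
    next
      case (2 s4)
      note fr4 = frameD[OF 2(1), simplified]
      have c4: "ctx s4" by (rule ctx_frame[OF 2(1) c3]) auto
      have e4: "es s4 = e" by (simp add: fr4 e3)
      have inv: "perc_inv e s4" using 2 by simp
      show ?case
      proof (rule wp_If)
        assume "\<not> bval (Less (V ''done'') (N 1)) s4"
        then have d: "var s4 ''done'' = 1" using inv by (auto simp: perc_inv_def)
        define D where "D = pden n (srows e) R"
        have z: "real_of_int (arr s4 ''z'' (int i)) = D * mv n (PR e) (us s4) i" if "i < n" for i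
          using inv that by (simp add: perc_inv_def D_def)
        have "(\<Sum>c<n. A r c * (scale e c * arr s4 ''z'' (int c))) = 0" if "r < R" for r
        proof -
          have "real_of_int (\<Sum>c<n. A r c * (scale e c * arr s4 ''z'' (int c)))
              = D * ip n (srows e r) (mv n (PR e) (us s4))"
            by (simp add: ip_def sum_distrib_left srows_int z algebra_simps)
          also have "\<dots> = 0" using proj_mv_in_kernel[OF that, of n "srows e"] by simp
          finally show ?thesis by linarith
        qed
        then have "positive_kernel s4" using inv d by (simp add: positive_kernel_def e4 perc_inv_def)
        moreover have "potential s4 = potential s" using fun_cong[OF e4] by (simp add: potential_def e_def)
        ultimately show "wp b Skip (\<lambda>s'. eok (es s') \<and> box_inv n R A K (es s') \<and>
          (var s' ''done'' = 1 \<and> potential s' \<le> potential s \<and> positive_kernel s' \<or> var s' ''done'' = 0 \<and> potential s' < potential s)) s4"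
          using assms d by (intro wp_Skip) (simp add: e4 e_def)
      next
        assume "bval (Less (V ''done'') (N 1)) s4"
        then have d: "var s4 ''done'' = 0" "var s4 ''tt'' = int (4 * n ^ 3)" using 2 by auto
        show "wp b HALVE (\<lambda>s'. eok (es s') \<and> box_inv n R A K (es s') \<and>
          (var s' ''done'' = 1 \<and> potential s' \<le> potential s \<and> positive_kernel s' \<or> var s' ''done'' = 0 \<and> potential s' < potential s)) s4"
        proof (rule wp_conseq[OF wp_HALVE[OF c4]], goal_cases)
          case (1 s5)
          from 1(2) obtain k where k0: "k < n" "es s5 = (es s4)(k := es s4 k - 1)"
            "\<forall>i<n. arr s4 ''u'' (int i) \<le> arr s4 ''u'' (int k)" by blast
          have "es s5 = e(k := e k - 1)" using k0(2) fun_cong[OF e4, of k] e4 by simp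
          note k = k0(1) this k0(3)
          have "(\<Sum>i<n. us s4 i) \<le> (\<Sum>i<n. us s4 k)" using k(3) by (intro sum_mono) auto
          then have big: "4 * real n ^ 3 \<le> real n * us s4 k"
            using inv d(2) by (simp add: perc_inv_def)
          \<comment> \<open>The largest counter is at least the average \<open>4 * n ^ 2\<close> and
            thus above 1, whereas counters of deleted coordinates stay at most 1. So the exponent of
            \<open>k\<close> can still be decremented.\<close>
          have "4 * real n ^ 3 = real n * (4 * real n ^ 2)" by (simp add: power2_eq_square power3_eq_cube)
          then have "4 * real n ^ 2 \<le> us s4 k" using big n_pos by simp
          moreover have "1 \<le> real n ^ 2" using n_pos by simp
          ultimately have "1 < us s4 k" by linarith
          then have ek: "0 \<le> e k" using inv k(1) by (fastforce simp: perc_inv_def)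
          have "box_inv n R A K (e(k := e k - 1))"
          proof (rule box_inv_halve[where u = "us s4" and t = "4 * real n ^ 3", OF A_le n_pow_R])
            show "box_inv n R A K e" using assms by (simp add: e_def)
            show "ip n (us s4) (mv n (proj n (srow A (\<lambda>c. real_of_int (scale e c))) R) (us s4)) \<le> 4 * real n ^ 3"
              using inv d(2) by (simp add: perc_inv_def srows_def)
          qed (use inv k(1) big ek in \<open>auto simp: perc_inv_def\<close>)
          moreover have "eok (e(k := e k - 1))" using assms(4) ek by (auto simp: eok_def e_def)
          moreover have "potential s5 < potential s" unfolding potential_def
          proof (rule sum_strict_mono_ex1)
            show "\<forall>c\<in>{..<n}. nat (es s5 c + 1) \<le> nat (es s c + 1)"
              using fun_cong[OF k(2)] by (auto simp: e_def intro!: nat_mono)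
            show "\<exists>c\<in>{..<n}. nat (es s5 c + 1) < nat (es s c + 1)"
              using k(1) ek fun_cong[OF k(2)] by (intro bexI[of _ k]) (auto simp: e_def)
          qed simp
          ultimately show ?case using d(1) frame_var[OF 1(1), of "''done''"] k(2) by simp
        qed
      qed
    qed
  qed
qed

lemma wp_SETUP:
  assumes s: "var s ''n'' = int n" "var s ''R'' = int R" "arr s ''pw'' (- 1) = 0"
    "\<And>r c. r < R \<Longrightarrow> c < n \<Longrightarrow> arr s ''A'' (int r * int n + int c) = A r c"
  shows "wp b SETUP (\<lambda>s'. ctx s' \<and> (\<forall>c<n. es s' c = int K) \<and> var s' ''t0'' = int (4 * n ^ 3) \<and> var s' ''done'' = 0) s"
  unfolding SETUP_def
proof (rule wp_Seq, rule wp_SMUL[where x = "int n" and y = R], goal_cases)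
  case (5 s1)
  note fr1 = frameD[OF 5(1), simplified]
  have K1: "var s1 ''K'' = int K" using 5(2) by (simp add: K_def)
  show ?case
  proof (rule wp_Seq, rule wp_SMUL[where x = "int (n + K + K)" and y = "R + 1"], goal_cases)
    case (5 s2)
    note fr2 = frameD[OF 5(1), simplified]
    have L2: "var s2 ''L'' + 1 = int l" using 5(2) by (simp add: l_def algebra_simps)
    have pwf: "wp b (FOR ''i'' (N 0) (V ''L'') (Store ''pw'' (Add (V ''i'') (N 1)) (Add (Arr ''pw'' (V ''i'')) (Arr ''pw'' (V ''i'')))))
       (\<lambda>s'. pow_table s' l) s3" if "var s3 ''L'' = int l" "arr s3 ''pw'' 0 = 1" "arr s3 ''pw'' (- 1) = 0" for s3
      by (rule wp_FOR[where lo = 0 and hi = l and I = "\<lambda>m s'. (\<forall>i\<le>m. arr s' ''pw'' (int i) = 2 ^ i) \<and> arr s' ''pw'' (- 1) = 0"])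
        (use that b_le in \<open>auto simp: frameD le_Suc_eq pow_table_def add.commute intro!: wp_intros\<close>)
    show ?case
    proof (intro wp_Seq wp_Assign wp_Store, rule wp_conseq[OF pwf], goal_cases)
      case (4 s4)
      note fr4 = frameD[OF 4(1), simplified]
      have n4: "var s4 ''n'' = int n" "var s4 ''R'' = int R" "var s4 ''K'' = int K"
        using s K1 by (simp_all add: fr1 fr2 fr4)
      have A4: "arr s4 ''A'' = arr s ''A''" by (simp add: fr1 fr2 fr4)
      show ?case
      proof (intro wp_Seq wp_Assign, rule wp_FOR[where lo = 0 and hi = "n + R" and I = "\<lambda>m s'.
           var s' ''p'' = int m * int n \<and> (\<forall>i<m. arr s' ''rb'' (int i) = int i * int n)"], goal_cases)
        case (7 i s')
        show ?case using 7 n4 by (intro wp_intros) (auto simp: less_Suc_eq frame_var[OF 7(1)] algebra_simps)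
      next
        case (8 s5)
        note fr5 = frameD[OF 8(1), simplified]
        show ?case
        proof (intro wp_Seq wp_Assign, rule wp_FOR[where lo = 0 and hi = n and I = "\<lambda>m s'. \<forall>i<m. es s' i = int K"], goal_cases)
          case (7 i s')
          then show ?case using n4 by (intro wp_intros) (auto simp: less_Suc_eq frame_var[OF 7(1)] fr5)
        next
          case (8 s6)
          note fr6 = frameD[OF 8(1), simplified]
          show ?case
          proof (rule wp_Seq, rule wp_SMUL[where x = "int n" and y = n], goal_cases)
            case (5 s7)
            note fr7 = frameD[OF 5(1), simplified]
            show ?case
            proof (rule wp_Seq, rule wp_SMUL[where x = "int n * int n" and y = n], goal_cases)
              case (5 s8)
              note fr8 = frameD[OF 5(1), simplified]
              have "pow_table s8 l" using 4(2) by (simp add: pow_table_def fr8 fr7 fr6 fr5)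
              then have "ctx s8" using n4 A4 s(4) \<open>_ \<and> (\<forall>i<n + R. arr s5 ''rb'' (int i) = int i * int n)\<close>
                by (simp add: ctx_def fr8 fr7 fr6 fr5)
              then show ?case using 5(2) 8(3)
                by (intro wp_Seq wp_Assign) (simp add: fr8 fr7 power3_eq_cube)
            qed (use n4 b_le \<open>var s7 ''t1'' = _\<close> in \<open>auto simp: frameD fr5 fr6 fr7\<close>)
          qed (use n4 b_le in \<open>auto simp: frameD fr5 fr6\<close>)
        qed (use n4 b_le in \<open>auto simp: frameD fr5\<close>)
      qed (use n4 b_ge in \<open>auto simp: frameD\<close>)
    qed (use L2 s in \<open>auto simp: fr1 fr2\<close>)
  qed (use s K1 b_ge n_pos in \<open>auto simp: frameD fr1\<close>)
qed (use s b_le in \<open>auto simp: frameD\<close>)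

text \<open>The loop ends with a positive \<open>z\<close> in either case, since the potential
  cannot fall forever. Multiplying by the scales turns \<open>z\<close> into a solution of the
  original system; it is the wanted one unless the homogenizing coordinate has been deleted, and
  then no solution exists.\<close>

lemma wp_SOLVE:
  assumes s: "var s ''n'' = int n" "var s ''R'' = int R" "arr s ''pw'' (- 1) = 0"
    "\<And>r c. r < R \<Longrightarrow> c < n \<Longrightarrow> arr s ''A'' (int r * int n + int c) = A r c"
  shows "wp b SOLVE (\<lambda>s'. 
     var s' ''feasible'' = 1 \<and> (\<forall>c<n. 0 \<le> arr s' ''x'' (int c)) \<and> 0 < arr s' ''x'' 0 \<and>
       (\<forall>r<R. (\<Sum>c<n. A r c * arr s' ''x'' (int c)) = 0) \<or>
     var s' ''feasible'' = 0 \<and> \<not> (\<exists>x. kern n R A x \<and> (\<forall>i<n. 0 \<le> x i) \<and> 0 < x 0)) s"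
  unfolding SOLVE_def
proof (rule wp_Seq, rule wp_conseq[OF wp_SETUP[OF s(1-3)]], goal_cases)
  case (2 s1)
  have c1: "ctx s1" "var s1 ''t0'' = int (4 * n ^ 3)" "var s1 ''done'' = 0" and e1: "\<forall>c<n. es s1 c = int K"
    using 2 by auto
  define I where "I s' \<longleftrightarrow> eok (es s') \<and> box_inv n R A K (es s') \<and> var s' ''done'' \<in> {0, 1} \<and>
     (var s' ''done'' = 1 \<longrightarrow> positive_kernel s') \<and> potential s' \<le> n * (K + 1)" for s'
  have loop: "wp b (While (Less (V ''done'') (N 1)) MAJOR) (\<lambda>s'. I s' \<and> var s' ''done'' = 1 \<and> ctx s') s1"
  proof (rule wp_While[where I = I and \<mu> = "\<lambda>s. potential s + (if var s ''done'' = 0 then 1 else 0)"], goal_cases)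
    case 1
    have "nat (1 + int K) = Suc K" by simp
    then show ?case using e1 c1 box_inv_start[of n "es s1" K R A]
      by (auto simp: I_def eok_def potential_def add.commute)
  next
    case 2
    have "nat (1 + int K) = Suc K" by simp
    then have "potential s1 = n * (K + 1)" using e1 by (simp add: potential_def add.commute)
    then show ?case using b_ge by simp
  next
    case (3 s')
    have c: "ctx s'" by (rule ctx_frame[OF 3(1) c1(1)]) auto
    have d: "var s' ''done'' = 0" "var s' ''t0'' = int (4 * n ^ 3)" 
      using 3 c1(2) frame_var[OF 3(1)] by (auto simp: I_def)
    show ?case
      by (rule wp_conseq[OF wp_MAJOR[OF c d(2,1)]]) (use 3(2) d in \<open>auto simp: I_def\<close>)
  next
    case (4 s')
    have "ctx s'" by (rule ctx_frame[OF 4(1) c1(1)]) auto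
    then show ?case using 4 by (auto simp: I_def)
  qed
  show ?case
  proof (rule wp_Seq, rule wp_conseq[OF loop], goal_cases)
    case (1 s2)
    then have c2: "ctx s2" and I2: "I s2" and d2: "var s2 ''done'' = 1" by auto
    have e2: "eok (es s2)" and box: "box_inv n R A K (es s2)" and g: "positive_kernel s2" using I2 d2 by (auto simp: I_def)
    have small: "\<bar>scale (es s2) c\<bar> < 2 ^ l" if "c < n" for c
      using scale_bounds[OF e2 that] K_less_l power_strict_increasing[of K l "2::int"] by linarith
    show ?case
    proof (rule wp_Seq, rule wp_FOR[where lo = 0 and hi = n and I = "\<lambda>m s'.
        \<forall>c<m. arr s' ''x'' (int c) = arr s2 ''z'' (int c) * scale (es s2) c"], goal_cases)
      case (7 i s')
      note fr = frameD[OF 7(1), simplified]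
      have c: "ctx s'" by (rule ctx_frame[OF 7(1) c2]) auto
      show ?case
        apply (intro wp_Seq)
        apply (rule wp_MUL[where l = l and x = "arr s2 ''z'' (int i)" and y = "scale (es s2) i"])
             apply (use 7 c b_le small pw_scale[OF ctxD(3)[OF c] e2, of i] in \<open>simp_all add: ctxD fr\<close>)[5]
        apply (rule wp_Store)
        apply (use 7 in \<open>auto simp: frameD less_Suc_eq\<close>)
        done
    next
      case (8 s3)
      note fr = frameD[OF 8(1), simplified]
      have x: "\<forall>c<n. arr s3 ''x'' (int c) = arr s2 ''z'' (int c) * scale (es s2) c" using 8 by simp
      have ker: "(\<Sum>c<n. A r c * arr s3 ''x'' (int c)) = 0" if "r < R" for r
      proof -
        have "(\<Sum>c<n. A r c * arr s3 ''x'' (int c)) = (\<Sum>c<n. A r c * (scale (es s2) c * arr s2 ''z'' (int c)))"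
          using x by (intro sum.cong) auto
        then show ?thesis using g that by (simp add: positive_kernel_def)
      qed
      have ge: "0 \<le> arr s3 ''x'' (int c)" if "c < n" for c
      proof -
        have "0 < arr s2 ''z'' (int c)" using g that by (simp add: positive_kernel_def)
        then show ?thesis using x scale_bounds[OF e2 that] that by simp
      qed
      have e0: "arr s3 ''e'' 0 = es s2 0" by (simp add: fr)
      show ?case
      proof (intro wp_If wp_Assign, goal_cases)
        case 1
        then have "es s2 0 < 0" using e0 by simp
        from box_inv_infeasible[OF box this n_pos] show ?case by simp
      next
        case 2
        then have "0 < scale (es s2) 0" using e0 by (simp add: scale_def)
        moreover have "0 < arr s2 ''z'' (int 0)" using g n_pos unfolding positive_kernel_def by blast
        ultimately have "0 < arr s3 ''x'' 0" using x n_pos by fastforce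
        then show ?case using ker ge by simp
      qed
    qed (use c2 b_le in \<open>auto simp: ctxD frameD\<close>)
  qed
qed (use s in auto)

end

section \<open>Setting up the flow problem\<close>

definition EQ :: "aexp \<Rightarrow> aexp \<Rightarrow> bexp" where
  "EQ d e = Conj (Neg (Less d e)) (Neg (Less e d))"

lemma bval_EQ [simp]: "bval (EQ d e) s \<longleftrightarrow> aval d s = aval e s"
  by (auto simp: EQ_def)

text \<open>Scores are sorted, so the last one times the total weight bounds every collected score;
  the final increment makes \<open>S\<close> an exclusive bound.\<close>

definition SIZES :: com where
  "SIZES =
     Assign ''W'' (N 0);;
     FOR ''l'' (N 1) (Add (V ''k'') (N 1)) (Assign ''W'' (Add (V ''W'') (Arr ''w'' (V ''l''))));;
     SMUL ''S'' (V ''W'') (Arr ''alpha'' (Sub (V ''m'') (N 1)));;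
     Assign ''S'' (Add (V ''S'') (N 1))"

text \<open>A column is an arc: manipulator \<open>''cl''\<close> gives candidate \<open>''ci''\<close> the score number \<open>''cj''\<close>, which
  changes its collected score from \<open>''cs''\<close> to \<open>''ct''\<close>. Column \<open>0\<close> is the homogenizing variable; since its
  attributes are \<open>0\<close>, it also plays the role of the arc that enters the source of every candidate.\<close>

definition COLUMN :: com where
  "COLUMN =
     SMUL ''t'' (Arr ''w'' (V ''l'')) (Arr ''alpha'' (V ''j''));;
     Assign ''t'' (Add (V ''t'') (V ''s''));;
     If (Conj (Neg (Less (Sub (V ''T'') (Arr ''sigma'' (V ''i''))) (V ''t''))) (Less (V ''t'') (V ''S'')))
       (Store ''ci'' (V ''n'') (V ''i'');;
        Store ''cl'' (V ''n'') (V ''l'');;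
        Store ''cs'' (V ''n'') (V ''s'');;
        Store ''cj'' (V ''n'') (V ''j'');;
        Store ''ct'' (V ''n'') (V ''t'');;
        Assign ''n'' (Add (V ''n'') (N 1)))
       Skip"

definition COLUMNS :: com where
  "COLUMNS =
     Assign ''n'' (N 1);;
     FOR ''i'' (N 1) (Add (V ''m'') (N 1))
       (FOR ''l'' (N 1) (Add (V ''k'') (N 1)) (FOR ''s'' (N 0) (V ''S'') (FOR ''j'' (N 0) (V ''m'') COLUMN)))"

definition ROW :: "com \<Rightarrow> com" where
  "ROW B =
     FOR ''c'' (N 0) (V ''n'')
       (B;;
        Store ''A'' (Add (V ''p'') (V ''c'')) (V ''val''));;
     Assign ''p'' (Add (V ''p'') (V ''n''));;
     Assign ''R'' (Add (V ''R'') (N 1))"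

definition COVER :: com where
  "COVER =
     If (Less (V ''c'') (N 1))
       (Assign ''val'' (N (- 1)))
       (If (Conj (EQ (Arr ''cl'' (V ''c'')) (V ''l'')) (EQ (Arr ''cj'' (V ''c'')) (V ''j'')))
          (Assign ''val'' (N 1))
          (Assign ''val'' (N 0)))"

text \<open>Inflow minus outflow at the node that candidate \<open>i\<close> reaches with score
  \<open>s\<close> after \<open>l\<close> manipulators. The negated conjunction expresses a
  disjunction: the incoming arc is column 0 or belongs to candidate \<open>i\<close>.\<close>

definition FLOW :: com where
  "FLOW =
     If (Conj (Conj (EQ (Arr ''cl'' (V ''c'')) (V ''l'')) (EQ (Arr ''ct'' (V ''c'')) (V ''s''))) (Neg (Conj (Neg (EQ (V ''c'') (N 0))) (Neg (EQ (Arr ''ci'' (V ''c'')) (V ''i''))))))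
       (Assign ''val'' (N 1))
       (If (Conj (Conj (EQ (Arr ''cl'' (V ''c'')) (Add (V ''l'') (N 1))) (EQ (Arr ''cs'' (V ''c'')) (V ''s''))) (EQ (Arr ''ci'' (V ''c'')) (V ''i'')))
          (Assign ''val'' (N (- 1)))
          (Assign ''val'' (N 0)))"

definition ROWS :: com where
  "ROWS =
     Assign ''R'' (N 0);;
     Assign ''p'' (N 0);;
     FOR ''l'' (N 1) (Add (V ''k'') (N 1)) (FOR ''j'' (N 0) (V ''m'') (ROW COVER));;
     FOR ''i'' (N 1) (Add (V ''m'') (N 1)) (FOR ''l'' (N 0) (V ''k'') (FOR ''s'' (N 0) (V ''S'') (ROW FLOW)))"

definition BUILD :: com where
  "BUILD =
     SIZES;;
     COLUMNS;;
     ROWS"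

lemma wvars_SIZES [simp]: "wvars SIZES = {''W'', ''l'', ''S'', ''si''}" and warrs_SIZES [simp]: "warrs SIZES = {}"
  by (auto simp: SIZES_def)

lemma wvars_COLUMN [simp]: "wvars COLUMN = {''t'', ''si'', ''n''}"
  and warrs_COLUMN [simp]: "warrs COLUMN = {''ci'', ''cl'', ''cs'', ''cj'', ''ct''}"
  by (auto simp: COLUMN_def)

lemma wvars_COLUMNS [simp]: "wvars COLUMNS = {''i'', ''l'', ''s'', ''j'', ''t'', ''si'', ''n''}"
  and warrs_COLUMNS [simp]: "warrs COLUMNS = {''ci'', ''cl'', ''cs'', ''cj'', ''ct''}"
  by (auto simp: COLUMNS_def)

lemma wvars_ROW [simp]: "wvars (ROW B) = wvars B \<union> {''c'', ''p'', ''R''}"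
  and warrs_ROW [simp]: "warrs (ROW B) = insert ''A'' (warrs B)"
  by (auto simp: ROW_def)

lemma wvars_COVER [simp]: "wvars COVER = {''val''}" and warrs_COVER [simp]: "warrs COVER = {}"
  by (auto simp: COVER_def)

lemma wvars_FLOW [simp]: "wvars FLOW = {''val''}" and warrs_FLOW [simp]: "warrs FLOW = {}"
  by (auto simp: FLOW_def)

lemma wvars_ROWS [simp]: "wvars ROWS = {''i'', ''l'', ''s'', ''j'', ''val'', ''c'', ''p'', ''R''}"
  and warrs_ROWS [simp]: "warrs ROWS = {''A''}"
  by (auto simp: ROWS_def)

lemma wvars_BUILD [simp]: "wvars BUILD = {''W'', ''S'', ''si'', ''n'', ''t'', ''i'', ''l'', ''s'', ''j'', ''val'', ''c'', ''p'', ''R''}"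
  and warrs_BUILD [simp]: "warrs BUILD = {''A'', ''ci'', ''cl'', ''cs'', ''cj'', ''ct''}"
  by (auto simp: BUILD_def)

section \<open>Enumeration of the arcs\<close>

locale wcm_lp =
  fixes I :: wcm and T :: int and b :: nat and m k S :: nat
  assumes inst: "wcm_instance I"
    and m_def: "m = cands I" and k_def: "k = manips I"
    and S_def: "S = total_weight I * score I (m - 1) + 1"
    and m_pos: "0 < m" and k_pos: "0 < k"
    and b_bound: "m \<le> b" "k \<le> b" "S \<le> b" "1 + m * k * S * m \<le> b"
begin

abbreviation "w \<equiv> weight I"
abbreviation "\<alpha> \<equiv> score I"
abbreviation "\<sigma> \<equiv> init_score I"

text \<open>The bound on the score of a candidate is imposed on every arc. Along a path the
  collected score never decreases, so this excludes no admissible configuration, and the end of a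
  path needs no separate test.\<close>

definition allowed :: "(nat \<times> nat \<times> nat \<times> nat) set" where
  "allowed = {(i, l, s, j). 1 \<le> i \<and> i \<le> m \<and> 1 \<le> l \<and> l \<le> k \<and> s < S \<and> j < m \<and>
     s + w l * \<alpha> j < S \<and> int (s + w l * \<alpha> j) \<le> T - \<sigma> i}"

definition allowed_below :: "nat \<Rightarrow> nat \<Rightarrow> nat \<Rightarrow> nat \<Rightarrow> (nat \<times> nat \<times> nat \<times> nat) set" where
  "allowed_below i l s j = {(i', l', s', j') \<in> allowed. i' < i \<or> i' = i \<and> (l' < l \<or> l' = l \<and> (s' < s \<or> s' = s \<and> j' < j))}"

text \<open>The four nested loops run in lexicographic order. Apart from the first equation, which
  adds one arc, these identities pass from an exhausted inner loop to the next value of the outer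
  index, and from the empty set to all arcs.\<close>

lemma allowed_below_simps:
  "allowed_below i l s (Suc j) = (if (i, l, s, j) \<in> allowed then insert (i, l, s, j) (allowed_below i l s j) else allowed_below i l s j)"
  "allowed_below i l s m = allowed_below i l (Suc s) 0"
  "allowed_below i l S 0 = allowed_below i (Suc l) 0 0"
  "allowed_below i (Suc k) 0 0 = allowed_below (Suc i) (Suc 0) 0 0"
  "allowed_below (Suc 0) (Suc 0) 0 0 = {}"
  "allowed_below (Suc m) (Suc 0) 0 0 = allowed"
  by (auto simp: allowed_below_def allowed_def less_Suc_eq)

lemma card_allowed: "finite allowed" "card allowed \<le> m * k * S * m"
proof -
  have sub: "allowed \<subseteq> {1..m} \<times> {1..k} \<times> {..<S} \<times> {..<m}" by (auto simp: allowed_def)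
  show "finite allowed" by (rule finite_subset[OF sub]) auto
  have "card allowed \<le> card ({1..m} \<times> {1..k} \<times> {..<S} \<times> {..<m})" by (rule card_mono[OF _ sub]) auto
  then show "card allowed \<le> m * k * S * m" by (simp add: card_cartesian_product mult.assoc)
qed

definition inp :: "state \<Rightarrow> bool" where
  "inp s \<longleftrightarrow> var s ''m'' = int m \<and> var s ''k'' = int k \<and> var s ''T'' = T \<and>
     (\<forall>j<m. arr s ''alpha'' (int j) = int (\<alpha> j)) \<and>
     (\<forall>i. 1 \<le> i \<longrightarrow> i \<le> m \<longrightarrow> arr s ''sigma'' (int i) = \<sigma> i) \<and>
     (\<forall>l. 1 \<le> l \<longrightarrow> l \<le> k \<longrightarrow> arr s ''w'' (int l) = int (w l))"

lemma inpD:
  assumes "inp s"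
  shows "var s ''m'' = int m" "var s ''k'' = int k" "var s ''T'' = T"
    "\<And>j. j < m \<Longrightarrow> arr s ''alpha'' (int j) = int (\<alpha> j)"
    "\<And>i. 1 \<le> i \<Longrightarrow> i \<le> m \<Longrightarrow> arr s ''sigma'' (int i) = \<sigma> i"
    "\<And>l. 1 \<le> l \<Longrightarrow> l \<le> k \<Longrightarrow> arr s ''w'' (int l) = int (w l)"
  using assms by (auto simp: inp_def)

lemma inp_frame:
  assumes "frame c s s'" "inp s" "wvars c \<inter> {''m'', ''k'', ''T''} = {}" "warrs c \<inter> {''alpha'', ''sigma'', ''w''} = {}"
  shows "inp s'"
  using assms by (auto simp: inp_def frame_def disjoint_iff)

lemma inp_setv [simp]: "x \<notin> {''m'', ''k'', ''T''} \<Longrightarrow> inp (setv x v s) \<longleftrightarrow> inp s"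
  by (auto simp: inp_def)

lemma score_le_last: "j < m \<Longrightarrow> \<alpha> j \<le> \<alpha> (m - 1)"
  using inst m_pos by (auto simp: wcm_instance_def m_def intro: mono_onD)

lemma total_weight_pos: "1 \<le> total_weight I"
proof -
  have "1 \<le> w 1" using inst k_pos by (auto simp: wcm_instance_def k_def Suc_le_eq)
  also have "w 1 \<le> total_weight I"
    unfolding total_weight_def by (rule member_le_sum) (use k_pos in \<open>auto simp: k_def\<close>)
  finally show ?thesis .
qed

lemma score_le_b: "j < m \<Longrightarrow> \<alpha> j \<le> b"
proof -
  assume "j < m"
  then have "\<alpha> j \<le> 1 * \<alpha> (m - 1)" using score_le_last by simp
  also have "\<dots> \<le> total_weight I * \<alpha> (m - 1)" using total_weight_pos by (intro mult_right_mono) auto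
  also have "\<dots> \<le> b" using b_bound(3) by (simp add: S_def)
  finally show ?thesis .
qed

lemma wp_SIZES:
  assumes s: "inp s"
  shows "wp b SIZES (\<lambda>s'. var s' ''S'' = int S) s"
  unfolding SIZES_def
proof (intro wp_Seq wp_Assign, rule wp_FOR[where lo = 1 and hi = "Suc k" and
    I = "\<lambda>i s'. var s' ''W'' = int (\<Sum>l=1..<i. w l)"], goal_cases)
  case (7 i s')
  have "inp s'" by (rule inp_frame[OF 7(1)]) (use s in auto)
  then show ?case using 7 by (intro wp_Assign) (simp add: inpD sum.atLeastLessThan_Suc)
next
  case (8 s')
  have i: "inp s'" by (rule inp_frame[OF 8(1)]) (use s in auto)
  have W: "var s' ''W'' = int (total_weight I)" 
    using 8 by (simp add: total_weight_def k_def atLeastLessThanSuc_atLeastAtMost)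
  have a: "arr s' ''alpha'' (int m - 1) = int (\<alpha> (m - 1))"
    using inpD(4)[OF i, of "m - 1"] m_pos by (simp add: of_nat_diff)
  show ?case
  proof (rule wp_Seq, rule wp_SMUL[where x = "int (total_weight I)" and y = "\<alpha> (m - 1)"], goal_cases)
    case (5 s2)
    then show ?case by (intro wp_Assign) (simp add: S_def)
  qed (use m_pos W i a score_le_b[of "m - 1"] in \<open>auto simp: frameD inpD\<close>)
qed (use s b_bound in \<open>auto simp: frameD inpD\<close>)

definition attr :: "state \<Rightarrow> nat \<Rightarrow> nat \<times> nat \<times> nat \<times> nat" where
  "attr s c = (nat (arr s ''ci'' (int c)), nat (arr s ''cl'' (int c)), nat (arr s ''cs'' (int c)), nat (arr s ''cj'' (int c)))"

text \<open>The number of arcs is known only when the program runs, and their order is immaterial,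
  hence an injective enumeration of a set with an existentially quantified length.\<close>

definition columns_are :: "(nat \<times> nat \<times> nat \<times> nat) set \<Rightarrow> state \<Rightarrow> bool" where
  "columns_are X s \<longleftrightarrow> (\<exists>n. var s ''n'' = int n \<and> 1 \<le> n \<and> inj_on (attr s) {1..<n} \<and> attr s ` {1..<n} = X \<and>
     (\<forall>c. 0 \<le> arr s ''ci'' (int c) \<and> 0 \<le> arr s ''cl'' (int c) \<and> 0 \<le> arr s ''cs'' (int c) \<and> 0 \<le> arr s ''cj'' (int c)) \<and>
     (\<forall>c. 1 \<le> c \<longrightarrow> c < n \<longrightarrow> arr s ''ct'' (int c) = arr s ''cs'' (int c) +
        int (w (nat (arr s ''cl'' (int c))) * \<alpha> (nat (arr s ''cj'' (int c))))) \<and>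
     arr s ''ci'' 0 = 0 \<and> arr s ''cl'' 0 = 0 \<and> arr s ''cs'' 0 = 0 \<and> arr s ''cj'' 0 = 0 \<and> arr s ''ct'' 0 = 0)"

lemma columns_are_cong:
  assumes "var s' ''n'' = var s ''n''" "\<And>a. a \<in> {''ci'', ''cl'', ''cs'', ''cj'', ''ct''} \<Longrightarrow> arr s' a = arr s a"
  shows "columns_are X s' \<longleftrightarrow> columns_are X s"
  using assms by (simp add: columns_are_def attr_def[abs_def])

lemma columns_are_setv [simp]: "x \<noteq> ''n'' \<Longrightarrow> columns_are X (setv x v s) \<longleftrightarrow> columns_are X s"
  by (rule columns_are_cong) auto

lemma columns_are_frame:
  assumes "frame c s s'" "''n'' \<notin> wvars c" "warrs c \<inter> {''ci'', ''cl'', ''cs'', ''cj'', ''ct''} = {}"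
  shows "columns_are X s' \<longleftrightarrow> columns_are X s"
  by (rule columns_are_cong) (use assms in \<open>auto simp: frame_def disjoint_iff\<close>)

lemma wp_COLUMN:
  assumes s: "inp s" "var s ''S'' = int S" "columns_are X s"
    and v: "var s ''i'' = int i" "var s ''l'' = int l" "var s ''s'' = int s0" "var s ''j'' = int j"
    and r: "1 \<le> i" "i \<le> m" "1 \<le> l" "l \<le> k" "s0 < S" "j < m" and new: "(i, l, s0, j) \<notin> X"
  shows "wp b COLUMN (\<lambda>s'. columns_are (if (i, l, s0, j) \<in> allowed then insert (i, l, s0, j) X else X) s') s"
  unfolding COLUMN_def
proof (rule wp_Seq, rule wp_SMUL[where x = "int (w l)" and y = "\<alpha> j"], goal_cases)
  case (5 s1)
  note fr = frameD[OF 5(1), simplified]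
  have i1: "inp s1" by (rule inp_frame[OF 5(1) s(1)]) auto
  have c1: "columns_are X s1" using columns_are_frame[OF 5(1)] s(3) by simp
  have t: "var s1 ''t'' = int (w l * \<alpha> j)" using 5(2) by simp
  have iff: "(i, l, s0, j) \<in> allowed \<longleftrightarrow> \<not> (T - \<sigma> i < int (w l * \<alpha> j) + int s0) \<and> int (w l * \<alpha> j) + int s0 < int S"
  proof -
    have e: "int (w l * \<alpha> j) + int s0 = int (s0 + w l * \<alpha> j)" by simp
    show ?thesis unfolding e of_nat_less_iff not_less using r
      by (auto simp: allowed_def simp del: of_nat_add of_nat_mult)
  qed
  show ?case
  proof (intro wp_Seq wp_Assign, rule wp_If, goal_cases)
    case 1
    then have al: "(i, l, s0, j) \<in> allowed"
      unfolding iff using i1 r v s t by (simp add: fr inpD)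
    from c1 obtain n where n: "var s1 ''n'' = int n" "1 \<le> n" "inj_on (attr s1) {1..<n}" "attr s1 ` {1..<n} = X"
      and nn: "\<And>c. 0 \<le> arr s1 ''ci'' (int c) \<and> 0 \<le> arr s1 ''cl'' (int c) \<and> 0 \<le> arr s1 ''cs'' (int c) \<and> 0 \<le> arr s1 ''cj'' (int c)"
      and ct: "\<And>c. 1 \<le> c \<Longrightarrow> c < n \<Longrightarrow> arr s1 ''ct'' (int c) = arr s1 ''cs'' (int c) +
        int (w (nat (arr s1 ''cl'' (int c))) * \<alpha> (nat (arr s1 ''cj'' (int c))))"
      and z: "arr s1 ''ci'' 0 = 0" "arr s1 ''cl'' 0 = 0" "arr s1 ''cs'' 0 = 0" "arr s1 ''cj'' 0 = 0" "arr s1 ''ct'' 0 = 0"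
      unfolding columns_are_def by blast
    define s2 where "s2 = setv ''n'' (int n + 1) (seta ''ct'' (int n) (int (w l * \<alpha> j) + int s0) (seta ''cj'' (int n) (int j)
       (seta ''cs'' (int n) (int s0) (seta ''cl'' (int n) (int l) (seta ''ci'' (int n) (int i)
         (setv ''t'' (int (w l * \<alpha> j) + int s0) s1))))))"
    have at: "attr s2 c = (if c = n then (i, l, s0, j) else attr s1 c)" for c
      by (simp add: attr_def s2_def)
    have img: "attr s2 ` {1..<Suc n} = insert (i, l, s0, j) X"
    proof -
      have "attr s2 ` {1..<n} = X" unfolding n(4)[symmetric] by (intro image_cong) (auto simp: at)
      moreover have "attr s2 ` {1..<Suc n} = insert (attr s2 n) (attr s2 ` {1..<n})"
        using n(2) by (simp add: atLeastLessThanSuc)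
      moreover have "attr s2 n = (i, l, s0, j)" by (simp add: at)
      ultimately show ?thesis by simp
    qed
    have inj: "inj_on (attr s2) {1..<Suc n}"
    proof (rule inj_onI)
      fix x y assume xy: "x \<in> {1..<Suc n}" "y \<in> {1..<Suc n}" "attr s2 x = attr s2 y"
      have "attr s1 z \<noteq> (i, l, s0, j)" if "1 \<le> z" "z < n" for z
        using new n(4) that by (metis atLeastLessThan_iff image_eqI)
      then show "x = y" using xy n(3) by (cases "x = n"; cases "y = n") (auto simp: at inj_on_def less_Suc_eq)
    qed
    have "columns_are (insert (i, l, s0, j) X) s2"
      unfolding columns_are_def
    proof (intro exI[of _ "Suc n"] conjI)
      show "\<forall>c. 1 \<le> c \<longrightarrow> c < Suc n \<longrightarrow> arr s2 ''ct'' (int c) = arr s2 ''cs'' (int c) +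
        int (w (nat (arr s2 ''cl'' (int c))) * \<alpha> (nat (arr s2 ''cj'' (int c))))"
        using ct by (auto simp: s2_def less_Suc_eq)
    qed (use n inj img nn z in \<open>auto simp: s2_def\<close>)
    then show ?case using al v t n(1)
      by (intro wp_intros) (simp add: fr s2_def)
  next
    case 2
    then have al: "(i, l, s0, j) \<notin> allowed"
      unfolding iff using i1 r v s t by (simp add: fr inpD)
    then show ?case using c1 by (intro wp_Skip) simp
  qed
qed (use s v r score_le_b in \<open>auto simp: frameD inpD\<close>)

lemma wp_COLUMNS:
  assumes s: "inp s" "var s ''S'' = int S" and z: "\<And>a. a \<in> {''ci'', ''cl'', ''cs'', ''cj'', ''ct''} \<Longrightarrow> arr s a = (\<lambda>_. 0)"
  shows "wp b COLUMNS (columns_are allowed) s"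
  unfolding COLUMNS_def
proof (intro wp_Seq wp_Assign, rule wp_FOR[where lo = 1 and hi = "Suc m" and
    I = "\<lambda>i. columns_are (allowed_below i 1 0 0)"], goal_cases)
  case 6
  show ?case using z by (auto simp: allowed_below_simps columns_are_def attr_def)
next
  case (7 i s1)
  note o1 = 7
  note fr1 = frameD[OF 7(1), simplified]
  have i1: "inp s1" by (rule inp_frame[OF 7(1)]) (use s in auto)
  have S1: "var s1 ''S'' = int S" using s by (simp add: fr1)
  show ?case
  proof (rule wp_FOR[where lo = 1 and hi = "Suc k" and I = "\<lambda>l. columns_are (allowed_below i l 0 0)"], goal_cases)
    case (7 l s2)
    note o2 = 7
    note fr2 = frameD[OF 7(1), simplified]
    have i2: "inp s2" by (rule inp_frame[OF 7(1) i1]) auto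
    have S2: "var s2 ''S'' = int S" using S1 by (simp add: fr2)
    show ?case
    proof (rule wp_FOR[where lo = 0 and hi = S and I = "\<lambda>s0. columns_are (allowed_below i l s0 0)"], goal_cases)
      case (7 s0 s3)
      note o3 = 7
      note fr3 = frameD[OF 7(1), simplified]
      have i3: "inp s3" by (rule inp_frame[OF 7(1) i2]) auto
      have S3: "var s3 ''S'' = int S" using S2 by (simp add: fr3)
      show ?case
      proof (rule wp_FOR[where lo = 0 and hi = m and I = "\<lambda>j. columns_are (allowed_below i l s0 j)"], goal_cases)
        case (7 j s4)
        note fr4 = frameD[OF 7(1), simplified]
        have i4: "inp s4" by (rule inp_frame[OF 7(1) i3]) auto
        have S4: "var s4 ''S'' = int S" using S3 by (simp add: fr4)
        have "(i, l, s0, j) \<notin> allowed_below i l s0 j" by (simp add: allowed_below_def)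
        then show ?case
          by (intro wp_conseq[OF wp_COLUMN[OF i4 S4 7(5), of i l s0 j]])
            (use o1 o2 o3 7 in \<open>auto simp: fr2 fr3 fr4 allowed_below_simps\<close>)
      next
        case (8 s4)
        then show ?case by (simp add: allowed_below_simps)
      qed (use i3 b_bound o3(5) in \<open>auto simp: frameD inpD\<close>)
    next
      case (8 s3)
      then show ?case by (simp add: allowed_below_simps)
    qed (use i2 S2 b_bound o2(5) in \<open>auto simp: frameD inpD\<close>)
  next
    case (8 s2)
    then show ?case by (simp add: allowed_below_simps)
  qed (use i1 b_bound o1(5) in \<open>auto simp: frameD inpD\<close>)
next
  case (8 s1)
  then show ?case by (simp add: allowed_below_simps)
qed (use s b_bound in \<open>auto simp: frameD inpD\<close>)

end

text \<open>The contents of the column arrays as functions on natural numbers, so that the reasoning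
  about flows does not refer to a machine state.\<close>

locale flow_lp = wcm_lp +
  fixes n :: nat and ci cl cs cj ct :: "nat \<Rightarrow> nat"
  assumes n_ge1: "1 \<le> n"
    and inj: "inj_on (\<lambda>c. (ci c, cl c, cs c, cj c)) {1..<n}"
    and img: "(\<lambda>c. (ci c, cl c, cs c, cj c)) ` {1..<n} = allowed"
    and ct_eq: "\<And>c. 1 \<le> c \<Longrightarrow> c < n \<Longrightarrow> ct c = cs c + w (cl c) * \<alpha> (cj c)"
    and zero: "ci 0 = 0" "cl 0 = 0" "cs 0 = 0" "cj 0 = 0" "ct 0 = 0"
begin

definition colarr :: "state \<Rightarrow> bool" where
  "colarr s \<longleftrightarrow> var s ''n'' = int n \<and> (\<forall>c<n. arr s ''ci'' (int c) = int (ci c) \<and> arr s ''cl'' (int c) = int (cl c) \<and>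
     arr s ''cs'' (int c) = int (cs c) \<and> arr s ''cj'' (int c) = int (cj c) \<and> arr s ''ct'' (int c) = int (ct c))"

lemma colarrD:
  assumes "colarr s"
  shows "var s ''n'' = int n" "\<And>c. c < n \<Longrightarrow> arr s ''ci'' (int c) = int (ci c)"
    "\<And>c. c < n \<Longrightarrow> arr s ''cl'' (int c) = int (cl c)" "\<And>c. c < n \<Longrightarrow> arr s ''cs'' (int c) = int (cs c)"
    "\<And>c. c < n \<Longrightarrow> arr s ''cj'' (int c) = int (cj c)" "\<And>c. c < n \<Longrightarrow> arr s ''ct'' (int c) = int (ct c)"
  using assms by (auto simp: colarr_def)

lemma colarr_frame:
  assumes "frame c s s'" "colarr s" "''n'' \<notin> wvars c" "warrs c \<inter> {''ci'', ''cl'', ''cs'', ''cj'', ''ct''} = {}"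
  shows "colarr s'"
proof -
  have "arr s' a = arr s a" if "a \<in> {''ci'', ''cl'', ''cs'', ''cj'', ''ct''}" for a
    using frame_arr[OF assms(1)] assms(4) that by blast
  then show ?thesis using assms(2) frame_var[OF assms(1,3)] by (simp add: colarr_def)
qed

lemma n_le_b: "n \<le> b"
proof -
  have "n - 1 = card ((\<lambda>c. (ci c, cl c, cs c, cj c)) ` {1..<n})" unfolding card_image[OF inj] by simp
  also have "\<dots> \<le> m * k * S * m" unfolding img by (rule card_allowed)
  finally show ?thesis using b_bound(4) by linarith
qed

definition cover_row :: "nat \<Rightarrow> nat \<Rightarrow> nat \<Rightarrow> int" where
  "cover_row l j c = (if c = 0 then - 1 else if cl c = l \<and> cj c = j then 1 else 0)"

definition flow_row :: "nat \<Rightarrow> nat \<Rightarrow> nat \<Rightarrow> nat \<Rightarrow> int" where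
  "flow_row i l s c = (if cl c = l \<and> ct c = s \<and> (c = 0 \<or> ci c = i) then 1
     else if cl c = Suc l \<and> cs c = s \<and> ci c = i then - 1 else 0)"

text \<open>A fixed value beyond the last column makes rows comparable as functions, so that they
  can be collected in a set and their order forgotten.\<close>

definition trunc_at_n :: "(nat \<Rightarrow> int) \<Rightarrow> nat \<Rightarrow> int" where
  "trunc_at_n f c = (if c < n then f c else 0)"

definition matrow :: "state \<Rightarrow> nat \<Rightarrow> nat \<Rightarrow> int" where
  "matrow s r = trunc_at_n (\<lambda>c. arr s ''A'' (int r * int n + int c))"

definition rows_are :: "nat \<Rightarrow> (nat \<Rightarrow> int) set \<Rightarrow> state \<Rightarrow> bool" where
  "rows_are r X s \<longleftrightarrow> var s ''R'' = int r \<and> var s ''p'' = int r * int n \<and> matrow s ` {..<r} = X"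

lemma rows_are_setv [simp]: "x \<noteq> ''R'' \<Longrightarrow> x \<noteq> ''p'' \<Longrightarrow> rows_are r X (setv x v s) \<longleftrightarrow> rows_are r X s"
  by (auto simp: rows_are_def matrow_def[abs_def])

lemma wp_ROW:
  assumes s: "var s ''n'' = int n" "rows_are r X s"
    and B: "wvars B \<subseteq> {''val''}" "warrs B = {}"
    and spec: "\<And>s' c. c < n \<Longrightarrow> var s' ''c'' = int c \<Longrightarrow> frame (ROW B) s s' \<Longrightarrow> wp b B (\<lambda>s''. var s'' ''val'' = f c) s'"
  shows "wp b (ROW B) (rows_are (Suc r) (insert (trunc_at_n f) X)) s"
  unfolding ROW_def
proof (rule wp_Seq, rule wp_FOR[where lo = 0 and hi = n and I = "\<lambda>i s'. (\<forall>c<i. arr s' ''A'' (int r * int n + int c) = f c) \<and>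
     (\<forall>q<r. \<forall>c<n. arr s' ''A'' (int q * int n + int c) = arr s ''A'' (int q * int n + int c))"], goal_cases)
  case 4
  then show ?case using B by auto
next
  case (5 s')
  have "''n'' \<notin> wvars B" using B by auto
  then show ?case using s frame_var[OF 5, of "''n''"] by simp
next
  case (7 c s')
  have fr: "frame (ROW B) s s'" using 7(1) B by (auto simp: frame_def)
  have "''p'' \<notin> wvars B" "''c'' \<notin> wvars B" using B by auto
  then have p: "var s' ''p'' = int r * int n" using s frame_var[OF 7(1), of "''p''"] by (simp add: rows_are_def)
  show ?case
  proof (rule wp_Seq, rule wp_conseq[OF spec[OF 7(3,4) fr]], rule wp_Store, goal_cases)
    case (1 s2)
    have "var s2 ''p'' = int r * int n" "var s2 ''c'' = int c" "arr s2 = arr s'"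
      using p 7(4) \<open>''p'' \<notin> wvars B\<close> \<open>''c'' \<notin> wvars B\<close> 1(1) B(2) by (auto simp: frame_def)
    then show ?case using 7(3,5) 1(2) by (auto simp: less_Suc_eq matrix_index_eq_int)
  qed
next
  case (8 s')
  have v: "''p'' \<notin> wvars B" "''R'' \<notin> wvars B" "''n'' \<notin> wvars B" using B by auto
  have A: "matrow s' q = (if q = r then trunc_at_n f else matrow s q)" if "q < Suc r" for q
    using 8(3) that by (auto simp: matrow_def trunc_at_n_def fun_eq_iff)
  have "matrow s' ` {..<Suc r} = insert (trunc_at_n f) X"
  proof -
    have "matrow s' ` {..<r} = X" using s(2) unfolding rows_are_def by (auto simp: A image_iff)
    then show ?thesis by (simp add: lessThan_Suc A)
  qed
  then show ?case using s v frame_var[OF 8(1)]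
    by (intro wp_Seq wp_Assign) (simp add: rows_are_def matrow_def[abs_def] algebra_simps)
qed (use s n_le_b in auto)

definition cover_below :: "nat \<Rightarrow> nat \<Rightarrow> (nat \<Rightarrow> int) set" where
  "cover_below l j = {trunc_at_n (cover_row l' j') | l' j'. 1 \<le> l' \<and> l' \<le> k \<and> j' < m \<and> (l' < l \<or> l' = l \<and> j' < j)}"

definition flow_below :: "nat \<Rightarrow> nat \<Rightarrow> nat \<Rightarrow> (nat \<Rightarrow> int) set" where
  "flow_below i l s = cover_below (Suc k) 0 \<union> {trunc_at_n (flow_row i' l' s') | i' l' s'. 1 \<le> i' \<and> i' \<le> m \<and> l' < k \<and> s' < S \<and>
     (i' < i \<or> i' = i \<and> (l' < l \<or> l' = l \<and> s' < s))}"

lemma cover_below_simps: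
  "1 \<le> l \<Longrightarrow> l \<le> k \<Longrightarrow> j < m \<Longrightarrow> cover_below l (Suc j) = insert (trunc_at_n (cover_row l j)) (cover_below l j)"
  "cover_below l m = cover_below (Suc l) 0"
  "cover_below (Suc 0) 0 = {}"
  by (auto simp: cover_below_def less_Suc_eq)

lemma flow_below_simps:
  "1 \<le> i \<Longrightarrow> i \<le> m \<Longrightarrow> l < k \<Longrightarrow> s < S \<Longrightarrow> flow_below i l (Suc s) = insert (trunc_at_n (flow_row i l s)) (flow_below i l s)"
  "flow_below i l S = flow_below i (Suc l) 0"
  "flow_below i k 0 = flow_below (Suc i) 0 0"
  "flow_below (Suc 0) 0 0 = cover_below (Suc k) 0"
  by (auto simp: flow_below_def less_Suc_eq)

definition lp_rows :: "(nat \<Rightarrow> int) set" where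
  "lp_rows = flow_below (Suc m) 0 0"

lemma wp_COVER:
  assumes "colarr s" "var s ''l'' = int l" "var s ''j'' = int j" "var s ''c'' = int c" "c < n"
  shows "wp b COVER (\<lambda>s'. var s' ''val'' = cover_row l j c) s"
  unfolding COVER_def using assms
  by (intro wp_intros) (auto simp: colarrD cover_row_def)

lemma wp_FLOW:
  assumes "colarr s" "var s ''i'' = int i" "var s ''l'' = int l" "var s ''s'' = int s0" "var s ''c'' = int c" "c < n"
  shows "wp b FLOW (\<lambda>s'. var s' ''val'' = flow_row i l s0 c) s"
  unfolding FLOW_def using assms
  by (intro wp_intros) (auto simp: colarrD flow_row_def)

lemma wp_ROWS:
  assumes s: "inp s" "var s ''S'' = int S" "colarr s"
  shows "wp b ROWS (rows_are (k * m + m * k * S) lp_rows) s"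
proof -
  have cov: "wp b (FOR ''l'' (N 1) (Add (V ''k'') (N 1)) (FOR ''j'' (N 0) (V ''m'') (ROW COVER)))
      (rows_are (k * m) (cover_below (Suc k) 0)) s0"
    if c0: "inp s0" "colarr s0" and r0: "rows_are 0 {} s0" for s0
  proof (rule wp_FOR[where lo = 1 and hi = "Suc k" and I = "\<lambda>l. rows_are ((l - 1) * m) (cover_below l 0)"], goal_cases)
    case (7 l s1)
    have c1: "inp s1" by (rule inp_frame[OF 7(1) c0(1)]) auto
    have d1: "colarr s1" by (rule colarr_frame[OF 7(1) c0(2)]) auto
    note o = 7
    show ?case
    proof (rule wp_FOR[where lo = 0 and hi = m and I = "\<lambda>j. rows_are ((l - 1) * m + j) (cover_below l j)"], goal_cases)
      case (7 j s2)
      have d2: "colarr s2" by (rule colarr_frame[OF 7(1) d1]) auto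
      have l2: "var s2 ''l'' = int l" using o(4) frame_var[OF 7(1)] by simp
      show ?case
      proof (rule wp_conseq[OF wp_ROW[where f = "cover_row l j", OF _ 7(5)]], goal_cases)
        case (4 s3 c)
        have "colarr s3" by (rule colarr_frame[OF 4(3) d2]) auto
        then show ?case using 4 l2 7(4) frame_var[OF 4(3)] by (intro wp_COVER) auto
      next
        case (5 s3)
        then show ?case using cover_below_simps(1)[of l j] o 7 by simp
      qed (use d2 in \<open>auto simp: colarrD\<close>)
    next
      case (8 s2)
      have "(l - 1) * m + m = l * m" using o(2) by (cases l) auto
      then show ?case using 8(3) by (simp add: cover_below_simps)
    qed (use c1 b_bound o(5) in \<open>auto simp: frameD inpD\<close>)
  qed (use c0 r0 b_bound in \<open>auto simp: frameD inpD cover_below_simps\<close>)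
  have flow: "wp b (FOR ''i'' (N 1) (Add (V ''m'') (N 1)) (FOR ''l'' (N 0) (V ''k'') (FOR ''s'' (N 0) (V ''S'') (ROW FLOW))))
      (rows_are (k * m + m * k * S) lp_rows) s0"
    if c0: "inp s0" "colarr s0" "var s0 ''S'' = int S" and r0: "rows_are (k * m) (cover_below (Suc k) 0) s0" for s0
  proof (rule wp_FOR[where lo = 1 and hi = "Suc m" and I = "\<lambda>i. rows_are (k * m + (i - 1) * k * S) (flow_below i 0 0)"], goal_cases)
    case (7 i s1)
    have c1: "inp s1" by (rule inp_frame[OF 7(1) c0(1)]) auto
    have d1: "colarr s1" by (rule colarr_frame[OF 7(1) c0(2)]) auto
    have S1: "var s1 ''S'' = int S" using c0(3) frame_var[OF 7(1)] by simp
    note o = 7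
    show ?case
    proof (rule wp_FOR[where lo = 0 and hi = k and I = "\<lambda>l. rows_are (k * m + (i - 1) * k * S + l * S) (flow_below i l 0)"], goal_cases)
      case (7 l s2)
      have c2: "inp s2" by (rule inp_frame[OF 7(1) c1]) auto
      have d2: "colarr s2" by (rule colarr_frame[OF 7(1) d1]) auto
      have S2: "var s2 ''S'' = int S" using S1 frame_var[OF 7(1)] by simp
      have i2: "var s2 ''i'' = int i" using o(4) frame_var[OF 7(1)] by simp
      note o2 = 7
      show ?case
      proof (rule wp_FOR[where lo = 0 and hi = S and I = "\<lambda>s'. rows_are (k * m + (i - 1) * k * S + l * S + s') (flow_below i l s')"], goal_cases)
        case (7 s' s3)
        have d3: "colarr s3" by (rule colarr_frame[OF 7(1) d2]) auto
        have l3: "var s3 ''l'' = int l" "var s3 ''i'' = int i" using o2(4) i2 frame_var[OF 7(1)] by auto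
        show ?case
        proof (rule wp_conseq[OF wp_ROW[where f = "flow_row i l s'", OF _ 7(5)]], goal_cases)
          case (4 s4 c)
          have "colarr s4" by (rule colarr_frame[OF 4(3) d3]) auto
          then show ?case using 4 l3 7(4) frame_var[OF 4(3)] by (intro wp_FLOW) auto
        next
          case (5 s4)
          then show ?case using flow_below_simps(1)[of i l s'] o o2 7 by simp
        qed (use d3 in \<open>auto simp: colarrD\<close>)
      next
        case (8 s3)
        then show ?case by (simp add: flow_below_simps algebra_simps)
      qed (use c2 S2 b_bound o2(5) in \<open>auto simp: frameD inpD\<close>)
    next
      case (8 s2)
      have "(i - 1) * k * S + k * S = i * k * S" using o(2) by (cases i) (auto simp: algebra_simps)
      then show ?case using 8(3) by (simp add: flow_below_simps add.assoc)
    qed (use c1 b_bound o(5) in \<open>auto simp: frameD inpD\<close>)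
  qed (use c0 r0 b_bound in \<open>auto simp: frameD inpD flow_below_simps lp_rows_def\<close>)
  show ?thesis unfolding ROWS_def
  proof (intro wp_Seq wp_Assign, rule wp_conseq[OF cov], goal_cases)
    case 1
    show ?case using s by (simp add: inp_def)
  next
    case 2
    show ?case using s by (simp add: colarr_def)
  next
    case 3
    show ?case by (simp add: rows_are_def)
  next
    case (4 s1)
    have "inp s1" by (rule inp_frame[OF 4(1)]) (use s in auto)
    moreover have "colarr s1" by (rule colarr_frame[OF 4(1)]) (use s in \<open>auto simp: colarr_def\<close>)
    moreover have "var s1 ''S'' = int S" using s(2) frame_var[OF 4(1)] by simp
    ultimately show ?case using 4(2) by (rule flow)
  qed
qed

lemma lp_rows_abs_le: "f \<in> lp_rows \<Longrightarrow> \<bar>f c\<bar> \<le> 1"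
  by (auto simp: lp_rows_def flow_below_def cover_below_def trunc_at_n_def cover_row_def flow_row_def)

section \<open>The rows as covering and conservation equations\<close>

definition inset :: "nat \<Rightarrow> nat \<Rightarrow> nat \<Rightarrow> nat set" where
  "inset i l s = {c. c < n \<and> cl c = l \<and> ct c = s \<and> (c = 0 \<or> ci c = i)}"

definition outset :: "nat \<Rightarrow> nat \<Rightarrow> nat \<Rightarrow> nat set" where
  "outset i l s = {c. c < n \<and> cl c = Suc l \<and> cs c = s \<and> ci c = i}"

definition covset :: "nat \<Rightarrow> nat \<Rightarrow> nat set" where
  "covset l j = {c. 1 \<le> c \<and> c < n \<and> cl c = l \<and> cj c = j}"

lemma finite_colsets [simp]: "finite (inset i l s)" "finite (outset i l s)" "finite (covset l j)"
  by (auto simp: inset_def outset_def covset_def)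

text \<open>The ring is left open because both the integers computed by the program and real
  solutions are considered. Nodes in layer \<open>k\<close> carry no equation, as paths end
  there.\<close>

definition is_flow :: "(nat \<Rightarrow> 'a :: comm_ring_1) \<Rightarrow> bool" where
  "is_flow x \<longleftrightarrow> (\<forall>l j. 1 \<le> l \<longrightarrow> l \<le> k \<longrightarrow> j < m \<longrightarrow> (\<Sum>c\<in>covset l j. x c) = x 0) \<and>
     (\<forall>i l s. 1 \<le> i \<longrightarrow> i \<le> m \<longrightarrow> l < k \<longrightarrow> s < S \<longrightarrow> (\<Sum>c\<in>inset i l s. x c) = (\<Sum>c\<in>outset i l s. x c))"

lemma sum_cover_row:
  "(\<Sum>c<n. of_int (trunc_at_n (cover_row l j) c) * x c) = (\<Sum>c\<in>covset l j. x c) - (x 0 :: 'a :: comm_ring_1)"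
proof -
  have "(\<Sum>c<n. of_int (trunc_at_n (cover_row l j) c) * x c) = (\<Sum>c<n. (if c \<in> covset l j then x c else 0) - (if c = 0 then x c else 0))"
    by (intro sum.cong refl) (auto simp: trunc_at_n_def cover_row_def covset_def)
  also have "\<dots> = (\<Sum>c<n. if c \<in> covset l j then x c else 0) - (\<Sum>c<n. if c = 0 then x c else 0)"
    by (rule sum_subtractf)
  also have "(\<Sum>c<n. if c \<in> covset l j then x c else 0) = (\<Sum>c\<in>covset l j. x c)"
    by (subst sum.inter_restrict[symmetric]) (auto intro!: sum.cong simp: covset_def)
  also have "(\<Sum>c<n. if c = 0 then x c else 0) = x 0"
    using n_ge1 by (simp add: sum.delta)
  finally show ?thesis .
qed

lemma sum_flow_row:
  "(\<Sum>c<n. of_int (trunc_at_n (flow_row i l s) c) * x c) = (\<Sum>c\<in>inset i l s. x c) - (\<Sum>c\<in>outset i l s. x c :: 'a :: comm_ring_1)"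
proof -
  have "(\<Sum>c<n. of_int (trunc_at_n (flow_row i l s) c) * x c)
      = (\<Sum>c<n. (if c \<in> inset i l s then x c else 0) - (if c \<in> outset i l s then x c else 0))"
    by (intro sum.cong refl) (auto simp: trunc_at_n_def flow_row_def inset_def outset_def)
  also have "\<dots> = (\<Sum>c<n. if c \<in> inset i l s then x c else 0) - (\<Sum>c<n. if c \<in> outset i l s then x c else 0)"
    by (rule sum_subtractf)
  also have "(\<Sum>c<n. if c \<in> inset i l s then x c else 0) = (\<Sum>c\<in>inset i l s. x c)"
    by (subst sum.inter_restrict[symmetric]) (auto intro!: sum.cong simp: inset_def)
  also have "(\<Sum>c<n. if c \<in> outset i l s then x c else 0) = (\<Sum>c\<in>outset i l s. x c)"
    by (subst sum.inter_restrict[symmetric]) (auto intro!: sum.cong simp: outset_def)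
  finally show ?thesis .
qed

lemma lp_rows_iff_flow:
  "(\<forall>f\<in>lp_rows. (\<Sum>c<n. of_int (f c) * x c) = 0) \<longleftrightarrow> is_flow (x :: nat \<Rightarrow> 'a :: comm_ring_1)"
proof -
  have "lp_rows = {trunc_at_n (cover_row l j) | l j. 1 \<le> l \<and> l \<le> k \<and> j < m} \<union>
     {trunc_at_n (flow_row i l s) | i l s. 1 \<le> i \<and> i \<le> m \<and> l < k \<and> s < S}"
    by (auto simp: lp_rows_def flow_below_def cover_below_def less_Suc_eq_le)
  then have "(\<forall>f\<in>lp_rows. (\<Sum>c<n. of_int (f c) * x c) = 0) \<longleftrightarrow>
    (\<forall>l j. 1 \<le> l \<longrightarrow> l \<le> k \<longrightarrow> j < m \<longrightarrow> (\<Sum>c<n. of_int (trunc_at_n (cover_row l j) c) * x c) = 0) \<and>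
    (\<forall>i l s. 1 \<le> i \<longrightarrow> i \<le> m \<longrightarrow> l < k \<longrightarrow> s < S \<longrightarrow> (\<Sum>c<n. of_int (trunc_at_n (flow_row i l s) c) * x c) = 0)"
    by (simp only: ball_Un) blast
  then show ?thesis unfolding sum_cover_row sum_flow_row is_flow_def by simp
qed

end

section \<open>From solutions to flows\<close>

context flow_lp
begin

definition pre :: "(nat \<Rightarrow> nat) \<Rightarrow> nat \<Rightarrow> nat" where
  "pre C l = (\<Sum>l'=1..l. w l' * \<alpha> (C l'))"

lemma pre_simps [simp]: "pre C 0 = 0" "pre C (Suc l) = pre C l + w (Suc l) * \<alpha> (C (Suc l))"
  by (simp_all add: pre_def)

lemma configs_iff: "C \<in> configs I T i \<longleftrightarrow> C \<in> {1..k} \<rightarrow>\<^sub>E {..<m} \<and> int (pre C k) \<le> T - \<sigma> i"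
  by (simp add: configs_def pre_def m_def k_def)

lemma finite_configs [simp]: "finite (configs I T i)"
  by (rule finite_subset[OF _ finite_PiE[of "{1..k}" "\<lambda>_. {..<m}"]]) (simp_all add: subset_iff configs_iff)

lemma pre_mono: "l \<le> l' \<Longrightarrow> pre C l \<le> pre C l'"
  unfolding pre_def by (rule sum_mono2) auto

lemma pre_less:
  assumes "C \<in> configs I T i" "l \<le> k" shows "pre C l < S"
proof -
  have "pre C k \<le> (\<Sum>l'=1..k. w l' * \<alpha> (m - 1))"
    unfolding pre_def using assms(1)
    by (intro sum_mono mult_left_mono score_le_last) (auto simp: configs_iff PiE_iff)
  also have "\<dots> = total_weight I * \<alpha> (m - 1)"
    by (simp add: total_weight_def k_def sum_distrib_right)
  finally show ?thesis using pre_mono[OF assms(2), of C] by (simp add: S_def)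
qed

lemma allowed_column:
  assumes "(i, l, s, j) \<in> allowed"
  obtains c where "1 \<le> c" "c < n" "ci c = i" "cl c = l" "cs c = s" "cj c = j"
  using assms unfolding img[symmetric] by auto

lemma column_allowed: "1 \<le> c \<Longrightarrow> c < n \<Longrightarrow> (ci c, cl c, cs c, cj c) \<in> allowed"
  unfolding img[symmetric] by auto

lemma column_eq:
  assumes "1 \<le> c" "c < n" "1 \<le> c'" "c' < n" "ci c = ci c'" "cl c = cl c'" "cs c = cs c'" "cj c = cj c'"
  shows "c = c'"
  using inj_onD[OF inj, of c c'] assms by simp

definition is_column :: "nat \<Rightarrow> (nat \<Rightarrow> nat) \<Rightarrow> nat \<Rightarrow> nat \<Rightarrow> bool" where
  "is_column i C l c \<longleftrightarrow> 1 \<le> c \<and> c < n \<and> ci c = i \<and> cl c = l \<and> cs c = pre C (l - 1) \<and> cj c = C l"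

definition column_of :: "nat \<Rightarrow> (nat \<Rightarrow> nat) \<Rightarrow> nat \<Rightarrow> nat" where
  "column_of i C l = (THE c. is_column i C l c)"

lemma column_of_ex1:
  assumes "1 \<le> i" "i \<le> m" "C \<in> configs I T i" "1 \<le> l" "l \<le> k"
  shows "\<exists>!c. is_column i C l c"
proof -
  obtain l0 where l0: "l = Suc l0" using assms(4) by (cases l) auto
  have t: "pre C (l - 1) + w l * \<alpha> (C l) = pre C l" by (simp add: l0)
  have "pre C l \<le> pre C k" using assms by (intro pre_mono)
  then have 1: "int (pre C l) \<le> T - \<sigma> i" using assms(3) unfolding configs_iff by linarith
  have 2: "pre C l < S" "pre C (l - 1) < S" using assms by (auto intro!: pre_less)
  have 3: "C l < m" using assms by (auto simp: configs_iff dest: PiE_mem)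
  have "(i, l, pre C (l - 1), C l) \<in> allowed"
    unfolding allowed_def mem_Collect_eq prod.case t using 1 2 3 assms by blast
  then obtain c where "1 \<le> c" "c < n" "ci c = i" "cl c = l" "cs c = pre C (l - 1)" "cj c = C l"
    by (rule allowed_column)
  then have "is_column i C l c" by (simp add: is_column_def)
  then show ?thesis
  proof (rule ex1I)
    fix c' assume "is_column i C l c'"
    then show "c' = c" using \<open>is_column i C l c\<close> column_eq[of c' c] by (simp add: is_column_def)
  qed
qed

lemma is_column_column_of:
  assumes "1 \<le> i" "i \<le> m" "C \<in> configs I T i" "1 \<le> l" "l \<le> k"
  shows "is_column i C l (column_of i C l)"
  unfolding column_of_def by (rule theI'[OF column_of_ex1[OF assms]])

lemma column_of_unique:
  assumes "1 \<le> i" "i \<le> m" "C \<in> configs I T i" "1 \<le> l" "l \<le> k"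
  shows "is_column i C l c \<longleftrightarrow> c = column_of i C l"
  using column_of_ex1[OF assms] is_column_column_of[OF assms] by blast

lemma column_of_facts:
  assumes "1 \<le> i" "i \<le> m" "C \<in> configs I T i" "1 \<le> l" "l \<le> k"
  shows "0 < column_of i C l" "column_of i C l < n" "ci (column_of i C l) = i" "cl (column_of i C l) = l"
    "cs (column_of i C l) = pre C (l - 1)" "cj (column_of i C l) = C l" "ct (column_of i C l) = pre C l"
proof -
  obtain l0 where l0: "l = Suc l0" using assms(4) by (cases l) auto
  obtain c where c: "c = column_of i C l" by simp
  have "is_column i C l c" unfolding c by (rule is_column_column_of[OF assms])
  then have f: "1 \<le> c" "c < n" "ci c = i" "cl c = l" "cs c = pre C l0" "cj c = C l"
    by (simp_all add: is_column_def l0)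
  have "ct c = pre C l" unfolding ct_eq[OF f(1,2)] f by (simp add: l0)
  then show "0 < column_of i C l" "column_of i C l < n" "ci (column_of i C l) = i" "cl (column_of i C l) = l"
    "cs (column_of i C l) = pre C (l - 1)" "cj (column_of i C l) = C l" "ct (column_of i C l) = pre C l"
    using f l0 unfolding c by simp_all
qed

text \<open>Each configuration sends \<open>y i C\<close> units along its path; these path flows are
  superposed, and the homogenizing variable is normalized to 1.\<close>

definition flow_of :: "(nat \<Rightarrow> (nat \<Rightarrow> nat) \<Rightarrow> real) \<Rightarrow> nat \<Rightarrow> real" where
  "flow_of y c = (if c = 0 then 1 else
     (\<Sum>i=1..m. \<Sum>C\<in>configs I T i. if is_column i C (cl c) c then y i C else 0))"

text \<open>A path has exactly one arc in each layer. A sum over arcs of one layer can thus be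
  rewritten as a sum over the configurations whose arc in that layer is among them.\<close>

lemma sum_flow_of:
  assumes Q: "\<And>c. c \<in> Q \<Longrightarrow> 1 \<le> c \<and> c < n \<and> cl c = l" and l: "1 \<le> l" "l \<le> k"
  shows "(\<Sum>c\<in>Q. flow_of y c) = (\<Sum>i=1..m. \<Sum>C\<in>configs I T i. if column_of i C l \<in> Q then y i C else 0)"
proof -
  have fin: "finite Q" by (rule finite_subset[of _ "{..<n}"]) (use Q in auto)
  have "(\<Sum>c\<in>Q. flow_of y c) = (\<Sum>c\<in>Q. \<Sum>i=1..m. \<Sum>C\<in>configs I T i. if c = column_of i C l then y i C else 0)"
  proof (rule sum.cong[OF refl])
    fix c assume c: "c \<in> Q"
    have "flow_of y c = (\<Sum>i=1..m. \<Sum>C\<in>configs I T i. if is_column i C l c then y i C else 0)"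
      using Q[OF c] by (simp add: flow_of_def)
    also have "\<dots> = (\<Sum>i=1..m. \<Sum>C\<in>configs I T i. if c = column_of i C l then y i C else 0)"
      using l by (intro sum.cong refl) (simp add: column_of_unique)
    finally show "flow_of y c = (\<Sum>i=1..m. \<Sum>C\<in>configs I T i. if c = column_of i C l then y i C else 0)" .
  qed
  also have "\<dots> = (\<Sum>i=1..m. \<Sum>c\<in>Q. \<Sum>C\<in>configs I T i. if c = column_of i C l then y i C else 0)"
    by (rule sum.swap)
  also have "\<dots> = (\<Sum>i=1..m. \<Sum>C\<in>configs I T i. \<Sum>c\<in>Q. if c = column_of i C l then y i C else 0)"
    by (intro sum.cong refl sum.swap)
  also have "\<dots> = (\<Sum>i=1..m. \<Sum>C\<in>configs I T i. if column_of i C l \<in> Q then y i C else 0)"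
    using fin by (simp add: sum.delta)
  finally show ?thesis .
qed

text \<open>Double counting for a fixed manipulator: the \<open>m\<close> covering sums are at least
  1 each, and their total equals that of the \<open>m\<close> packing sums, which are at most 1
  each. Hence equality holds everywhere.\<close>

lemma lp_feasible_tight:
  assumes y: "lp_feasible I T y"
  shows "1 \<le> i \<Longrightarrow> i \<le> m \<Longrightarrow> (\<Sum>C\<in>configs I T i. y i C) = 1"
    and "1 \<le> l \<Longrightarrow> l \<le> k \<Longrightarrow> j < m \<Longrightarrow> (\<Sum>i=1..m. \<Sum>C\<in>configs I T i. if C l = j then y i C else 0) = 1"
proof -
  define a where "a i = (\<Sum>C\<in>configs I T i. y i C)" for i
  define c where "c l j = (\<Sum>i=1..m. \<Sum>C\<in>configs I T i. if C l = j then y i C else 0)" for l j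
  have a1: "a i \<le> 1" if "i \<in> {1..m}" for i using y that by (simp add: lp_feasible_def a_def m_def)
  have c1: "1 \<le> c l j" if "j < m" "1 \<le> l" "l \<le> k" for l j
  proof -
    have "c l j = (\<Sum>i=1..m. \<Sum>C\<in>{C \<in> configs I T i. C l = j}. y i C)"
      unfolding c_def by (rule sum.cong[OF refl]) (simp add: sum.inter_filter)
    then show ?thesis using y that by (auto simp: lp_feasible_def m_def k_def)
  qed
  have ac: "(\<Sum>j<m. c l j) = (\<Sum>i=1..m. a i)" if l: "1 \<le> l" "l \<le> k" for l
  proof -
    have "(\<Sum>j<m. c l j) = (\<Sum>i=1..m. \<Sum>j<m. \<Sum>C\<in>configs I T i. if C l = j then y i C else 0)"
      unfolding c_def by (rule sum.swap)
    also have "\<dots> = (\<Sum>i=1..m. \<Sum>C\<in>configs I T i. \<Sum>j<m. if C l = j then y i C else 0)"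
      by (intro sum.cong refl sum.swap)
    also have "\<dots> = (\<Sum>i=1..m. a i)"
      unfolding a_def
    proof (intro sum.cong refl)
      fix i C assume "C \<in> configs I T i"
      then have "C l < m" using l by (auto simp: configs_iff PiE_iff)
      then show "(\<Sum>j<m. if C l = j then y i C else 0) = y i C" by (simp add: sum.delta')
    qed
    finally show ?thesis .
  qed
  have le: "(\<Sum>i=1..m. a i) \<le> m" using sum_mono[of "{1..m}" a "\<lambda>_. 1"] a1 by simp
  have ge: "real m \<le> (\<Sum>j<m. c l j)" if "1 \<le> l" "l \<le> k" for l
    using sum_mono[of "{..<m}" "\<lambda>_. 1" "c l"] c1[OF _ that] by simp
  have "(\<Sum>i=1..m. a i) = m" using le ge[of 1] ac[of 1] k_pos by simp
  then have "(\<Sum>i=1..m. 1 - a i) = 0" by (simp add: sum_subtractf)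
  then have "\<forall>i\<in>{1..m}. 1 - a i = 0"
    by (subst (asm) sum_nonneg_eq_0_iff) (use a1 in auto)
  then show "1 \<le> i \<Longrightarrow> i \<le> m \<Longrightarrow> (\<Sum>C\<in>configs I T i. y i C) = 1" by (simp add: a_def)
  show "(\<Sum>i=1..m. \<Sum>C\<in>configs I T i. if C l = j then y i C else 0) = 1" if l: "1 \<le> l" "l \<le> k" and "j < m"
  proof -
    have "(\<Sum>j<m. c l j) = m" using le ge[OF l] ac[OF l] by simp
    then have "(\<Sum>j<m. c l j - 1) = 0" by (simp add: sum_subtractf)
    then have "\<forall>j\<in>{..<m}. c l j - 1 = 0"
      by (subst (asm) sum_nonneg_eq_0_iff) (use c1[OF _ l] in auto)
    then show ?thesis using \<open>j < m\<close> by (simp add: c_def)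
  qed
qed

lemma flow_of_nonneg: "lp_feasible I T y \<Longrightarrow> 0 \<le> flow_of y c"
  unfolding flow_of_def by (auto intro!: sum_nonneg simp: lp_feasible_def lp_vars_def m_def)

text \<open>Inflow and outflow of a node both collect the weight of those configurations of the
  candidate whose first \<open>l\<close> scores add up to \<open>s\<close>. In layer 0 the inflow is
  column 0, and tightness of the packing constraint provides the matching unit.\<close>

lemma is_flow_flow_of:
  assumes y: "lp_feasible I T y"
  shows "is_flow (flow_of y)"
  unfolding is_flow_def
proof (intro conjI allI impI)
  fix l j assume l: "1 \<le> l" "l \<le> k" and j: "j < m"
  have "(\<Sum>c\<in>covset l j. flow_of y c) = (\<Sum>i=1..m. \<Sum>C\<in>configs I T i. if column_of i C l \<in> covset l j then y i C else 0)"
    using l by (intro sum_flow_of) (auto simp: covset_def)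
  also have "\<dots> = (\<Sum>i=1..m. \<Sum>C\<in>configs I T i. if C l = j then y i C else 0)"
    using l by (intro sum.cong refl) (simp add: covset_def column_of_facts Suc_le_eq)
  also have "\<dots> = flow_of y 0" using lp_feasible_tight(2)[OF y l j] by (simp add: flow_of_def)
  finally show "(\<Sum>c\<in>covset l j. flow_of y c) = flow_of y 0" .
next
  fix i l s assume i: "1 \<le> i" "i \<le> m" and l: "l < k" and s: "s < S"
  have out: "(\<Sum>c\<in>outset i l s. flow_of y c) = (\<Sum>i'=1..m. \<Sum>C\<in>configs I T i'. if i' = i \<and> pre C l = s then y i' C else 0)"
  proof -
    have "1 \<le> c" if "c \<in> outset i l s" for c using that zero by (cases c) (auto simp: outset_def)
    then have "(\<Sum>c\<in>outset i l s. flow_of y c) = (\<Sum>i'=1..m. \<Sum>C\<in>configs I T i'. if column_of i' C (Suc l) \<in> outset i l s then y i' C else 0)"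
      using l by (intro sum_flow_of) (auto simp: outset_def)
    also have "\<dots> = (\<Sum>i'=1..m. \<Sum>C\<in>configs I T i'. if i' = i \<and> pre C l = s then y i' C else 0)"
      using l by (intro sum.cong refl) (simp add: outset_def column_of_facts conj_commute)
    finally show ?thesis .
  qed
  show "(\<Sum>c\<in>inset i l s. flow_of y c) = (\<Sum>c\<in>outset i l s. flow_of y c)"
  proof (cases "l = 0")
    case False
    have "1 \<le> c" if "c \<in> inset i l s" for c using that zero False by (cases c) (auto simp: inset_def)
    then have "(\<Sum>c\<in>inset i l s. flow_of y c) = (\<Sum>i'=1..m. \<Sum>C\<in>configs I T i'. if column_of i' C l \<in> inset i l s then y i' C else 0)"
      using l False by (intro sum_flow_of) (auto simp: inset_def)
    also have "\<dots> = (\<Sum>i'=1..m. \<Sum>C\<in>configs I T i'. if i' = i \<and> pre C l = s then y i' C else 0)"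
      using l False zero
    proof (intro sum.cong refl)
      fix i' C assume "i' \<in> {1..m}" "C \<in> configs I T i'"
      then have "1 \<le> column_of i' C l" "column_of i' C l < n" "ci (column_of i' C l) = i'" "cl (column_of i' C l) = l" "ct (column_of i' C l) = pre C l"
        using l False by (simp_all add: column_of_facts Suc_le_eq)
      then have "column_of i' C l \<in> inset i l s \<longleftrightarrow> i' = i \<and> pre C l = s" by (auto simp: inset_def)
      then show "(if column_of i' C l \<in> inset i l s then y i' C else 0) = (if i' = i \<and> pre C l = s then y i' C else 0)" by simp
    qed
    finally show ?thesis unfolding out .
  next
    case True
    have "inset i l s = (if s = 0 then {0} else {})"
    proof -
      have "c \<in> inset i l s \<longleftrightarrow> c = 0 \<and> s = 0" for c
      proof (cases "c = 0")
        case True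
        then show ?thesis using \<open>l = 0\<close> zero n_ge1 by (auto simp: inset_def)
      next
        case False
        then have "cl c \<noteq> 0" if "c < n" using column_allowed[of c] that by (auto simp: allowed_def)
        then show ?thesis using \<open>l = 0\<close> False by (auto simp: inset_def)
      qed
      then show ?thesis by auto
    qed
    then have "(\<Sum>c\<in>inset i l s. flow_of y c) = (if s = 0 then 1 else 0)" by (simp add: flow_of_def)
    moreover have "(\<Sum>i'=1..m. \<Sum>C\<in>configs I T i'. if i' = i \<and> pre C l = s then y i' C else 0)
        = (\<Sum>i'=1..m. if i' = i then (if s = 0 then 1 else 0) else 0)"
      using True lp_feasible_tight(1)[OF y i] by (intro sum.cong refl) auto
    then have "(\<Sum>c\<in>outset i l s. flow_of y c) = (if s = 0 then 1 else 0)"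
      unfolding out using i by (simp add: sum.delta)
    ultimately show ?thesis by simp
  qed
qed

end

section \<open>From flows to solutions\<close>

text \<open>Follows positive arcs from the source, layer by layer. The bottleneck \<open>mn\<close>
  starts with column 0, so that no path takes more than what the candidate has left.\<close>

definition TRACE :: com where
  "TRACE =
     Store ''pth'' (N 0) (N 0);;
     Assign ''t'' (N 0);;
     Assign ''mn'' (Arr ''x'' (N 0));;
     FOR ''l'' (N 1) (Add (V ''k'') (N 1))
       (FOR ''c'' (N 1) (V ''n'')
          (If (Conj (Conj (EQ (Arr ''ci'' (V ''c'')) (V ''i'')) (EQ (Arr ''cl'' (V ''c'')) (V ''l''))) (Conj (EQ (Arr ''cs'' (V ''c'')) (V ''t'')) (Less (N 0) (Arr ''x'' (V ''c'')))))
             (Assign ''f'' (V ''c''))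
             Skip);;
        Store ''pth'' (V ''l'') (V ''f'');;
        Store ''conf'' (Add (V ''pc'') (V ''l'')) (Arr ''cj'' (V ''f''));;
        If (Less (Arr ''x'' (V ''f'')) (V ''mn'')) (Assign ''mn'' (Arr ''x'' (V ''f''))) Skip;;
        Assign ''t'' (Arr ''ct'' (V ''f'')))"

definition PEEL :: com where
  "PEEL =
     FOR ''l'' (N 0) (Add (V ''k'') (N 1))
       (Store ''x'' (Arr ''pth'' (V ''l'')) (Sub (Arr ''x'' (Arr ''pth'' (V ''l''))) (V ''mn'')))"

definition EMIT :: com where
  "EMIT =
     Store ''cand'' (V ''count'') (V ''i'');;
     Store ''num'' (V ''count'') (V ''mn'');;
     Store ''den'' (V ''count'') (V ''D'');;
     Assign ''count'' (Add (V ''count'') (N 1));;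
     Assign ''pc'' (Add (V ''pc'') (V ''k''))"

text \<open>Column 0 is shared by all candidates. It is reset to the full value for each of them and
  then measures the flow of this candidate that is not yet decomposed.\<close>

definition DECODE :: com where
  "DECODE =
     Assign ''count'' (N 0);;
     Assign ''pc'' (N 0);;
     Assign ''D'' (Arr ''x'' (N 0));;
     FOR ''i'' (N 1) (Add (V ''m'') (N 1))
       (Store ''x'' (N 0) (V ''D'');;
        While (Less (N 0) (Arr ''x'' (N 0)))
          (TRACE;;
           PEEL;;
           EMIT))"

lemma wvars_TRACE [simp]: "wvars TRACE = {''t'', ''mn'', ''l'', ''c'', ''f''}"
  and warrs_TRACE [simp]: "warrs TRACE = {''pth'', ''conf''}"
  by (auto simp: TRACE_def)

lemma wvars_PEEL [simp]: "wvars PEEL = {''l''}" and warrs_PEEL [simp]: "warrs PEEL = {''x''}"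
  by (auto simp: PEEL_def)

lemma wvars_EMIT [simp]: "wvars EMIT = {''count'', ''pc''}" and warrs_EMIT [simp]: "warrs EMIT = {''cand'', ''num'', ''den''}"
  by (auto simp: EMIT_def)

lemma wvars_DECODE [simp]: "wvars DECODE = {''t'', ''mn'', ''l'', ''c'', ''f'', ''count'', ''pc'', ''D'', ''i''}"
  and warrs_DECODE [simp]: "warrs DECODE = {''pth'', ''conf'', ''x'', ''cand'', ''num'', ''den''}"
  by (auto simp: DECODE_def)

section \<open>Path decomposition\<close>

locale flow_solution = flow_lp +
  fixes x0 :: "nat \<Rightarrow> int"
  assumes flow0: "is_flow x0" and x0_nonneg: "\<And>c. c < n \<Longrightarrow> 0 \<le> x0 c" and x0_pos: "0 < x0 0"
begin

abbreviation X :: "state \<Rightarrow> nat \<Rightarrow> int" where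
  "X s c \<equiv> arr s ''x'' (int c)"

definition vpath :: "nat \<Rightarrow> (nat \<Rightarrow> nat) \<Rightarrow> nat \<Rightarrow> bool" where
  "vpath i p l \<longleftrightarrow> p 0 = 0 \<and> (\<forall>l'<l. 1 \<le> p (Suc l') \<and> p (Suc l') < n \<and> ci (p (Suc l')) = i \<and>
     cl (p (Suc l')) = Suc l' \<and> cs (p (Suc l')) = ct (p l'))"

lemma vpath_Suc: "vpath i p (Suc l) \<longleftrightarrow> vpath i p l \<and> 1 \<le> p (Suc l) \<and> p (Suc l) < n \<and> ci (p (Suc l)) = i \<and>
     cl (p (Suc l)) = Suc l \<and> cs (p (Suc l)) = ct (p l)"
  by (auto simp: vpath_def less_Suc_eq)

lemma vpath_upd: "l < l' \<Longrightarrow> vpath i (p(l' := c)) l \<longleftrightarrow> vpath i p l"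
  by (auto simp: vpath_def)

lemma vpath_cl: "vpath i p l \<Longrightarrow> l' \<le> l \<Longrightarrow> cl (p l') = l'"
  using zero by (cases l') (auto simp: vpath_def)

lemma vpath_in: "vpath i p l \<Longrightarrow> l' \<le> l \<Longrightarrow> p l' < n \<and> (p l' = 0 \<or> ci (p l') = i)"
  using n_ge1 by (cases l') (auto simp: vpath_def)

lemma column_bounds:
  assumes "1 \<le> c" "c < n" shows "1 \<le> ci c" "ci c \<le> m" "1 \<le> cl c" "cl c \<le> k" "cs c < S" "ct c < S" "cj c < m"
    "int (ct c) \<le> T - \<sigma> (ci c)"
  using column_allowed[OF assms] ct_eq[OF assms] by (auto simp: allowed_def)

lemma S_pos: "0 < S" by (simp add: S_def)

lemma Suc_k_le_b: "Suc k \<le> b"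
proof -
  have "k * 1 \<le> k * (m * S * m)" using m_pos S_pos by (intro mult_le_mono2) (simp add: Suc_le_eq)
  moreover have "m * k * S * m = k * (m * S * m)" by (simp add: mult_ac)
  ultimately show ?thesis using b_bound(4) by linarith
qed

lemma vpath_ct: "vpath i p l \<Longrightarrow> l' \<le> l \<Longrightarrow> ct (p l') < S"
  using zero S_pos column_bounds(6) by (cases l') (auto simp: vpath_def)

definition cons :: "nat \<Rightarrow> (nat \<Rightarrow> int) \<Rightarrow> bool" where
  "cons i x \<longleftrightarrow> (\<forall>l s. l < k \<longrightarrow> s < S \<longrightarrow> (\<Sum>c\<in>inset i l s. x c) = (\<Sum>c\<in>outset i l s. x c))"

text \<open>The last arc brings positive flow into its node, and no negative flow can cancel it; by
  conservation some outgoing arc is positive.\<close>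

lemma vpath_extend:
  assumes p: "vpath i p l" "l < k" "0 < x (p l)" and x: "\<And>c. c < n \<Longrightarrow> 0 \<le> x c" "cons i x"
  shows "\<exists>c. 1 \<le> c \<and> c < n \<and> ci c = i \<and> cl c = Suc l \<and> cs c = ct (p l) \<and> 0 < x c"
proof -
  have pin: "p l \<in> inset i l (ct (p l))"
    using vpath_in[OF p(1), of l] vpath_cl[OF p(1), of l] by (auto simp: inset_def)
  have "0 < x (p l)" by (rule p(3))
  also have "x (p l) \<le> (\<Sum>c\<in>inset i l (ct (p l)). x c)"
    by (rule member_le_sum) (use pin x in \<open>auto simp: inset_def\<close>)
  also have "\<dots> = (\<Sum>c\<in>outset i l (ct (p l)). x c)"
    using x(2) p(2) vpath_ct[OF p(1), of l] by (simp add: cons_def)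
  finally have "\<exists>c\<in>outset i l (ct (p l)). 0 < x c"
    by (meson linorder_not_le sum_nonpos)
  then obtain c where c: "c < n" "cl c = Suc l" "cs c = ct (p l)" "ci c = i" "0 < x c" by (auto simp: outset_def)
  moreover have "1 \<le> c" using c(2) zero by (cases c) auto
  ultimately show ?thesis by blast
qed

lemma wp_TRACE:
  assumes s: "inp s" "colarr s" "var s ''i'' = int i"
    and x: "\<And>c. c < n \<Longrightarrow> 0 \<le> X s c" "cons i (X s)" "0 < X s 0"
  shows "wp b TRACE (\<lambda>s'. \<exists>p. vpath i p k \<and> (\<forall>l\<le>k. arr s' ''pth'' (int l) = int (p l) \<and> var s' ''mn'' \<le> X s (p l) \<and> 0 < X s (p l)) \<and>
     (\<exists>l\<le>k. var s' ''mn'' = X s (p l)) \<and>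
     (\<forall>l. 1 \<le> l \<longrightarrow> l \<le> k \<longrightarrow> arr s' ''conf'' (var s ''pc'' + int l) = int (cj (p l))) \<and>
     (\<forall>z\<le>var s ''pc''. arr s' ''conf'' z = arr s ''conf'' z)) s"
proof -
  define J where "J h s' \<longleftrightarrow> (\<exists>p. vpath i p h \<and> var s' ''t'' = int (ct (p h)) \<and>
     (\<forall>l\<le>h. arr s' ''pth'' (int l) = int (p l) \<and> var s' ''mn'' \<le> X s (p l) \<and> 0 < X s (p l)) \<and>
     (\<exists>l\<le>h. var s' ''mn'' = X s (p l)) \<and>
     (\<forall>l. 1 \<le> l \<longrightarrow> l \<le> h \<longrightarrow> arr s' ''conf'' (var s ''pc'' + int l) = int (cj (p l))) \<and>
     (\<forall>z\<le>var s ''pc''. arr s' ''conf'' z = arr s ''conf'' z))" for h and s' :: state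
  show ?thesis unfolding TRACE_def
  proof (intro wp_Seq wp_Assign wp_Store, rule wp_FOR[where lo = 1 and hi = "Suc k" and I = "\<lambda>l. J (l - 1)"], goal_cases)
    case 6
    show ?case using x(3) zero by (auto simp: J_def vpath_def intro!: exI[of _ "\<lambda>_. 0"])
  next
    case (7 l1 s1)
    note fr = frameD[OF 7(1), simplified]
    obtain l where l: "l1 = Suc l" "l < k" using 7 by (cases l1) auto
    have c1: "colarr s1" by (rule colarr_frame[OF 7(1)]) (use s in \<open>auto simp: colarr_def\<close>)
    have xs: "arr s1 ''x'' = arr s ''x''" by (simp add: fr)
    have i1: "var s1 ''i'' = int i" "var s1 ''pc'' = var s ''pc''" using s by (simp_all add: fr)
    from 7(5) l obtain p where p: "vpath i p l" "var s1 ''t'' = int (ct (p l))"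
      "\<forall>h\<le>l. arr s1 ''pth'' (int h) = int (p h) \<and> var s1 ''mn'' \<le> X s (p h) \<and> 0 < X s (p h)"
      "\<exists>h\<le>l. var s1 ''mn'' = X s (p h)"
      "\<forall>h. 1 \<le> h \<longrightarrow> h \<le> l \<longrightarrow> arr s1 ''conf'' (var s ''pc'' + int h) = int (cj (p h))"
      "\<forall>z\<le>var s ''pc''. arr s1 ''conf'' z = arr s ''conf'' z" by (auto simp: J_def)
    define ok where "ok c \<longleftrightarrow> 1 \<le> c \<and> c < n \<and> ci c = i \<and> cl c = Suc l \<and> cs c = ct (p l) \<and> 0 < X s c" for c
    have ex: "\<exists>c. ok c" unfolding ok_def using vpath_extend[OF p(1) l(2) _ x(1,2)] p(3) by simp
    \<comment> \<open>The scan has no early exit: once an admissible arc has been passed,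
      \<open>f\<close> holds some admissible arc, not necessarily the first.\<close>
    show ?case
    proof (rule wp_Seq, rule wp_FOR[where lo = 1 and hi = n and
        I = "\<lambda>h s'. (\<exists>c<h. ok c) \<longrightarrow> (\<exists>c. var s' ''f'' = int c \<and> ok c)"], goal_cases)
      case 6
      show ?case by (auto simp: ok_def)
    next
      case (7 c s2)
      note fr2 = frameD[OF 7(1), simplified]
      have c2: "colarr s2" by (rule colarr_frame[OF 7(1) c1]) auto
      have [simp]: "int (cl c) = 1 + int l \<longleftrightarrow> cl c = Suc l" by linarith
      have "bval (Conj (Conj (EQ (Arr ''ci'' (V ''c'')) (V ''i'')) (EQ (Arr ''cl'' (V ''c'')) (V ''l'')))
              (Conj (EQ (Arr ''cs'' (V ''c'')) (V ''t'')) (Less (N 0) (Arr ''x'' (V ''c''))))) s2 \<longleftrightarrow> ok c"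
        using \<open>var s1 ''l'' = int l1\<close> 7(2-4) l(1) p(2) i1 c1 xs by (simp add: fr2 colarrD ok_def conj_assoc)
      then show ?case using 7(4,5) by (intro wp_If wp_Assign wp_Skip) (auto simp: less_Suc_eq)
    next
      case (8 s2)
      note fr2 = frameD[OF 8(1), simplified]
      have c2: "colarr s2" by (rule colarr_frame[OF 8(1) c1]) auto
      have "\<exists>c<n. ok c" using ex by (auto simp: ok_def)
      then obtain f where f: "var s2 ''f'' = int f" "ok f" using 8(3) by blast
      then have fn: "f < n" by (simp add: ok_def)
      define q where "q = p(Suc l := f)"
      have q: "vpath i q (Suc l)" "q (Suc l) = f" "\<And>h. h \<le> l \<Longrightarrow> q h = p h"
        using p(1) f(2) by (auto simp: q_def vpath_Suc vpath_upd ok_def)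
      have l2: "var s2 ''l'' = int (Suc l)" using \<open>var s1 ''l'' = int l1\<close> l by (simp add: fr2)
      define mn where "mn = min (var s1 ''mn'') (X s f)"
      have mn: "\<forall>h\<le>Suc l. mn \<le> X s (q h) \<and> 0 < X s (q h)"
        using p(3) f(2) q(2,3) by (auto simp: le_Suc_eq mn_def ok_def min_le_iff_disj)
      have mn2: "\<exists>h\<le>Suc l. mn = X s (q h)"
      proof (cases "X s f < var s1 ''mn''")
        case True
        then show ?thesis using q(2) by (intro exI[of _ "Suc l"]) (simp add: mn_def)
      next
        case False
        then show ?thesis using p(4) q(3) by (auto simp: mn_def intro: le_SucI)
      qed
      have fin: "J (Suc l) (setv ''l'' (1 + int l1) s3)"
        if "var s3 ''mn'' = mn" "var s3 ''t'' = int (ct f)"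
          "arr s3 ''pth'' = (arr s1 ''pth'')(int (Suc l) := int f)"
          "arr s3 ''conf'' = (arr s1 ''conf'')(var s ''pc'' + int (Suc l) := int (cj f))" for s3
        unfolding J_def
      proof (intro exI[of _ q] conjI)
        show "\<forall>h\<le>Suc l. arr (setv ''l'' (1 + int l1) s3) ''pth'' (int h) = int (q h) \<and>
            var (setv ''l'' (1 + int l1) s3) ''mn'' \<le> X s (q h) \<and> 0 < X s (q h)"
          using mn that(1,3) p(3) q(2,3) by (auto simp: le_Suc_eq)
        show "\<forall>h. 1 \<le> h \<longrightarrow> h \<le> Suc l \<longrightarrow> arr (setv ''l'' (1 + int l1) s3) ''conf'' (var s ''pc'' + int h) = int (cj (q h))"
          using that(4) p(5) q(2,3) by (auto simp: le_Suc_eq)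
        show "\<forall>z\<le>var s ''pc''. arr (setv ''l'' (1 + int l1) s3) ''conf'' z = arr s ''conf'' z"
          using that(4) p(6) by auto
      qed (use q mn2 that in auto)
      have ax: "var s2 ''pc'' = var s ''pc''" "arr s2 ''x'' = arr s ''x''" "var s2 ''mn'' = var s1 ''mn''"
        "arr s2 ''pth'' = arr s1 ''pth''" "arr s2 ''conf'' = arr s1 ''conf''"
        using i1 xs by (simp_all add: fr2)
      have l11: "l1 = Suc l" by (rule l(1))
      show ?case
        apply (intro wp_intros)
         apply (simp_all only: l11 diff_Suc_1)
         apply (rule fin[unfolded l11])
            apply (use f fn c2 l2 ax in \<open>simp_all add: colarrD mn_def\<close>)[4]
        apply (rule fin[unfolded l11])
           apply (use f fn c2 l2 ax in \<open>simp_all add: colarrD mn_def\<close>)[4]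
        done
    qed (use c1 n_ge1 n_le_b in \<open>auto simp: colarrD frameD\<close>)
  next
    case (8 s1)
    then show ?case by (auto simp: J_def)
  qed (use s b_bound in \<open>auto simp: inpD frameD\<close>)
qed

text \<open>The arcs of a path lie in different layers and are therefore distinct, so each of them
  is reduced exactly once.\<close>

lemma wp_PEEL:
  assumes s: "inp s" "\<And>l. l \<le> k \<Longrightarrow> arr s ''pth'' (int l) = int (p l)" and p: "vpath i p k"
  shows "wp b PEEL (\<lambda>s'. \<forall>c. X s' c = X s c - (if \<exists>l\<le>k. p l = c then var s ''mn'' else 0)) s"
  unfolding PEEL_def
proof (rule wp_FOR[where lo = 0 and hi = "Suc k" and
    I = "\<lambda>h s'. \<forall>c. X s' c = X s c - (if \<exists>l<h. p l = c then var s ''mn'' else 0)"], goal_cases)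
  case (7 h s')
  note fr = frameD[OF 7(1), simplified]
  have "p l \<noteq> p h" if "l < h" for l
    using vpath_cl[OF p, of l] vpath_cl[OF p, of h] that 7(3) by auto
  then have new: "\<not> (\<exists>l<h. p l = p h)" by blast
  have "var s' ''l'' = int h" "arr s' ''pth'' (int h) = int (p h)" "var s' ''mn'' = var s ''mn''"
    using 7(3,4) s(2)[of h] by (simp_all add: fr)
  then show ?case using 7(5) new by (intro wp_Store) (auto simp: less_Suc_eq)
next
  case (8 s')
  then show ?case by (simp add: less_Suc_eq_le)
qed (use s Suc_k_le_b in \<open>auto simp: inpD frameD\<close>)

text \<open>The sequences \<open>it\<close>, \<open>p\<close> and \<open>nm\<close> are ghosts for
  the candidates, paths and numerators emitted so far; emitted and remaining flow always add up to
  \<open>x0\<close>. A column \<open>c\<close> from 1 on can occur in a path only in its own layer,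
  hence the test \<open>p e (cl c) = c\<close>.\<close>

definition base :: "nat \<Rightarrow> nat \<Rightarrow> (nat \<Rightarrow> nat) \<Rightarrow> (nat \<Rightarrow> nat \<Rightarrow> nat) \<Rightarrow> (nat \<Rightarrow> int) \<Rightarrow> state \<Rightarrow> bool" where
  "base i cnt it p nm s \<longleftrightarrow> var s ''count'' = int cnt \<and> var s ''pc'' = int (cnt * k) \<and>
     (\<forall>e<cnt. arr s ''cand'' (int e) = int (it e) \<and> arr s ''num'' (int e) = nm e \<and> arr s ''den'' (int e) = x0 0 \<and>
        (\<forall>l. 1 \<le> l \<longrightarrow> l \<le> k \<longrightarrow> arr s ''conf'' (int (e * k + l)) = int (cj (p e l)))) \<and>
     (\<forall>e<cnt. 1 \<le> it e \<and> it e \<le> m \<and> vpath (it e) (p e) k \<and> 0 < nm e) \<and>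
     (\<forall>c. 1 \<le> c \<longrightarrow> c < n \<longrightarrow> 0 \<le> X s c \<and> X s c + (\<Sum>e<cnt. if p e (cl c) = c then nm e else 0) = x0 c) \<and>
     (\<forall>i'. 1 \<le> i' \<longrightarrow> i' < i \<longrightarrow> (\<Sum>e<cnt. if it e = i' then nm e else 0) = x0 0 \<and>
        (\<forall>c. 1 \<le> c \<longrightarrow> c < n \<longrightarrow> ci c = i' \<longrightarrow> X s c = 0)) \<and>
     (\<forall>e<cnt. \<forall>e'<e. it e' = it e \<longrightarrow> (\<exists>l. 1 \<le> l \<and> l \<le> k \<and> p e' l \<noteq> p e l))"

text \<open>The last conjunct makes the entries distinct: a peeled path keeps a saturated arc and is not
  traced again.\<close>

definition current :: "nat \<Rightarrow> nat \<Rightarrow> (nat \<Rightarrow> nat) \<Rightarrow> (nat \<Rightarrow> nat \<Rightarrow> nat) \<Rightarrow> (nat \<Rightarrow> int) \<Rightarrow> state \<Rightarrow> bool" where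
  "current i cnt it p nm s \<longleftrightarrow> (\<forall>e<cnt. it e \<le> i) \<and> 0 \<le> X s 0 \<and>
     X s 0 + (\<Sum>e<cnt. if it e = i then nm e else 0) = x0 0 \<and> cons i (X s) \<and>
     (\<forall>e<cnt. it e = i \<longrightarrow> (\<exists>l\<le>k. X s (p e l) = 0))"

text \<open>A path enters and leaves every node that it visits before the last layer, so subtracting
  it changes both sides of the conservation equation alike.\<close>

lemma cons_peel:
  assumes p: "vpath i p k" and x: "cons i x" and x': "\<And>c. x' c = x c - (if \<exists>l\<le>k. p l = c then d else 0)"
  shows "cons i x'"
  unfolding cons_def
proof (intro allI impI)
  fix l s assume l: "l < k" and s: "s < S"
  have sub: "(\<Sum>c\<in>Q. x' c) = (\<Sum>c\<in>Q. x c) - (if p h \<in> Q then d else 0)"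
    if "\<And>c. c \<in> Q \<Longrightarrow> cl c = h" "finite Q" "h \<le> k" for Q h
  proof -
    have "(\<Sum>c\<in>Q. x' c) = (\<Sum>c\<in>Q. x c - (if c = p h then d else 0))"
    proof (rule sum.cong[OF refl])
      fix c assume "c \<in> Q"
      then have "(\<exists>l\<le>k. p l = c) \<longleftrightarrow> c = p h" using that vpath_cl[OF p] by metis
      then show "x' c = x c - (if c = p h then d else 0)" by (simp add: x')
    qed
    also have "\<dots> = (\<Sum>c\<in>Q. x c) - (\<Sum>c\<in>Q. if c = p h then d else 0)" by (rule sum_subtractf)
    finally show ?thesis using that(2) by (simp add: sum.delta)
  qed
  have 1: "p l \<in> inset i l s \<longleftrightarrow> ct (p l) = s"
    using vpath_in[OF p, of l] vpath_cl[OF p, of l] l by (auto simp: inset_def)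
  have 2: "p (Suc l) \<in> outset i l s \<longleftrightarrow> cs (p (Suc l)) = s"
    using p l by (auto simp: outset_def vpath_def)
  have 3: "cs (p (Suc l)) = ct (p l)" using p l by (simp add: vpath_def)
  have "(\<Sum>c\<in>inset i l s. x' c) = (\<Sum>c\<in>inset i l s. x c) - (if p l \<in> inset i l s then d else 0)"
    using l by (intro sub) (auto simp: inset_def)
  moreover have "(\<Sum>c\<in>outset i l s. x' c) = (\<Sum>c\<in>outset i l s. x c) - (if p (Suc l) \<in> outset i l s then d else 0)"
    using l by (intro sub) (auto simp: outset_def)
  ultimately show "(\<Sum>c\<in>inset i l s. x' c) = (\<Sum>c\<in>outset i l s. x' c)"
    using x l s 1 2 3 by (simp add: cons_def)
qed

text \<open>By induction on the layers: without inflow, conservation and nonnegativity leave no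
  outflow. An exhausted column 0 thus certifies that the whole flow of the candidate has been
  emitted.\<close>

lemma cons_zero:
  assumes x: "cons i x" "x 0 = 0" "\<And>c. c < n \<Longrightarrow> 0 \<le> x c"
  shows "c < n \<Longrightarrow> c = 0 \<or> ci c = i \<Longrightarrow> x c = 0"
proof (induction "cl c" arbitrary: c)
  case 0
  then have "c = 0" using column_bounds(3)[of c] by (cases c) auto
  then show ?case using x(2) by simp
next
  case (Suc l)
  show ?case
  proof (cases "c = 0")
    case True
    then show ?thesis using x(2) by simp
  next
    case False
    then have b: "cs c < S" "l < k" "ci c = i" using column_bounds[of c] Suc by auto
    have "(\<Sum>c\<in>inset i l (cs c). x c) = 0"
      using Suc.hyps(1) by (intro sum.neutral) (auto simp: inset_def)
    then have "(\<Sum>c\<in>outset i l (cs c). x c) = 0" using x(1) b by (simp add: cons_def)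
    moreover have "\<forall>c\<in>outset i l (cs c). 0 \<le> x c" using x(3) by (auto simp: outset_def)
    ultimately have "\<forall>c'\<in>outset i l (cs c). x c' = 0" by (subst (asm) sum_nonneg_eq_0_iff) auto
    moreover have "c \<in> outset i l (cs c)" using Suc b by (auto simp: outset_def)
    ultimately show ?thesis by blast
  qed
qed

lemma wp_EMIT:
  "wp b EMIT (\<lambda>s'. var s' ''count'' = var s ''count'' + 1 \<and> var s' ''pc'' = var s ''pc'' + var s ''k'' \<and>
     arr s' ''cand'' = (arr s ''cand'')(var s ''count'' := var s ''i'') \<and>
     arr s' ''num'' = (arr s ''num'')(var s ''count'' := var s ''mn'') \<and>
     arr s' ''den'' = (arr s ''den'')(var s ''count'' := var s ''D'')) s"
  unfolding EMIT_def by (intro wp_intros) simp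

text \<open>Peeling empties the bottleneck arc and makes no arc positive. The count of positive
  columns therefore drops, which bounds the number of paths per candidate by
  \<open>n\<close>.\<close>

lemma peel_step:
  assumes base: "base i cnt it p nm s" and cur: "current i cnt it p nm s" and i: "1 \<le> i" "i \<le> m"
    and pos: "0 < X s 0" and q: "vpath i q k"
    and mn: "\<And>l. l \<le> k \<Longrightarrow> d \<le> X s (q l) \<and> 0 < X s (q l)" "\<exists>l\<le>k. d = X s (q l)"
    and x': "\<And>c. X s' c = X s c - (if \<exists>l\<le>k. q l = c then d else 0)"
    and counts: "var s' ''count'' = var s ''count'' + 1" "var s' ''pc'' = var s ''pc'' + int k"
      "arr s' ''cand'' = (arr s ''cand'')(var s ''count'' := int i)"
      "arr s' ''num'' = (arr s ''num'')(var s ''count'' := d)"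
      "arr s' ''den'' = (arr s ''den'')(var s ''count'' := x0 0)"
    and conf: "\<And>l. 1 \<le> l \<Longrightarrow> l \<le> k \<Longrightarrow> arr s' ''conf'' (var s ''pc'' + int l) = int (cj (q l))"
      "\<And>z. z \<le> var s ''pc'' \<Longrightarrow> arr s' ''conf'' z = arr s ''conf'' z"
  shows "base i (Suc cnt) (it(cnt := i)) (p(cnt := q)) (nm(cnt := d)) s'"
    "current i (Suc cnt) (it(cnt := i)) (p(cnt := q)) (nm(cnt := d)) s'"
    "card {c. c < n \<and> 0 < X s' c} < card {c. c < n \<and> 0 < X s c}"
proof -
  have b1: "var s ''count'' = int cnt" "var s ''pc'' = int (cnt * k)"
    and e1: "\<forall>e<cnt. arr s ''cand'' (int e) = int (it e) \<and> arr s ''num'' (int e) = nm e \<and> arr s ''den'' (int e) = x0 0 \<and>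
        (\<forall>l. 1 \<le> l \<longrightarrow> l \<le> k \<longrightarrow> arr s ''conf'' (int (e * k + l)) = int (cj (p e l)))"
    and e2: "\<forall>e<cnt. 1 \<le> it e \<and> it e \<le> m \<and> vpath (it e) (p e) k \<and> 0 < nm e"
    and e3: "\<forall>c. 1 \<le> c \<longrightarrow> c < n \<longrightarrow> 0 \<le> X s c \<and> X s c + (\<Sum>e<cnt. if p e (cl c) = c then nm e else 0) = x0 c"
    and e4: "\<forall>i'. 1 \<le> i' \<longrightarrow> i' < i \<longrightarrow> (\<Sum>e<cnt. if it e = i' then nm e else 0) = x0 0 \<and>
        (\<forall>c. 1 \<le> c \<longrightarrow> c < n \<longrightarrow> ci c = i' \<longrightarrow> X s c = 0)"
    and e5: "\<forall>e<cnt. \<forall>e'<e. it e' = it e \<longrightarrow> (\<exists>l. 1 \<le> l \<and> l \<le> k \<and> p e' l \<noteq> p e l)"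
    using base unfolding base_def by - (elim conjE, assumption)+
  have c1: "\<And>e. e < cnt \<Longrightarrow> it e \<le> i" and c2: "0 \<le> X s 0"
    and c3: "X s 0 + (\<Sum>e<cnt. if it e = i then nm e else 0) = x0 0" and c4: "cons i (X s)"
    and c5: "\<And>e. e < cnt \<Longrightarrow> it e = i \<Longrightarrow> \<exists>l\<le>k. X s (p e l) = 0"
    using cur by (simp_all add: current_def)
  have b2: "arr s ''cand'' (int e) = int (it e) \<and> arr s ''num'' (int e) = nm e \<and> arr s ''den'' (int e) = x0 0" if "e < cnt" for e
    using e1 that by simp
  have b3: "arr s ''conf'' (int (e * k + l)) = int (cj (p e l))" if "e < cnt" "1 \<le> l" "l \<le> k" for e l
    using e1 that by blast
  have b4: "1 \<le> it e \<and> it e \<le> m \<and> vpath (it e) (p e) k \<and> 0 < nm e" if "e < cnt" for e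
    using e2 that by blast
  have b5: "0 \<le> X s c \<and> X s c + (\<Sum>e<cnt. if p e (cl c) = c then nm e else 0) = x0 c" if "1 \<le> c" "c < n" for c
    using e3 that by blast
  have b6: "(\<Sum>e<cnt. if it e = i' then nm e else 0) = x0 0" if "1 \<le> i'" "i' < i" for i'
    using e4 that by blast
  have b7: "X s c = 0" if "1 \<le> i'" "i' < i" "1 \<le> c" "c < n" "ci c = i'" for i' c
    using e4 that by blast
  have b8: "\<exists>l. 1 \<le> l \<and> l \<le> k \<and> p e' l \<noteq> p e l" if "e < cnt" "e' < e" "it e' = it e" for e e'
    using e5 that by blast
  have d: "0 < d" using mn by auto
  have q0: "q 0 = 0" using q by (simp add: vpath_def)
  have ind: "(\<exists>l\<le>k. q l = c) \<longleftrightarrow> q (cl c) = c" if "1 \<le> c" "c < n" for c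
    using vpath_cl[OF q] column_bounds(4)[OF that] by metis
  have nonneg: "0 \<le> X s' c" if "c < n" for c
  proof -
    have "0 \<le> X s c" using b5[of c] c2 that by (cases c) auto
    then show ?thesis using mn(1) by (auto simp: x')
  qed
  have le: "X s' c \<le> X s c" for c using d by (simp add: x')
  have zero_stays: "X s' c = 0" if "X s c = 0" for c
    using mn(1) that by (force simp: x')
  \<comment> \<open>Entry \<open>e\<close> ends at index \<open>e * k + k\<close>, so all earlier
    entries lie at or below \<open>cnt * k\<close>, where writing has not yet begun.\<close>
  have conf_old: "arr s' ''conf'' (int (e * k + l)) = arr s ''conf'' (int (e * k + l))" if "e < cnt" "l \<le> k" for e l
  proof -
    have "Suc e * k \<le> cnt * k" using that by (intro mult_le_mono1) simp
    then have "e * k + l \<le> cnt * k" using that by simp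
    then show ?thesis by (intro conf(2)) (simp only: b1 of_nat_le_iff)
  qed
  have conf_new: "arr s' ''conf'' (int (cnt * k + l)) = int (cj (q l))" if "1 \<le> l" "l \<le> k" for l
    using conf(1)[OF that] b1 by simp
  have sums: "(\<Sum>e<Suc cnt. if P ((p(cnt := q)) e) ((it(cnt := i)) e) then (nm(cnt := d)) e else 0)
      = (\<Sum>e<cnt. if P (p e) (it e) then nm e else 0) + (if P q i then d else 0)" for P
  proof -
    have "(\<Sum>e<cnt. if P ((p(cnt := q)) e) ((it(cnt := i)) e) then (nm(cnt := d)) e else 0)
        = (\<Sum>e<cnt. if P (p e) (it e) then nm e else 0)" by (rule sum.cong) auto
    then show ?thesis unfolding sum.lessThan_Suc by simp
  qed
  show "base i (Suc cnt) (it(cnt := i)) (p(cnt := q)) (nm(cnt := d)) s'"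
    unfolding base_def
  proof (intro conjI allI impI)
    fix e assume e: "e < Suc cnt"
    show "arr s' ''cand'' (int e) = int ((it(cnt := i)) e)" "arr s' ''num'' (int e) = (nm(cnt := d)) e" "arr s' ''den'' (int e) = x0 0"
      using e b2 b1 by (auto simp: counts less_Suc_eq)
    show "arr s' ''conf'' (int (e * k + l)) = int (cj ((p(cnt := q)) e l))" if "1 \<le> l" "l \<le> k" for l
      using e that conf_old[of e l] conf_new b3 by (cases "e = cnt") auto
    show "1 \<le> (it(cnt := i)) e" "(it(cnt := i)) e \<le> m" "vpath ((it(cnt := i)) e) ((p(cnt := q)) e) k" "0 < (nm(cnt := d)) e"
      using e b4 i q d by (auto simp: less_Suc_eq)
  next
    fix c assume c: "1 \<le> c" "c < n"
    show "0 \<le> X s' c" using nonneg c by simp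
    show "X s' c + (\<Sum>e<Suc cnt. if (p(cnt := q)) e (cl c) = c then (nm(cnt := d)) e else 0) = x0 c"
      using sums[of "\<lambda>p _. p (cl c) = c"] b5[OF c] ind[OF c] by (simp add: x')
  next
    fix i' assume i': "1 \<le> i'" "i' < i"
    show "(\<Sum>e<Suc cnt. if (it(cnt := i)) e = i' then (nm(cnt := d)) e else 0) = x0 0"
      using sums[of "\<lambda>_ i. i = i'"] b6[OF i'] i' by simp
    show "X s' c = 0" if "1 \<le> c" "c < n" "ci c = i'" for c
      using zero_stays b7[OF i' that] by simp
  next
    fix e e' assume e: "e < Suc cnt" "e' < e" and it: "(it(cnt := i)) e' = (it(cnt := i)) e"
    show "\<exists>l. 1 \<le> l \<and> l \<le> k \<and> (p(cnt := q)) e' l \<noteq> (p(cnt := q)) e l"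
    proof (cases "e = cnt")
      case False
      then show ?thesis using b8[of e e'] e it by auto
    next
      case True
      then have e': "e' < cnt" "it e' = i" using e it by (auto split: if_splits)
      then obtain l where l: "l \<le> k" "X s (p e' l) = 0" using c5 by blast
      have "p e' 0 = 0" using b4[OF e'(1)] by (simp add: vpath_def)
      then have "l \<noteq> 0" using l pos by (metis less_irrefl of_nat_0)
      moreover have "p e' l \<noteq> q l" using mn(1)[OF l(1)] l(2) by (metis less_irrefl)
      ultimately show ?thesis using l True e' by (intro exI[of _ l]) auto
    qed
  qed (use b1 counts in auto)
  show "current i (Suc cnt) (it(cnt := i)) (p(cnt := q)) (nm(cnt := d)) s'"
    unfolding current_def
  proof (intro conjI allI impI)
    show "0 \<le> X s' 0" using nonneg[of 0] n_ge1 by simp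
    have "\<exists>l\<le>k. q l = 0" using q0 by blast
    then have "X s' 0 = X s 0 - d" using x'[of 0] by simp
    then show "X s' 0 + (\<Sum>e<Suc cnt. if (it(cnt := i)) e = i then (nm(cnt := d)) e else 0) = x0 0"
      using sums[of "\<lambda>_ i'. i' = i"] c3 by simp
    show "cons i (X s')" by (rule cons_peel[OF q c4 x'])
  next
    fix e assume e: "e < Suc cnt"
    show "(it(cnt := i)) e \<le> i" using e c1 by (auto simp: less_Suc_eq)
    assume it: "(it(cnt := i)) e = i"
    show "\<exists>l\<le>k. X s' ((p(cnt := q)) e l) = 0"
    proof (cases "e = cnt")
      case True
      obtain l where l: "l \<le> k" "d = X s (q l)" using mn(2) by blast
      then have "X s' (q l) = 0" using x'[of "q l"] by auto
      then show ?thesis using True l by auto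
    next
      case False
      then show ?thesis using c5[of e] e it zero_stays by auto
    qed
  qed
  show "card {c. c < n \<and> 0 < X s' c} < card {c. c < n \<and> 0 < X s c}"
  proof (rule psubset_card_mono)
    obtain l where l: "l \<le> k" "d = X s (q l)" using mn(2) by blast
    have "q l \<in> {c. c < n \<and> 0 < X s c}" using vpath_in[OF q l(1)] mn(1)[OF l(1)] by simp
    moreover have "q l \<notin> {c. c < n \<and> 0 < X s' c}" using x'[of "q l"] l by auto
    moreover have "{c. c < n \<and> 0 < X s' c} \<subseteq> {c. c < n \<and> 0 < X s c}" using le by (auto intro: less_le_trans)
    ultimately show "{c. c < n \<and> 0 < X s' c} \<subset> {c. c < n \<and> 0 < X s c}" by blast
  qed auto
qed

lemma base_transfer:
  assumes "base i cnt it p nm s" "var s' ''count'' = var s ''count''" "var s' ''pc'' = var s ''pc''"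
    "\<And>a. a \<in> {''cand'', ''num'', ''den'', ''conf''} \<Longrightarrow> arr s' a = arr s a"
    "\<And>c. 1 \<le> c \<Longrightarrow> X s' c = X s c"
  shows "base i cnt it p nm s'"
  using assms by (simp add: base_def)

lemma wp_candidate:
  assumes s: "inp s" "colarr s" "var s ''i'' = int i" "var s ''D'' = x0 0" and i: "1 \<le> i" "i \<le> m"
    and start: "base i cnt it p nm s" "\<And>e. e < cnt \<Longrightarrow> it e < i" "X s 0 = x0 0"
  shows "wp b (While (Less (N 0) (Arr ''x'' (N 0))) (Seq TRACE (Seq PEEL EMIT)))
    (\<lambda>s'. \<exists>cnt it p nm. base (Suc i) cnt it p nm s' \<and> (\<forall>e<cnt. it e < Suc i)) s"
proof (rule wp_While[where I = "\<lambda>s'. \<exists>cnt it p nm. base i cnt it p nm s' \<and> current i cnt it p nm s'" and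
    \<mu> = "\<lambda>s. card {c. c < n \<and> 0 < X s c}"], goal_cases)
  case 1
  \<comment> \<open>All earlier paths belong to other candidates, so the arcs of candidate
    \<open>i\<close> still carry their original flow.\<close>
  have "cons i (X s)"
    unfolding cons_def
  proof (intro allI impI)
    fix l s0 assume l: "l < k" "s0 < S"
    have eq: "X s c = x0 c" if c: "c < n" "c = 0 \<or> ci c = i" for c
    proof (cases "c = 0")
      case True
      then show ?thesis using start(3) by simp
    next
      case False
      have no: "p e (cl c) \<noteq> c" if "e < cnt" for e
      proof
        assume pc: "p e (cl c) = c"
        have "vpath (it e) (p e) k" using start(1) that by (simp add: base_def)
        moreover have "cl c \<le> k" using column_bounds(4)[of c] False c by auto
        ultimately have "ci c = it e" using vpath_in[of "it e" "p e" k "cl c"] pc False by auto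
        then show False using start(2)[OF that] c False by auto
      qed
      have "(\<Sum>e<cnt. if p e (cl c) = c then nm e else 0) = 0" using no by (intro sum.neutral) auto
      moreover have "X s c + (\<Sum>e<cnt. if p e (cl c) = c then nm e else 0) = x0 c"
      proof -
        have "1 \<le> c" using False by simp
        then show ?thesis using start(1) c(1) unfolding base_def by blast
      qed
      ultimately show ?thesis by simp
    qed
    have "(\<Sum>c\<in>inset i l s0. X s c) = (\<Sum>c\<in>inset i l s0. x0 c)" "(\<Sum>c\<in>outset i l s0. X s c) = (\<Sum>c\<in>outset i l s0. x0 c)"
      by (intro sum.cong refl eq; auto simp: inset_def outset_def)+
    then show "(\<Sum>c\<in>inset i l s0. X s c) = (\<Sum>c\<in>outset i l s0. X s c)"
      using flow0 i l by (simp add: is_flow_def)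
  qed
  moreover have "(\<Sum>e<cnt. if it e = i then nm e else 0) = 0" using start(2) by (intro sum.neutral) auto
  ultimately have "current i cnt it p nm s"
    using start x0_pos by (auto simp: current_def dest: less_imp_le)
  then show ?case using start(1) by blast
next
  case 2
  have "card {c. c < n \<and> 0 < X s c} \<le> card {..<n}" by (intro card_mono) auto
  then show ?case using n_le_b by simp
next
  case (3 s')
  note fr = frameD[OF 3(1), simplified]
  have pos: "0 < X s' 0" using 3(3) by simp
  have i': "inp s'" by (rule inp_frame[OF 3(1) s(1)]) auto
  have c': "colarr s'" by (rule colarr_frame[OF 3(1) s(2)]) auto
  have v': "var s' ''i'' = int i" "var s' ''D'' = x0 0" "var s' ''k'' = int k"
    using s by (auto simp: fr inpD)
  from 3(2) obtain cnt it p nm where b: "base i cnt it p nm s'" and cu: "current i cnt it p nm s'" by blast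
  have nn: "0 \<le> X s' c" if "c < n" for c
    using b cu that by (cases c) (auto simp: base_def current_def)
  have cons': "cons i (X s')" using cu by (simp add: current_def)
  show ?case
  proof (rule wp_Seq, rule wp_conseq[OF wp_TRACE[OF i' c' v'(1) nn cons' pos]], goal_cases)
    case (2 s1)
    note fr1 = frameD[OF 2(1), simplified]
    from 2(2) obtain q where q: "vpath i q k"
      and q1: "\<And>l. l \<le> k \<Longrightarrow> arr s1 ''pth'' (int l) = int (q l) \<and> var s1 ''mn'' \<le> X s' (q l) \<and> 0 < X s' (q l)"
      and q2: "\<exists>l\<le>k. var s1 ''mn'' = X s' (q l)"
      and q3: "\<And>l. 1 \<le> l \<Longrightarrow> l \<le> k \<Longrightarrow> arr s1 ''conf'' (var s' ''pc'' + int l) = int (cj (q l))"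
      and q4: "\<And>z. z \<le> var s' ''pc'' \<Longrightarrow> arr s1 ''conf'' z = arr s' ''conf'' z" by blast
    have i1: "inp s1" by (rule inp_frame[OF 2(1) i']) auto
    show ?case
    proof (rule wp_Seq, rule wp_conseq[OF wp_PEEL[OF i1 _ q]], goal_cases)
      case (1 l)
      then show ?case using q1 by simp
    next
      case (2 s2)
      note fr2 = frameD[OF 2(1), simplified]
      show ?case
      proof (rule wp_conseq[OF wp_EMIT], goal_cases)
        case (1 s3)
        note fr3 = frameD[OF 1(1), simplified]
        note st = peel_step[OF b cu i pos q, of "var s1 ''mn''" s3]
        have x3: "X s3 c = X s' c - (if \<exists>l\<le>k. q l = c then var s1 ''mn'' else 0)" for c
          using 2(2) by (simp add: fr1 fr3)
        have e3: "var s3 ''count'' = var s' ''count'' + 1" "var s3 ''pc'' = var s' ''pc'' + int k"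
          "arr s3 ''cand'' = (arr s' ''cand'')(var s' ''count'' := int i)"
          "arr s3 ''num'' = (arr s' ''num'')(var s' ''count'' := var s1 ''mn'')"
          "arr s3 ''den'' = (arr s' ''den'')(var s' ''count'' := x0 0)"
          "arr s3 ''conf'' = arr s1 ''conf''"
          using 1(2) v' by (simp_all add: fr1 fr2 fr3)
        have m1: "\<And>l. l \<le> k \<Longrightarrow> var s1 ''mn'' \<le> X s' (q l) \<and> 0 < X s' (q l)" using q1 by blast
        have m3: "\<And>l. 1 \<le> l \<Longrightarrow> l \<le> k \<Longrightarrow> arr s3 ''conf'' (var s' ''pc'' + int l) = int (cj (q l))"
          "\<And>z. z \<le> var s' ''pc'' \<Longrightarrow> arr s3 ''conf'' z = arr s' ''conf'' z"
          using q3 q4 unfolding e3(6) by blast+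
        note st = st[OF m1 q2 x3 e3(1-5) m3]
        show ?case using st by blast
      qed
    qed
  qed
next
  case (4 s')
  then obtain cnt it p nm where b: "base i cnt it p nm s'" and cu: "current i cnt it p nm s'" by blast
  have z: "X s' 0 = 0" using 4(3) cu by (simp add: current_def)
  have nn: "0 \<le> X s' c" if "c < n" for c
    using b cu that by (cases c) (auto simp: base_def current_def)
  have "X s' c = 0" if "c < n" "ci c = i" for c
    using cons_zero[of i "X s'" c] cu z nn that by (simp add: current_def)
  moreover have "(\<Sum>e<cnt. if it e = i then nm e else 0) = x0 0" using cu z by (simp add: current_def)
  ultimately have "base (Suc i) cnt it p nm s'" using b unfolding base_def by (simp add: less_Suc_eq)
  moreover have "\<forall>e<cnt. it e < Suc i" using cu by (simp add: current_def less_Suc_eq_le)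
  ultimately show ?case by blast
qed

lemma base_start:
  assumes "var s ''count'' = 0" "var s ''pc'' = 0" "\<And>c. c < n \<Longrightarrow> X s c = x0 c"
  shows "base 1 0 it p nm s"
  using assms x0_nonneg by (simp add: base_def)

lemma wp_DECODE:
  assumes s: "inp s" "colarr s" and x: "\<And>c. c < n \<Longrightarrow> X s c = x0 c"
  shows "wp b DECODE (\<lambda>s'. \<exists>cnt it p nm. base (Suc m) cnt it p nm s') s"
  unfolding DECODE_def
proof (intro wp_Seq wp_Assign, rule wp_FOR[where lo = 1 and hi = "Suc m" and
    I = "\<lambda>i s'. \<exists>cnt it p nm. base i cnt it p nm s' \<and> (\<forall>e<cnt. it e < i)"], goal_cases)
  case 6
  show ?case
    apply (rule exI[of _ 0], rule exI[of _ "\<lambda>_. 0"], rule exI[of _ "\<lambda>_ _. 0"], rule exI[of _ "\<lambda>_. 0"])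
    apply (rule conjI, rule base_start)
    using x by simp_all
next
  case (7 i s')
  note fr = frameD[OF 7(1), simplified]
  have i': "inp s'" by (rule inp_frame[OF 7(1)]) (use s in auto)
  have c': "colarr s'" by (rule colarr_frame[OF 7(1)]) (use s in \<open>auto simp: colarr_def\<close>)
  have D: "var s' ''D'' = x0 0" using x[of 0] n_ge1 by (simp add: fr)
  from 7(5) obtain cnt it p nm where b: "base i cnt it p nm s'" and it: "\<forall>e<cnt. it e < i" by blast
  define s2 where "s2 = seta ''x'' 0 (x0 0) s'"
  have s2: "inp s2" "colarr s2" "var s2 ''i'' = int i" "var s2 ''D'' = x0 0"
    using i' c' 7(4) D by (simp_all add: s2_def inp_def colarr_def)
  have b2: "base i cnt it p nm s2" by (rule base_transfer[OF b]) (auto simp: s2_def)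
  have "wp b (While (Less (N 0) (Arr ''x'' (N 0))) (Seq TRACE (Seq PEEL EMIT)))
    (\<lambda>s'. \<exists>cnt it p nm. base (Suc i) cnt it p nm s' \<and> (\<forall>e<cnt. it e < Suc i)) s2"
    by (rule wp_candidate[OF s2 _ _ b2]) (use 7 it in \<open>auto simp: s2_def\<close>)
  then have "wp b (While (Less (N 0) (Arr ''x'' (N 0))) (Seq TRACE (Seq PEEL EMIT)))
    (\<lambda>s''. \<exists>cnt it p nm. base (Suc i) cnt it p nm (setv ''i'' (1 + int i) s'') \<and> (\<forall>e<cnt. it e < Suc i)) s2"
  proof (rule wp_conseq)
    fix s'' assume "\<exists>cnt it p nm. base (Suc i) cnt it p nm s'' \<and> (\<forall>e<cnt. it e < Suc i)"
    then obtain cnt it p nm where *: "base (Suc i) cnt it p nm s''" "\<forall>e<cnt. it e < Suc i" by blast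
    have "base (Suc i) cnt it p nm (setv ''i'' (1 + int i) s'')" by (rule base_transfer[OF *(1)]) simp_all
    then show "\<exists>cnt it p nm. base (Suc i) cnt it p nm (setv ''i'' (1 + int i) s'') \<and> (\<forall>e<cnt. it e < Suc i)"
      using *(2) by blast
  qed
  then show ?case using D by (intro wp_Seq wp_Store) (simp add: s2_def)
next
  case (8 s')
  then show ?case by blast
qed (use s b_bound in \<open>auto simp: inpD frameD\<close>)

end

section \<open>Emitted paths as a solution of the configuration LP\<close>

context flow_solution
begin

definition conf_of :: "(nat \<Rightarrow> nat) \<Rightarrow> nat \<Rightarrow> nat" where
  "conf_of p = restrict (\<lambda>l. cj (p l)) {1..k}"

lemma pre_conf_of: "vpath i p k \<Longrightarrow> l \<le> k \<Longrightarrow> pre (conf_of p) l = ct (p l)"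
proof (induction l)
  case 0
  then show ?case using zero by (simp add: vpath_def)
next
  case (Suc l)
  then have p: "1 \<le> p (Suc l)" "p (Suc l) < n" "cl (p (Suc l)) = Suc l" "cs (p (Suc l)) = ct (p l)"
    by (auto simp: vpath_def)
  have "ct (p (Suc l)) = ct (p l) + w (Suc l) * \<alpha> (cj (p (Suc l)))" using ct_eq[OF p(1,2)] p(3,4) by simp
  then show ?case using Suc by (simp add: conf_of_def)
qed

lemma conf_of_in:
  assumes p: "vpath i p k" shows "conf_of p \<in> configs I T i"
proof -
  obtain k' where k': "k = Suc k'" using k_pos by (cases k) auto
  have pk: "1 \<le> p (Suc l)" "p (Suc l) < n" "ci (p (Suc l)) = i" if "l < k" for l
    using p that by (auto simp: vpath_def)
  have "cj (p l) < m" if "1 \<le> l" "l \<le> k" for l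
    using that pk[of "l - 1"] column_bounds(7)[of "p l"] by (cases l) auto
  then have "conf_of p \<in> {1..k} \<rightarrow>\<^sub>E {..<m}" by (auto simp: conf_of_def)
  moreover have "int (pre (conf_of p) k) \<le> T - \<sigma> i"
    using pre_conf_of[OF p, of k] column_bounds(8)[of "p k"] pk[of k'] k' by simp
  ultimately show ?thesis by (simp add: configs_iff)
qed

text \<open>Both paths start alike, and a node together with the next score number determines the
  next arc. So distinct paths of one candidate are distinct list entries with different
  configurations.\<close>

lemma conf_of_inj:
  assumes p: "vpath i p k" "vpath i p' k" and eq: "conf_of p = conf_of p'" and l: "l \<le> k"
  shows "p l = p' l"
  using l
proof (induction l)
  case 0
  then show ?case using p by (simp add: vpath_def)
next
  case (Suc l)
  then have a: "1 \<le> p (Suc l)" "p (Suc l) < n" "ci (p (Suc l)) = i" "cl (p (Suc l)) = Suc l" "cs (p (Suc l)) = ct (p l)"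
    and a': "1 \<le> p' (Suc l)" "p' (Suc l) < n" "ci (p' (Suc l)) = i" "cl (p' (Suc l)) = Suc l" "cs (p' (Suc l)) = ct (p' l)"
    using p by (auto simp: vpath_def)
  have "cj (p (Suc l)) = cj (p' (Suc l))"
    using fun_cong[OF eq, of "Suc l"] Suc.prems by (simp add: conf_of_def)
  show ?case by (rule column_eq) (use a a' Suc \<open>cj (p (Suc l)) = cj (p' (Suc l))\<close> in simp_all)
qed

lemma decoded_solution:
  assumes base: "base (Suc m) cnt it p nm s"
  shows "\<exists>y. lp_feasible I T y \<and> lists_solution I T s y"
proof -
  have cnt: "var s ''count'' = int cnt"
    and e1: "\<forall>e<cnt. arr s ''cand'' (int e) = int (it e) \<and> arr s ''num'' (int e) = nm e \<and> arr s ''den'' (int e) = x0 0 \<and>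
        (\<forall>l. 1 \<le> l \<longrightarrow> l \<le> k \<longrightarrow> arr s ''conf'' (int (e * k + l)) = int (cj (p e l)))"
    and e2: "\<forall>e<cnt. 1 \<le> it e \<and> it e \<le> m \<and> vpath (it e) (p e) k \<and> 0 < nm e"
    and e3: "\<forall>c. 1 \<le> c \<longrightarrow> c < n \<longrightarrow> 0 \<le> X s c \<and> X s c + (\<Sum>e<cnt. if p e (cl c) = c then nm e else 0) = x0 c"
    and e4: "\<forall>i'. 1 \<le> i' \<longrightarrow> i' < Suc m \<longrightarrow> (\<Sum>e<cnt. if it e = i' then nm e else 0) = x0 0 \<and>
        (\<forall>c. 1 \<le> c \<longrightarrow> c < n \<longrightarrow> ci c = i' \<longrightarrow> X s c = 0)"
    and e5: "\<forall>e<cnt. \<forall>e'<e. it e' = it e \<longrightarrow> (\<exists>l. 1 \<le> l \<and> l \<le> k \<and> p e' l \<noteq> p e l)"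
    using base unfolding base_def by - (elim conjE, assumption)+
  have it: "1 \<le> it e" "it e \<le> m" "vpath (it e) (p e) k" "0 < nm e" if "e < cnt" for e
    using e2 that by blast+
  define D where "D = x0 0"
  have D: "0 < D" using x0_pos by (simp add: D_def)
  define C where "C e = conf_of (p e)" for e
  have C: "C e \<in> configs I T (it e)" if "e < cnt" for e
    unfolding C_def by (rule conf_of_in[OF it(3)[OF that]])
  have distinct: "e = e'" if "e < cnt" "e' < cnt" "it e = it e'" "C e = C e'" for e e'
  proof -
    have vp: "vpath (it e) (p e) k" "vpath (it e) (p e') k"
      using it(3)[OF that(1)] it(3)[OF that(2)] that(3) by simp_all
    have "p e l = p e' l" if "l \<le> k" for l
      using conf_of_inj[OF vp _ that] \<open>C e = C e'\<close> by (simp add: C_def)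
    then show ?thesis using e5 that(1-3) by (metis linorder_neqE_nat)
  qed
  \<comment> \<open>As a sum over the entries, \<open>y\<close> allows summations to be exchanged.
    By \<open>distinct\<close>, at most one entry contributes to each value, so that the listed
    quotient is the value itself.\<close>
  define y where "y i K = (\<Sum>e<cnt. if it e = i \<and> C e = K then real_of_int (nm e) / real_of_int D else 0)" for i K
  have y_nonneg: "0 \<le> y i K" for i K
    unfolding y_def using it(4) D by (intro sum_nonneg) (auto intro: less_imp_le)
  have sum_y: "(\<Sum>K\<in>configs I T i. if P K then y i K else 0)
      = (\<Sum>e<cnt. if it e = i \<and> P (C e) then real_of_int (nm e) / real_of_int D else 0)" for i P
  proof -
    have "(\<Sum>K\<in>configs I T i. if P K then y i K else 0)
        = (\<Sum>K\<in>configs I T i. \<Sum>e<cnt. if C e = K then (if it e = i \<and> P K then real_of_int (nm e) / real_of_int D else 0) else 0)"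
    proof (rule sum.cong[OF refl])
      fix K
      show "(if P K then y i K else 0)
          = (\<Sum>e<cnt. if C e = K then (if it e = i \<and> P K then real_of_int (nm e) / real_of_int D else 0) else 0)"
      proof (cases "P K")
        case True
        then show ?thesis unfolding y_def by (auto intro!: sum.cong)
      next
        case False
        then show ?thesis by (simp cong: if_cong)
      qed
    qed
    also have "\<dots> = (\<Sum>e<cnt. \<Sum>K\<in>configs I T i. if C e = K then (if it e = i \<and> P K then real_of_int (nm e) / real_of_int D else 0) else 0)"
      by (rule sum.swap)
    also have "\<dots> = (\<Sum>e<cnt. if it e = i \<and> P (C e) then real_of_int (nm e) / real_of_int D else 0)"
    proof (rule sum.cong[OF refl])
      fix e assume "e \<in> {..<cnt}"
      then show "(\<Sum>K\<in>configs I T i. if C e = K then (if it e = i \<and> P K then real_of_int (nm e) / real_of_int D else 0) else 0)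
          = (if it e = i \<and> P (C e) then real_of_int (nm e) / real_of_int D else 0)"
        using C[of e] by (auto simp: sum.delta')
    qed
    finally show ?thesis .
  qed
  have srows: "(\<Sum>K\<in>configs I T i. y i K) = 1" if i: "1 \<le> i" "i \<le> m" for i
  proof -
    have "(\<Sum>K\<in>configs I T i. y i K) = (\<Sum>e<cnt. if it e = i then real_of_int (nm e) / real_of_int D else 0)"
      using sum_y[of "\<lambda>_. True" i] by simp
    also have "\<dots> = (\<Sum>e<cnt. real_of_int (if it e = i then nm e else 0) / real_of_int D)"
      by (intro sum.cong refl) simp
    also have "\<dots> = real_of_int (\<Sum>e<cnt. if it e = i then nm e else 0) / real_of_int D"
      by (simp add: sum_divide_distrib)
    also have "(\<Sum>e<cnt. if it e = i then nm e else 0) = D" using e4 i by (simp add: D_def)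
    finally show ?thesis using D by simp
  qed
  have cover: "(\<Sum>i=1..m. \<Sum>K\<in>{K \<in> configs I T i. K l = j}. y i K) = 1" if l: "1 \<le> l" "l \<le> k" and j: "j < m" for l j
  proof -
    have "(\<Sum>i=1..m. \<Sum>K\<in>{K \<in> configs I T i. K l = j}. y i K)
        = (\<Sum>i=1..m. \<Sum>K\<in>configs I T i. if K l = j then y i K else 0)"
      by (rule sum.cong[OF refl]) (simp add: sum.inter_filter)
    also have "\<dots> = (\<Sum>i=1..m. \<Sum>e<cnt. if it e = i \<and> C e l = j then real_of_int (nm e) / real_of_int D else 0)"
      using sum_y[of "\<lambda>K. K l = j"] by simp
    also have "\<dots> = (\<Sum>e<cnt. \<Sum>i=1..m. if it e = i \<and> C e l = j then real_of_int (nm e) / real_of_int D else 0)"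
      by (rule sum.swap)
    also have "\<dots> = (\<Sum>e<cnt. real_of_int (if C e l = j then nm e else 0) / real_of_int D)"
    proof (rule sum.cong[OF refl])
      fix e assume "e \<in> {..<cnt}"
      then have "it e \<in> {1..m}" using it by simp
      moreover have "(\<Sum>i=1..m. if it e = i \<and> C e l = j then real_of_int (nm e) / real_of_int D else 0)
          = (\<Sum>i=1..m. if it e = i then real_of_int (if C e l = j then nm e else 0) / real_of_int D else 0)"
        by (intro sum.cong refl) simp
      ultimately show "(\<Sum>i=1..m. if it e = i \<and> C e l = j then real_of_int (nm e) / real_of_int D else 0)
          = real_of_int (if C e l = j then nm e else 0) / real_of_int D" by (simp add: sum.delta')
    qed
    also have "\<dots> = real_of_int (\<Sum>e<cnt. if C e l = j then nm e else 0) / real_of_int D"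
      by (simp add: sum_divide_distrib)
    \<comment> \<open>No flow is left on any arc, so the covering equation of \<open>x0\<close>
      carries over to the emitted paths.\<close>
    also have "(\<Sum>e<cnt. if C e l = j then nm e else 0) = D"
    proof -
      have "D = (\<Sum>c\<in>covset l j. x0 c)" using flow0 l j by (simp add: is_flow_def D_def)
      also have "\<dots> = (\<Sum>c\<in>covset l j. \<Sum>e<cnt. if p e l = c then nm e else 0)"
      proof (rule sum.cong[OF refl])
        fix c assume c: "c \<in> covset l j"
        then have b: "1 \<le> c" "c < n" "cl c = l" by (auto simp: covset_def)
        have "X s c = 0" using e4 column_bounds(1,2)[OF b(1,2)] b by auto
        then show "x0 c = (\<Sum>e<cnt. if p e l = c then nm e else 0)" using e3 b by force
      qed
      also have "\<dots> = (\<Sum>e<cnt. \<Sum>c\<in>covset l j. if p e l = c then nm e else 0)" by (rule sum.swap)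
      also have "\<dots> = (\<Sum>e<cnt. if C e l = j then nm e else 0)"
      proof (rule sum.cong[OF refl])
        fix e assume "e \<in> {..<cnt}"
        then have v: "vpath (it e) (p e) k" using it by simp
        obtain l' where l': "l = Suc l'" using l by (cases l) auto
        have "p e l \<in> covset l j \<longleftrightarrow> C e l = j"
          using v l l' by (auto simp: covset_def vpath_def C_def conf_of_def)
        then show "(\<Sum>c\<in>covset l j. if p e l = c then nm e else 0) = (if C e l = j then nm e else 0)"
          by (simp add: sum.delta')
      qed
      finally show ?thesis by simp
    qed
    finally show ?thesis using D by simp
  qed
  have "lp_feasible I T y"
    unfolding lp_feasible_def using y_nonneg srows cover by (auto simp: m_def k_def lp_vars_def)
  moreover have entry: "entry_at k s e (it e) (C e)" if "e < cnt" for e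
    unfolding entry_at_def using e1 that by (auto simp: C_def conf_of_def)
  have val: "y (it e) (C e) = real_of_int (nm e) / real_of_int D" if "e < cnt" for e
  proof -
    have "y (it e) (C e) = (\<Sum>e'<cnt. if e = e' then real_of_int (nm e') / real_of_int D else 0)"
      unfolding y_def using distinct that by (intro sum.cong refl) auto
    then show ?thesis using that by (simp add: sum.delta')
  qed
  have "lists_solution I T s y"
    unfolding lists_solution_def Let_def cnt nat_int
  proof (intro conjI allI impI ballI)
    fix e assume e: "e < cnt"
    show "\<exists>(i, K)\<in>lp_vars I T. entry_at (manips I) s e i K \<and> 0 < arr s ''den'' (int e) \<and>
        y i K = of_int (arr s ''num'' (int e)) / of_int (arr s ''den'' (int e))"
    proof (rule bexI[of _ "(it e, C e)"])
      show "(it e, C e) \<in> lp_vars I T" using it(1,2)[OF e] C[OF e] by (simp add: lp_vars_def m_def)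
      show "case (it e, C e) of (i, K) \<Rightarrow> entry_at (manips I) s e i K \<and> 0 < arr s ''den'' (int e) \<and>
        y i K = of_int (arr s ''num'' (int e)) / of_int (arr s ''den'' (int e))"
        using entry[OF e] val[OF e] e1 e D by (simp add: k_def D_def)
    qed
  next
    fix v assume "v \<in> lp_vars I T"
    obtain i K where v: "v = (i, K)" by (cases v)
    have "y i K = 0" if no: "\<nexists>e. e < cnt \<and> entry_at (manips I) s e i K"
    proof -
      have "\<not> (it e = i \<and> C e = K)" if "e < cnt" for e
        using no entry[OF that] that by (auto simp: k_def)
      then show ?thesis unfolding y_def by (intro sum.neutral) auto
    qed
    then show "case v of (i, K) \<Rightarrow> (\<nexists>e. e < cnt \<and> entry_at (manips I) s e i K) \<longrightarrow> y i K = 0"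
      by (simp add: v)
  qed
  ultimately show ?thesis by blast
qed

end

text \<open>Without candidates or without manipulators there are no covering constraints. Then 0 is
  a solution, and the empty list in the untouched output arrays represents it.\<close>

definition CONFIG_LP :: com where
  "CONFIG_LP =
     If (Conj (Less (N 0) (V ''m'')) (Less (N 0) (V ''k'')))
       (BUILD;;
        SOLVE;;
        If (Less (N 0) (V ''feasible'')) DECODE Skip)
       (Assign ''feasible'' (N 1))"

lemma (in flow_lp) wp_solve_decode:
  fixes R :: nat
  defines "R \<equiv> k * m + m * k * S"
  assumes s: "inp s" "colarr s" "rows_are R lp_rows s" "arr s ''pw'' (- 1) = 0"
    and b: "n + R \<le> b" "(n + n * R + n * R) * (R + 1) + 1 \<le> b" "4 * n ^ 3 + 1 \<le> b" "n * (n * R + 1) + 1 \<le> b"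
  shows "wp b (Seq SOLVE (If (Less (N 0) (V ''feasible'')) DECODE Skip)) (solves_config_lp I T) s"
proof -
  define A where "A = matrow s"
  have A: "lp_rows = A ` {..<R}" using s(3) by (simp add: rows_are_def A_def)
  interpret solver: lp_data n R b "n * R" "(n + n * R + n * R) * (R + 1) + 1" A
  proof
    show "\<bar>A r c\<bar> \<le> 1" if "r < R" for r c
      using that by (intro lp_rows_abs_le) (simp add: A)
  qed (use n_ge1 b in auto)
  have kern_iff: "kern n R A x \<longleftrightarrow> is_flow x" for x
    unfolding lp_rows_iff_flow[symmetric] A by (auto simp: kern_def)
  have int_iff: "(\<forall>r<R. (\<Sum>c<n. A r c * x c) = 0) \<longleftrightarrow> is_flow x" for x :: "nat \<Rightarrow> int"
    unfolding lp_rows_iff_flow[symmetric] A by auto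
  have nR: "var s ''n'' = int n" "var s ''R'' = int R" 
    using s by (auto simp: colarrD rows_are_def)
  have As: "arr s ''A'' (int r * int n + int c) = A r c" if "r < R" "c < n" for r c
    using that by (simp add: A_def matrow_def trunc_at_n_def)
  show ?thesis
  proof (rule wp_Seq, rule wp_conseq[OF solver.wp_SOLVE[OF nR s(4) As]], assumption, assumption, goal_cases)
    case (1 s1)
    have i1: "inp s1" by (rule inp_frame[OF 1(1) s(1)]) auto
    have c1: "colarr s1" by (rule colarr_frame[OF 1(1) s(2)]) auto
    from 1(2) show ?case
    proof (elim disjE conjE)
      assume f: "var s1 ''feasible'' = 1" and x: "\<forall>c<n. 0 \<le> arr s1 ''x'' (int c)" "0 < arr s1 ''x'' 0"
        "\<forall>r<R. (\<Sum>c<n. A r c * arr s1 ''x'' (int c)) = 0"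
      interpret fs: flow_solution I T b m k S n ci cl cs cj ct "\<lambda>c. arr s1 ''x'' (int c)"
        by unfold_locales (use x int_iff in auto)
      have "wp b DECODE (solves_config_lp I T) s1"
      proof (rule wp_conseq[OF fs.wp_DECODE[OF i1 c1 refl]])
        fix s2 assume fr: "frame DECODE s1 s2" and "\<exists>cnt it p nm. fs.base (Suc m) cnt it p nm s2"
        then have "\<exists>y. lp_feasible I T y \<and> lists_solution I T s2 y" using fs.decoded_solution by blast
        moreover have "var s2 ''feasible'' = 1" using f frame_var[OF fr, of "''feasible''"] by simp
        ultimately show "solves_config_lp I T s2" by (auto simp: solves_config_lp_def)
      qed
      then show ?thesis using f by (intro wp_If) auto
    next
      assume f: "var s1 ''feasible'' = 0" and no: "\<not> (\<exists>x. kern n R A x \<and> (\<forall>i<n. 0 \<le> x i) \<and> 0 < x 0)"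
      have "\<not> (\<exists>y. lp_feasible I T y)"
      proof
        assume "\<exists>y. lp_feasible I T y"
        then obtain y where y: "lp_feasible I T y" by blast
        have "kern n R A (flow_of y)" unfolding kern_iff by (rule is_flow_flow_of[OF y])
        moreover have "0 < flow_of y 0" by (simp add: flow_of_def)
        ultimately show False using no flow_of_nonneg[OF y] by blast
      qed
      then show ?thesis using f by (intro wp_If wp_Skip) (auto simp: solves_config_lp_def)
    qed
  qed
qed

text \<open>The sum of all loop bounds instead of their maximum, which makes it a polynomial
  expression that is monotone in \<open>S\<close>. The numbers of columns and rows are replaced by
  their bounds in terms of \<open>m\<close>, \<open>k\<close> and \<open>S\<close>.\<close>

definition iteration_bound :: "nat \<Rightarrow> nat \<Rightarrow> nat \<Rightarrow> nat" where
  "iteration_bound m k S =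
    (let n = 1 + m * k * S * m; R = k * m + m * k * S in
     m + k + S + n + R + ((n + n * R + n * R) * (R + 1) + 1) + (4 * n ^ 3 + 1) + (n * (n * R + 1) + 1))"

lemma iteration_bound_mono: "S \<le> S' \<Longrightarrow> iteration_bound m k S \<le> iteration_bound m k S'"
  unfolding iteration_bound_def Let_def by (intro add_mono mult_mono power_mono le_refl) simp_all

lemma iteration_bound_ge:
  "m \<le> iteration_bound m k S" "k \<le> iteration_bound m k S" "S \<le> iteration_bound m k S"
  "1 + m * k * S * m \<le> iteration_bound m k S"
  unfolding iteration_bound_def Let_def by linarith+

lemma (in wcm_lp) wp_BUILD_SOLVE_DECODE:
  assumes s: "inp s" and z: "\<And>a. a \<in> {''ci'', ''cl'', ''cs'', ''cj'', ''ct'', ''pw''} \<Longrightarrow> arr s a = (\<lambda>_. 0)"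
    and b: "iteration_bound m k S \<le> b"
  shows "wp b (Seq BUILD (Seq SOLVE (If (Less (N 0) (V ''feasible'')) DECODE Skip))) (solves_config_lp I T) s"
  unfolding BUILD_def
proof (intro wp_Seq, rule wp_conseq[OF wp_SIZES[OF s]], goal_cases)
  case (1 s1)
  note fr1 = frameD[OF 1(1), simplified]
  have i1: "inp s1" by (rule inp_frame[OF 1(1) s]) auto
  have z1: "arr s1 a = (\<lambda>_. 0)" if "a \<in> {''ci'', ''cl'', ''cs'', ''cj'', ''ct''}" for a
    using z that by (auto simp: fr1)
  show ?case
  proof (intro wp_Seq, rule wp_conseq[OF wp_COLUMNS[OF i1 1(2) z1]], assumption, goal_cases)
    case (1 s2)
    note fr2 = frameD[OF 1(1), simplified]
    have i2: "inp s2" by (rule inp_frame[OF 1(1) i1]) auto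
    have S2: "var s2 ''S'' = int S" using \<open>var s1 ''S'' = int S\<close> by (simp add: fr2)
    from 1(2) obtain n where n: "var s2 ''n'' = int n" "1 \<le> n" "inj_on (attr s2) {1..<n}" "attr s2 ` {1..<n} = allowed"
      and nn: "\<forall>c. 0 \<le> arr s2 ''ci'' (int c) \<and> 0 \<le> arr s2 ''cl'' (int c) \<and> 0 \<le> arr s2 ''cs'' (int c) \<and> 0 \<le> arr s2 ''cj'' (int c)"
      and ct: "\<forall>c. 1 \<le> c \<longrightarrow> c < n \<longrightarrow> arr s2 ''ct'' (int c) = arr s2 ''cs'' (int c) +
        int (w (nat (arr s2 ''cl'' (int c))) * \<alpha> (nat (arr s2 ''cj'' (int c))))"
      and zz: "arr s2 ''ci'' 0 = 0" "arr s2 ''cl'' 0 = 0" "arr s2 ''cs'' 0 = 0" "arr s2 ''cj'' 0 = 0" "arr s2 ''ct'' 0 = 0"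
      unfolding columns_are_def by blast
    have ctn: "0 \<le> arr s2 ''ct'' (int c)" if "c < n" for c
    proof (cases "c = 0")
      case True
      then show ?thesis using zz by simp
    next
      case False
      then have "arr s2 ''ct'' (int c) = arr s2 ''cs'' (int c) +
          int (w (nat (arr s2 ''cl'' (int c))) * \<alpha> (nat (arr s2 ''cj'' (int c))))"
        using ct that by simp
      then show ?thesis using nn by simp
    qed
    interpret fl: flow_lp I T b m k S n "\<lambda>c. nat (arr s2 ''ci'' (int c))" "\<lambda>c. nat (arr s2 ''cl'' (int c))"
      "\<lambda>c. nat (arr s2 ''cs'' (int c))" "\<lambda>c. nat (arr s2 ''cj'' (int c))" "\<lambda>c. nat (arr s2 ''ct'' (int c))"
    proof
      show "nat (arr s2 ''ct'' (int c)) = nat (arr s2 ''cs'' (int c)) + w (nat (arr s2 ''cl'' (int c))) * \<alpha> (nat (arr s2 ''cj'' (int c)))"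
        if "1 \<le> c" "c < n" for c
        using ct nn that by (simp add: nat_add_distrib del: of_nat_mult)
    qed (use n zz in \<open>auto simp: attr_def[abs_def]\<close>)
    have c2: "fl.colarr s2"
      using nn ctn n by (simp add: fl.colarr_def)
    have "n - 1 = card (attr s2 ` {1..<n})" unfolding card_image[OF n(3)] by simp
    also have "\<dots> \<le> m * k * S * m" unfolding n(4) by (rule card_allowed)
    finally have n_le: "n \<le> 1 + m * k * S * m" by linarith
    show ?case
    proof (rule wp_conseq[OF fl.wp_ROWS[OF i2 S2 c2]], rule fl.wp_solve_decode, goal_cases)
      case (1 s3)
      show ?case by (rule inp_frame[OF 1(1) i2]) auto
    next
      case (2 s3)
      show ?case by (rule fl.colarr_frame[OF 2(1) c2]) auto
    next
      case (3 s3)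
      then show ?case by simp
    next
      case (4 s3)
      then show ?case using z frame_arr[OF 4(1), of "''pw''"] by (simp add: fr2 fr1)
    next
      case (5 s3)
      show ?case using n_le b unfolding iteration_bound_def Let_def by linarith
    next
      case (6 s3)
      let ?R = "k * m + m * k * S" and ?n = "1 + m * k * S * m"
      have "(n + n * ?R + n * ?R) * (?R + 1) + 1 \<le> (?n + ?n * ?R + ?n * ?R) * (?R + 1) + 1"
        using n_le by (intro add_mono mult_mono le_refl) auto
      also have "\<dots> \<le> b" using b unfolding iteration_bound_def Let_def by linarith
      finally show ?case .
    next
      case (7 s3)
      let ?n = "1 + m * k * S * m"
      have "4 * n ^ 3 + 1 \<le> 4 * ?n ^ 3 + 1" using n_le by (intro add_mono mult_mono power_mono le_refl) auto
      also have "\<dots> \<le> b" using b unfolding iteration_bound_def Let_def by linarith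
      finally show ?case .
    next
      case (8 s3)
      let ?R = "k * m + m * k * S" and ?n = "1 + m * k * S * m"
      have "n * (n * ?R + 1) + 1 \<le> ?n * (?n * ?R + 1) + 1" using n_le by (intro add_mono mult_mono le_refl) auto
      also have "\<dots> \<le> b" using b unfolding iteration_bound_def Let_def by linarith
      finally show ?case .
    qed
  qed
qed

lemma wp_CONFIG_LP:
  assumes "wcm_instance I"
    and bound: "0 < cands I \<Longrightarrow> iteration_bound (cands I) (manips I) (total_weight I * score I (cands I - 1) + 1) \<le> b"
  shows "wp b CONFIG_LP (solves_config_lp I T) (input I T)"
  unfolding CONFIG_LP_def
proof (rule wp_If, goal_cases)
  case 1
  then have pos: "0 < cands I" "0 < manips I" by (simp_all add: input_def)
  note b = bound[OF pos(1)]
  interpret wcm_lp I T b "cands I" "manips I" "total_weight I * score I (cands I - 1) + 1"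
  proof
    show "cands I \<le> b" by (rule order_trans[OF iteration_bound_ge(1) b])
    show "manips I \<le> b" by (rule order_trans[OF iteration_bound_ge(2) b])
    show "total_weight I * score I (cands I - 1) + 1 \<le> b" by (rule order_trans[OF iteration_bound_ge(3) b])
    show "1 + cands I * manips I * (total_weight I * score I (cands I - 1) + 1) * cands I \<le> b"
      by (rule order_trans[OF iteration_bound_ge(4) b])
  qed (use assms(1) pos in auto)
  have "inp (input I T)" by (simp add: inp_def input_def)
  then show ?case by (rule wp_BUILD_SOLVE_DECODE) (use b in \<open>auto simp: input_def\<close>)
next
  case 2
  then have triv: "cands I = 0 \<or> manips I = 0" by (simp add: input_def)
  define s where "s = setv ''feasible'' 1 (input I T)"
  have "lp_feasible I T (\<lambda>_ _. 0)" using triv by (auto simp: lp_feasible_def)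
  moreover have "lists_solution I T s (\<lambda>_ _. 0)"
    by (auto simp: lists_solution_def s_def input_def)
  ultimately have "solves_config_lp I T s" by (auto simp: solves_config_lp_def s_def)
  then show ?case by (intro wp_Assign) (simp add: s_def)
qed

section \<open>Polynomial bounds\<close>

primrec cost_poly :: "com \<Rightarrow> nat poly" where
  "cost_poly Skip = 1"
| "cost_poly (Assign x e) = [:acost e + 1:]"
| "cost_poly (Store a d e) = [:acost d + acost e + 1:]"
| "cost_poly (Seq c d) = cost_poly c + cost_poly d"
| "cost_poly (If e c d) = [:bcost e + 1:] + cost_poly c + cost_poly d"
| "cost_poly (While e c) = [:0, 1:] * ([:bcost e + 1:] + cost_poly c) + [:bcost e + 1:]"

lemma poly_cost_poly: "poly (cost_poly c) b = cost c b"
  by (induction c) (simp_all add: algebra_simps)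

text \<open>Closure under the arithmetic operations makes it possible to derive the existence of the
  final polynomial from the shape of the bound, without writing the polynomial down.\<close>

definition polynomial3 :: "(nat \<Rightarrow> nat \<Rightarrow> nat \<Rightarrow> nat) \<Rightarrow> bool" where
  "polynomial3 f \<longleftrightarrow> (\<exists>P. \<forall>x y z. poly3 P x y z = f x y z)"

lemma polynomial3_const: "polynomial3 (\<lambda>x y z. c)"
  unfolding polynomial3_def by (rule exI[of _ "[:[:[:c:]:]:]"]) (simp add: poly3_def)

lemma polynomial3_vars: "polynomial3 (\<lambda>x y z. x)" "polynomial3 (\<lambda>x y z. y)" "polynomial3 (\<lambda>x y z. z)"
  unfolding polynomial3_def
  by (rule exI[of _ "[:0, 1:]"], simp add: poly3_def) (rule exI[of _ "[:[:0, 1:]:]"], simp add: poly3_def,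
      rule exI[of _ "[:[:[:0, 1:]:]:]"], simp add: poly3_def)

lemma polynomial3_add: "polynomial3 f \<Longrightarrow> polynomial3 g \<Longrightarrow> polynomial3 (\<lambda>x y z. f x y z + g x y z)"
proof -
  assume "polynomial3 f" "polynomial3 g"
  then obtain P Q where "\<forall>x y z. poly3 P x y z = f x y z" "\<forall>x y z. poly3 Q x y z = g x y z"
    unfolding polynomial3_def by blast
  then show ?thesis unfolding polynomial3_def by (intro exI[of _ "P + Q"]) (simp add: poly3_def)
qed

lemma polynomial3_mult: "polynomial3 f \<Longrightarrow> polynomial3 g \<Longrightarrow> polynomial3 (\<lambda>x y z. f x y z * g x y z)"
proof -
  assume "polynomial3 f" "polynomial3 g"
  then obtain P Q where "\<forall>x y z. poly3 P x y z = f x y z" "\<forall>x y z. poly3 Q x y z = g x y z"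
    unfolding polynomial3_def by blast
  then show ?thesis unfolding polynomial3_def by (intro exI[of _ "P * Q"]) (simp add: poly3_def)
qed

lemma polynomial3_power: "polynomial3 f \<Longrightarrow> polynomial3 (\<lambda>x y z. f x y z ^ d)"
  by (induction d) (simp_all add: polynomial3_const polynomial3_mult)

lemma polynomial3_poly: "polynomial3 f \<Longrightarrow> polynomial3 (\<lambda>x y z. poly p (f x y z))"
  by (induction p) (simp_all add: polynomial3_const polynomial3_mult polynomial3_add)

lemmas polynomial3_intros = polynomial3_const polynomial3_vars polynomial3_add polynomial3_mult
  polynomial3_power polynomial3_poly

theorem theorem4:
  fixes q :: "nat poly"
  shows "\<exists>(prog :: com) (P :: nat poly poly poly). \<forall>(I :: wcm) (T :: int).
    wcm_instance I \<and> scores_bounded q I \<longrightarrow>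
      (\<exists>t s. exec prog (input I T) t s \<and>
             t \<le> poly3 P (cands I) (manips I) (total_weight I) \<and>
             solves_config_lp I T s)"
proof -
  \<comment> \<open>The assumption on the scores replaces the largest score by
    \<open>poly q x\<close>, so that the bound depends on \<open>m\<close>, \<open>k\<close> and the
    total weight alone.\<close>
  define B where "B x y z = iteration_bound x y (z * poly q x + 1)" for x y z
  have "polynomial3 (\<lambda>x y z. poly (cost_poly CONFIG_LP) (B x y z))"
    unfolding B_def iteration_bound_def Let_def by (intro polynomial3_intros)
  then obtain P where P: "\<And>x y z. poly3 P x y z = poly (cost_poly CONFIG_LP) (B x y z)"
    unfolding polynomial3_def by blast
  show ?thesis
  proof (intro exI[of _ CONFIG_LP] exI[of _ P] allI impI)
    fix I T assume I: "wcm_instance I \<and> scores_bounded q I"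
    have "iteration_bound (cands I) (manips I) (total_weight I * score I (cands I - 1) + 1) \<le> B (cands I) (manips I) (total_weight I)"
      if "0 < cands I"
    proof -
      have "score I (cands I - 1) \<le> poly q (cands I)" using I that by (simp add: scores_bounded_def)
      then show ?thesis unfolding B_def by (intro iteration_bound_mono) simp
    qed
    from wp_CONFIG_LP[OF _ this] I have "wp (B (cands I) (manips I) (total_weight I)) CONFIG_LP (solves_config_lp I T) (input I T)"
      by blast
    then show "\<exists>t s. exec CONFIG_LP (input I T) t s \<and> t \<le> poly3 P (cands I) (manips I) (total_weight I) \<and> solves_config_lp I T s"
      unfolding wp_def P poly_cost_poly by blast
  qed
qed

end
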